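(* Define $J:\mathcal{M}_1^+(S^n)\to[0,\infty]$ by $$J(\nu)=\begin{cases}H(\nu\mid\mu) & \text{if } \nu\in\bigcap_{j=1}^n\mathcal{R}_j,\\ \infty & \text{otherwise.}\end{cases}$$ Then $\{L_{N,\alpha}\}$ satisfies a quenched large deviation principle with good rate function $J$; that is, for every $c\in\mathbb{R}$ the level set $\{\nu\in\mathcal{M}_1^+(S^n): J(\nu)\le c\}$ is compact in the weak topology, and for every weakly continuous bounded map $\Phi:\mathcal{M}_1^+(S^n)\to\mathbb{R}$, $$\lim_{N\to\infty}\frac1N\log\sum_{\alpha\in\Sigma_N}\exp\left[N\Phi(L_{N,\alpha})\right]=\log 2+\sup_{\nu\in\mathcal{M}_1^+(S^n)}\left[\Phi(\nu)-J(\nu)\right]\quad \mathbb{P}\text{-almost surely.}$$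
   Context: Let $S$ be a Polish space with its Borel $\sigma$-field, let $n\in\mathbb{N}$ be fixed, and let $\mu_1,\dots,\mu_n$ be Borel probability measures on $S$; put $\mu=\mu_1\otimes\cdots\otimes\mu_n$. For a Polish space $T$, $\mathcal{M}_1^+(T)$ denotes the set of Borel probability measures on $T$ with the weak topology. Let $\gamma_1,\dots,\gamma_n>0$ with $\sum_{k=1}^n\gamma_k=1$, and $\Gamma_j=\sum_{k=1}^j\gamma_k$. It is assumed that all $\gamma_kN$ are integers ($N$ runs over the positive integers with this property, assumed to be infinitely many, and limits $N\to\infty$ are along such $N$). Let $\Sigma_N=\prod_{k=1}^n\{1,\dots,2^{\gamma_kN}\}$, so $|\Sigma_N|=2^N$; write $\alpha=(\alpha_1,\dots,\alpha_n)\in\Sigma_N$. On a probability space $(\Omega,\mathcal{F},\mathbb{P})$, for each $N$, let $X^j_{\alpha_1,\dots,\alpha_j,i}$ ($1\le j\le n$, $1\le\alpha_k\le2^{\gamma_kN}$, $1\le i\le N$) be independent $S$-valued random variables, $X^j_{\alpha_1,\dots,\alpha_j,i}$ having distribution $\mu_j$. Put $$X_{\alpha,i}=\left(X^1_{\alpha_1,i},X^2_{\alpha_1,\alpha_2,i},\dots,X^n_{\alpha_1,\dots,\alpha_n,i}\right)\in S^n,\qquad L_{N,\alpha}=\frac1N\sum_{i=1}^N\delta_{X_{\alpha,i}}\in\mathcal{M}_1^+(S^n).$$ $H(\nu\mid\mu)$ is the relative entropy: $\int\log\frac{d\nu}{d\mu}\,d\nu$ if $\nu\ll\mu$, and $\infty$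 otherwise. For $\nu\in\mathcal{M}_1^+(S^n)$, $\nu^{(j)}$ denotes its marginal on the first $j$ coordinates (so $\mu^{(j)}=\mu_1\otimes\cdots\otimes\mu_j$), and $$\mathcal{R}_j=\left\{\nu\in\mathcal{M}_1^+(S^n): H(\nu^{(j)}\mid\mu^{(j)})\le\Gamma_j\log2\right\}.$$ *)

theory Defs
  imports "HOL-Probability.Probability"
begin

section \<open>Borel probability measures and the weak topology\<close>

definition borel_algebra :: "'t topology \<Rightarrow> 't measure" where
  "borel_algebra T = sigma (topspace T) {U. openin T U}"

definition prob_measures :: "'t topology \<Rightarrow> 't measure set" where
  "prob_measures T = {\<nu>. prob_space \<nu> \<and> sets \<nu> = sets (borel_algebra T)}"

text \<open>The coarsest topology on the Borel probability measures making \<open>\<nu> \<mapsto> \<integral>f d\<nu>\<close> continuous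
  for every bounded continuous \<open>f\<close>.\<close>

definition weak_topology :: "'t topology \<Rightarrow> 't measure topology" where
  "weak_topology T = topology_generated_by
     {{\<nu> \<in> prob_measures T. (\<integral>x. f x \<partial>\<nu>) \<in> U} | f U.
        continuous_map T euclideanreal f \<and> bounded (f ` topspace T) \<and> open U}"

text \<open>\<open>S\<^sup>j\<close> with coordinates \<open>1, \<dots>, j\<close>; points are functions that are \<open>undefined\<close> off \<open>{1..j}\<close>.\<close>

abbreviation power_top :: "nat \<Rightarrow> (nat \<Rightarrow> 'a::polish_space) topology" where
  "power_top j \<equiv> product_topology (\<lambda>_. euclidean) {1..j}"

lemma space_borel_algebra [simp]: "space (borel_algebra T) = topspace T"
  unfolding borel_algebra_def
  by (rule space_measure_of) (auto dest: openin_subset)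

lemma sets_borel_algebra:
  "sets (borel_algebra T) = sigma_sets (topspace T) {U. openin T U}"
  unfolding borel_algebra_def
  by (rule sets_measure_of) (auto dest: openin_subset)

lemma topspace_weak_topology [simp]: "topspace (weak_topology T) = prob_measures T"
proof -
  have "continuous_map T euclideanreal (\<lambda>_. 0) \<and> bounded ((\<lambda>_. 0::real) ` topspace T) \<and>
      open (UNIV :: real set)"
    by (auto intro: bounded_subset[of "{0}"])
  moreover have "prob_measures T = {\<nu> \<in> prob_measures T. (\<integral>x. (0::real) \<partial>\<nu>) \<in> UNIV}"
    by simp
  ultimately show ?thesis
    unfolding weak_topology_def topology_generated_by_topspace by blast
qed

text \<open>On \<open>S\<^sup>j\<close> the Borel and the product \<open>\<sigma>\<close>-algebra agree, \<open>S\<close> being second countable.\<close>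

lemma sets_borel_algebra_power_top:
  "sets (borel_algebra (power_top j :: (nat \<Rightarrow> 'a::polish_space) topology)) =
     sets (PiM {1..j} (\<lambda>_. borel))"
proof
  let ?T = "power_top j :: (nat \<Rightarrow> 'a) topology"
  let ?P = "PiM {1..j} (\<lambda>_. borel :: 'a measure)"
  have top: "topspace ?T = ({1..j} \<rightarrow>\<^sub>E UNIV)" and sp: "space ?P = ({1..j} \<rightarrow>\<^sub>E UNIV)"
    by (auto simp: space_PiM)
  have "U \<in> sets ?P" if U: "openin ?T U" for U
  proof -
    let ?r = "\<lambda>x::nat \<Rightarrow> 'a. restrict x {1..j}"
    have "continuous_map (product_topology (\<lambda>_::nat. euclidean :: 'a topology) UNIV) ?T ?r"
    proof (subst continuous_map_componentwise, intro conjI ballI)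
      fix k assume "k \<in> {1..j}"
      then show "continuous_map (product_topology (\<lambda>_::nat. euclidean :: 'a topology) UNIV)
          euclidean (\<lambda>x. ?r x k)"
        using continuous_map_product_projection[of k UNIV "\<lambda>_::nat. euclidean :: 'a topology"]
        by simp
    qed auto
    then have c: "continuous_map euclidean ?T ?r"
      by (simp add: euclidean_product_topology)
    have o: "open {x. ?r x \<in> U}"
      using openin_continuous_map_preimage[OF c U] by simp
    then have b: "{x. ?r x \<in> U} \<in> sets (PiM UNIV (\<lambda>_::nat. borel :: 'a measure))"
      unfolding sets_PiM_equal_borel by (rule borel_open)
    have m: "(\<lambda>x. x) \<in> measurable ?P (PiM UNIV (\<lambda>_::nat. borel :: 'a measure))"
    proof (rule measurable_PiM_single')
      fix i :: nat
      show "(\<lambda>x. x i) \<in> measurable ?P (borel :: 'a measure)"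
      proof (cases "i \<in> {1..j}")
        case True
        then show ?thesis by (rule measurable_component_singleton)
      next
        case False
        have "(\<lambda>x. x i) \<in> measurable ?P (borel :: 'a measure) \<longleftrightarrow>
            (\<lambda>x. undefined) \<in> measurable ?P (borel :: 'a measure)"
          by (rule measurable_cong) (use False in \<open>auto simp: space_PiM PiE_def extensional_def\<close>)
        then show ?thesis by simp
      qed
    qed auto
    have "U = (\<lambda>x. x) -` {x. ?r x \<in> U} \<inter> space ?P"
      using openin_subset[OF U] unfolding top sp
      by (auto simp: PiE_restrict subset_iff)
    then show ?thesis
      using measurable_sets[OF m b] by simp
  qed
  then show "sets (borel_algebra ?T) \<subseteq> sets ?P"
    unfolding sets_borel_algebra top sp[symmetric] by (intro sets.sigma_sets_subset) auto
  have "{x \<in> topspace ?T. x i \<in> A} \<in> sets (borel_algebra ?T)"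
    if "i \<in> {1..j}" "A \<in> sets borel" for i and A :: "'a set"
  proof -
    have "(\<lambda>x. x i) \<in> measurable (borel_algebra ?T) borel"
    proof (rule borel_measurableI)
      fix V :: "'a set" assume "open V"
      have "openin ?T {x \<in> topspace ?T. x i \<in> V}"
        using \<open>open V\<close> that(1)
        by (intro openin_continuous_map_preimage[OF continuous_map_product_projection]) auto
      then have "{x \<in> topspace ?T. x i \<in> V} \<in> sets (borel_algebra ?T)"
        unfolding sets_borel_algebra by auto
      moreover have "(\<lambda>x. x i) -` V \<inter> space (borel_algebra ?T) = {x \<in> topspace ?T. x i \<in> V}"
        by auto
      ultimately show "(\<lambda>x. x i) -` V \<inter> space (borel_algebra ?T) \<in> sets (borel_algebra ?T)"
        by simp
    qed
    from measurable_sets[OF this that(2)] show ?thesis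
      by (simp add: vimage_def Int_def conj_commute)
  qed
  then have "(\<lambda>x. x) \<in> measurable (borel_algebra ?T) ?P"
    by (intro measurable_PiM_single) (auto simp: top)
  then have m: "(\<lambda>x. x) \<in> measurable (borel_algebra ?T) ?P" .
  show "sets ?P \<subseteq> sets (borel_algebra ?T)"
  proof
    fix A assume A: "A \<in> sets ?P"
    have "(\<lambda>x. x) -` A \<inter> space (borel_algebra ?T) = A"
      using sets.sets_into_space[OF A] unfolding sp space_borel_algebra top by auto
    with measurable_sets[OF m A] show "A \<in> sets (borel_algebra ?T)" by simp
  qed
qed


section \<open>Relative entropy\<close>

text \<open>\<open>KL_divergence\<close> is real-valued. If the log-density is not \<open>\<nu>\<close>-integrable then the integral
  is \<open>\<infinity>\<close>, because its negative part always has finite integral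
  (\<open>t * ln t \<ge> - 1 / e\<close>).\<close>

definition rel_entropy :: "'t measure \<Rightarrow> 't measure \<Rightarrow> ereal" where
  "rel_entropy \<nu> \<mu> =
     (if absolutely_continuous \<mu> \<nu> \<and> integrable \<nu> (entropy_density (exp 1) \<mu> \<nu>)
      then ereal (KL_divergence (exp 1) \<mu> \<nu>) else \<infinity>)"

lemma rel_entropy_nonneg:
  assumes "prob_space \<mu>" "prob_space \<nu>" "sets \<nu> = sets \<mu>"
  shows "0 \<le> rel_entropy \<nu> \<mu>"
proof (cases "absolutely_continuous \<mu> \<nu> \<and> integrable \<nu> (entropy_density (exp 1) \<mu> \<nu>)")
  case True
  interpret M: prob_space \<mu> by fact
  interpret N: prob_space \<nu> by fact
  interpret information_space \<mu> "exp 1" by standard simp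
  have "finite_measure \<nu>" by unfold_locales
  from M.real_RN_deriv[OF this _ assms(3)] True obtain D where
    D: "D \<in> borel_measurable \<mu>" "AE x in \<mu>. RN_deriv \<mu> \<nu> x = ennreal (D x)"
       "AE x in \<nu>. 0 < D x" "\<And>x. 0 \<le> D x"
    by auto
  have ac: "absolutely_continuous \<mu> \<nu>"
    and int: "integrable \<nu> (entropy_density (exp 1) \<mu> \<nu>)"
    using True by auto
  have "\<nu> = density \<mu> (RN_deriv \<mu> \<nu>)"
    using ac assms(3) by (rule M.density_RN_deriv[symmetric])
  also have "\<dots> = density \<mu> D"
    using D by (auto intro!: density_cong)
  finally have N: "\<nu> = density \<mu> D" .
  from absolutely_continuous_AE[OF assms(3) ac D(2)] D measurable_entropy_density[of "exp 1" \<mu> \<nu>]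
  have "integrable \<nu> (\<lambda>x. log (exp 1) (D x))"
    by (intro integrable_cong_AE[THEN iffD2, OF _ _ _ int]) (auto simp: N entropy_density_def)
  with D have "integrable \<mu> (\<lambda>x. D x * log (exp 1) (D x))"
    by (subst integrable_real_density[symmetric]) (auto simp: N[symmetric] comp_def)
  then have "0 \<le> KL_divergence (exp 1) \<mu> \<nu>"
    using D \<open>prob_space \<nu>\<close> unfolding N by (intro KL_nonneg) auto
  with True show ?thesis by (simp add: rel_entropy_def)
qed (auto simp: rel_entropy_def)


section \<open>The hierarchical model\<close>

definition empirical_measure :: "'t topology \<Rightarrow> nat \<Rightarrow> (nat \<Rightarrow> 't) \<Rightarrow> 't measure" where
  "empirical_measure T N x = measure_of (topspace T) (sets (borel_algebra T))
     (\<lambda>A. (\<Sum>i=1..N. emeasure (return (borel_algebra T) (x i)) A) / of_nat N)"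

lemma sets_empirical_measure [simp]:
  "sets (empirical_measure T N x) = sets (borel_algebra T)"
  unfolding empirical_measure_def
  by (metis sets.sigma_sets_eq sets_measure_of sets.space_closed space_borel_algebra)

lemma emeasure_empirical_measure:
  assumes "A \<in> sets (borel_algebra T)"
  shows "emeasure (empirical_measure T N x) A = (\<Sum>i=1..N. indicator A (x i)) / of_nat N"
proof -
  let ?B = "borel_algebra T"
  let ?f = "\<lambda>A. (\<Sum>i=1..N. emeasure (return ?B (x i)) A) / of_nat N"
  have "countably_additive (sets ?B) ?f"
  proof (rule countably_additiveI)
    fix F :: "nat \<Rightarrow> 'a set"
    assume F: "range F \<subseteq> sets ?B" "disjoint_family F" "\<Union> (range F) \<in> sets ?B"
    have "(\<Sum>k. ?f (F k)) = (\<Sum>k. \<Sum>i=1..N. emeasure (return ?B (x i)) (F k)) / of_nat N"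
      by (simp add: ennreal_suminf_divide)
    also have "(\<Sum>k. \<Sum>i=1..N. emeasure (return ?B (x i)) (F k)) =
        (\<Sum>i=1..N. \<Sum>k. emeasure (return ?B (x i)) (F k))"
      by (rule suminf_sum) simp
    also have "\<dots> = (\<Sum>i=1..N. emeasure (return ?B (x i)) (\<Union> (range F)))"
      using F by (intro sum.cong refl suminf_emeasure) auto
    finally show "(\<Sum>k. ?f (F k)) = ?f (\<Union> (range F))" .
  qed
  moreover have "positive (sets ?B) ?f" by (auto simp: positive_def)
  ultimately have "emeasure (empirical_measure T N x) A = ?f A"
    using assms sets.sigma_algebra_axioms[of ?B] unfolding empirical_measure_def
    by (intro emeasure_measure_of_sigma) auto
  then show ?thesis using assms by simp
qed

lemma empirical_measure_in_prob_measures: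
  assumes "N > 0" "\<And>i. i \<in> {1..N} \<Longrightarrow> x i \<in> topspace T"
  shows "empirical_measure T N x \<in> prob_measures T"
proof -
  have "space (empirical_measure T N x) = topspace T"
    using sets_eq_imp_space_eq[OF sets_empirical_measure[of T N x]] by simp
  moreover have "topspace T \<in> sets (borel_algebra T)"
    using sets.top[of "borel_algebra T"] by simp
  ultimately have "emeasure (empirical_measure T N x) (space (empirical_measure T N x)) = 1"
    using assms ennreal_divide_self[of "of_nat N"]
    by (simp add: emeasure_empirical_measure ennreal_of_nat_eq_real_of_nat)
  then show ?thesis unfolding prob_measures_def by (auto intro: prob_spaceI)
qed

text \<open>The admissible \<open>N\<close> are those for which the floor in \<open>num_branches\<close> is exact.\<close>

definition admissible :: "nat \<Rightarrow> (nat \<Rightarrow> real) \<Rightarrow> nat set" where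
  "admissible n \<gamma> = {N. N > 0 \<and> (\<forall>k\<in>{1..n}. \<gamma> k * real N \<in> \<int>)}"

definition num_branches :: "(nat \<Rightarrow> real) \<Rightarrow> nat \<Rightarrow> nat \<Rightarrow> nat" where
  "num_branches \<gamma> N k = 2 ^ nat \<lfloor>\<gamma> k * real N\<rfloor>"

text \<open>\<open>branches \<gamma> N j\<close> consists of the index vectors \<open>(\<alpha>\<^sub>1, \<dots>, \<alpha>\<^sub>j)\<close>;
  for \<open>j = n\<close> it is \<open>\<Sigma>\<^sub>N\<close>.\<close>

definition branches :: "(nat \<Rightarrow> real) \<Rightarrow> nat \<Rightarrow> nat \<Rightarrow> (nat \<Rightarrow> nat) set" where
  "branches \<gamma> N j = (\<Pi>\<^sub>E k\<in>{1..j}. {1..num_branches \<gamma> N k})"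

definition rv_indices :: "nat \<Rightarrow> (nat \<Rightarrow> real) \<Rightarrow> nat \<Rightarrow> (nat \<times> (nat \<Rightarrow> nat) \<times> nat) set" where
  "rv_indices n \<gamma> N = {(j, \<beta>, i). j \<in> {1..n} \<and> \<beta> \<in> branches \<gamma> N j \<and> i \<in> {1..N}}"

text \<open>\<open>X N j \<beta> i\<close> is \<open>X\<^sup>j\<close> at size \<open>N\<close>, index vector \<open>\<beta> = (\<alpha>\<^sub>1, \<dots>, \<alpha>\<^sub>j)\<close> and site \<open>i\<close>.\<close>

definition path_point ::
  "nat \<Rightarrow> (nat \<Rightarrow> nat \<Rightarrow> (nat \<Rightarrow> nat) \<Rightarrow> nat \<Rightarrow> 'w \<Rightarrow> 'a) \<Rightarrow> nat \<Rightarrow> (nat \<Rightarrow> nat) \<Rightarrow> nat \<Rightarrow> 'w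
     \<Rightarrow> (nat \<Rightarrow> 'a)" where
  "path_point n X N \<alpha> i \<omega> = (\<lambda>j\<in>{1..n}. X N j (restrict \<alpha> {1..j}) i \<omega>)"

definition path_empirical ::
  "nat \<Rightarrow> (nat \<Rightarrow> nat \<Rightarrow> (nat \<Rightarrow> nat) \<Rightarrow> nat \<Rightarrow> 'w \<Rightarrow> 'a::polish_space) \<Rightarrow> nat \<Rightarrow> (nat \<Rightarrow> nat) \<Rightarrow> 'w
     \<Rightarrow> (nat \<Rightarrow> 'a) measure" where
  "path_empirical n X N \<alpha> \<omega> = empirical_measure (power_top n) N (\<lambda>i. path_point n X N \<alpha> i \<omega>)"


section \<open>The rate function\<close>

definition marginal :: "nat \<Rightarrow> (nat \<Rightarrow> 'a::polish_space) measure \<Rightarrow> (nat \<Rightarrow> 'a) measure" where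
  "marginal j \<nu> = distr \<nu> (borel_algebra (power_top j)) (\<lambda>x. restrict x {1..j})"

definition entropy_region ::
  "nat \<Rightarrow> (nat \<Rightarrow> real) \<Rightarrow> (nat \<Rightarrow> 'a::polish_space measure) \<Rightarrow> nat \<Rightarrow> (nat \<Rightarrow> 'a) measure set" where
  "entropy_region n \<gamma> \<mu> j = {\<nu> \<in> prob_measures (power_top n).
     rel_entropy (marginal j \<nu>) (PiM {1..j} \<mu>) \<le> ereal ((\<Sum>k=1..j. \<gamma> k) * ln 2)}"

definition rate ::
  "nat \<Rightarrow> (nat \<Rightarrow> real) \<Rightarrow> (nat \<Rightarrow> 'a::polish_space measure) \<Rightarrow> (nat \<Rightarrow> 'a) measure \<Rightarrow> ereal" where
  "rate n \<gamma> \<mu> \<nu> =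
     (if \<nu> \<in> (\<Inter>j\<in>{1..n}. entropy_region n \<gamma> \<mu> j)
      then rel_entropy \<nu> (PiM {1..n} \<mu>) else \<infinity>)"

lemma rate_nonneg:
  assumes \<mu>: "\<And>k. k \<in> {1..n} \<Longrightarrow> prob_space (\<mu> k) \<and> sets (\<mu> k) = sets borel"
    and \<nu>: "\<nu> \<in> prob_measures (power_top n)"
  shows "0 \<le> rate n \<gamma> \<mu> \<nu>"
proof -
  have "prob_space (PiM {1..n} \<mu>)"
    using \<mu> by (intro prob_space_PiM) auto
  moreover have "sets (PiM {1..n} \<mu>) = sets (PiM {1..n} (\<lambda>_. borel))"
    using \<mu> by (intro sets_PiM_cong) auto
  ultimately have "0 \<le> rel_entropy \<nu> (PiM {1..n} \<mu>)"
    using \<nu> by (intro rel_entropy_nonneg)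
      (simp_all only: prob_measures_def sets_borel_algebra_power_top mem_Collect_eq)
  then show ?thesis by (simp add: rate_def)
qed

end

theory Submission
  imports Defs
begin

text \<open>
  Write \<open>\<mu>\<^sup>j\<close> for \<open>\<mu>\<^sub>1 \<otimes> \<dots> \<otimes> \<mu>\<^sub>j\<close>, \<open>\<nu>\<^sup>j\<close> for the marginal of \<open>\<nu>\<close> on the first \<open>j\<close> coordinates, and
  \<open>\<Gamma> j\<close> for \<open>\<gamma>\<^sub>1 + \<dots> + \<gamma>\<^sub>j\<close>, so that level \<open>j\<close> of the tree has \<open>2\<^sup>N\<^sup>\<Gamma>\<^sup>j\<close> nodes.

  The level sets are compact for the following reason. By the variational formula of Donsker and
  Varadhan, \<open>H(\<nu> | \<mu>) \<le> c\<close> says exactly that \<open>\<integral>f d\<nu> \<le> c + ln (\<integral>e\<^sup>f d\<mu>)\<close> for every bounded measurable \<open>f\<close>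
  (\<open>integral_le_rel_entropy_plus_log_mgf\<close>, \<open>rel_entropy_le_if_integral_le\<close>). So a probability measure
  is best viewed as a positive normalised linear functional on the bounded measurable functions. By
  Tychonoff's theorem these functionals form a compact space (\<open>compact_means\<close>), in which the entropy
  bounds are closed conditions. Conversely a functional obeying one such bound is small on indicators
  of sets of small \<open>\<mu>\<close>-measure, hence countably additive, hence a measure (\<open>means_represented\<close>).
  The level sets of the rate function are thus continuous images of compact sets of functionals.
  The same compact space does the work of exponential tightness in the upper bound.

  For the upper bound, count. The expected number of level \<open>j\<close> nodes whose sample average of \<open>f\<close> exceeds \<open>a\<close> is at
  most \<open>exp (N (\<Gamma> j ln 2 - a + ln (\<integral>e\<^sup>f d\<mu>\<^sup>j)))\<close>, and by Markov's inequality and the Borel-Cantelli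
  lemma the actual number obeys the same bound up to a factor \<open>e\<^sup>N\<^sup>\<epsilon>\<close>
  (\<open>eventually_count_branches_le\<close>). Near a functional that violates the \<open>j\<close>-th entropy constraint,
  \<open>f\<close> and \<open>a\<close> can be chosen with a negative exponent: no branch comes near it. Near a \<open>\<nu>\<close> that
  satisfies all of them, \<open>j = n\<close> and a nearly optimal \<open>f\<close> leave at most
  \<open>exp (N (ln 2 - H(\<nu> | \<mu>) + 2 \<epsilon>))\<close> branches. Finitely many such neighbourhoods cover the space.

  For the lower bound, compute a second moment. Mixing \<open>\<nu>\<close> with a little of \<open>\<mu>\<close> makes all the
  constraints strict without raising the entropy (\<open>approximate_strictly\<close>), so suppose that \<open>h j = H(\<nu>\<^sup>j | \<mu>\<^sup>j) < \<Gamma> j ln 2\<close> for all \<open>j\<close>.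
  Let \<open>D j = d\<nu>\<^sup>j / d\<mu>\<^sup>j\<close>, let \<open>A\<close> be the set of samples whose empirical measure is close to \<open>\<nu>\<close> and for
  which \<open>\<Prod>\<^sub>i D j (x\<^sub>i) \<le> e\<^sup>N\<^sup>(\<^sup>h\<^sup>j\<^sup>+\<^sup>\<delta>\<^sup>)\<close> for all \<open>j\<close>, and consider the average \<open>W\<close> over all branches \<open>\<alpha>\<close> of
  the weights \<open>1\<^sub>A (X\<^sub>\<alpha>) \<Prod>\<^sub>i D n (X\<^sub>\<alpha>\<^sub>,\<^sub>i)\<close>. Its mean is the probability of \<open>A\<close> under i.i.d. samples from
  \<open>\<nu>\<close>, which tends to 1 by the weak law of large numbers. For two branches that split after level
  \<open>j \<ge> 1\<close>, integrating out the coordinates of the second one that the first one does not share turns the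
  weight of the second into at most \<open>\<Prod>\<^sub>i D j\<close> along the common part (\<open>nn_integral_branching_pair\<close>), which is at
  most \<open>e\<^sup>N\<^sup>(\<^sup>h\<^sup>j\<^sup>+\<^sup>\<delta>\<^sup>)\<close> on \<open>A\<close>. Branches that split at the root are independent, and a fraction
  \<open>2\<^sup>-\<^sup>N\<^sup>\<Gamma>\<^sup>j\<close> of the pairs share \<open>j\<close> levels, so the variance of \<open>W\<close> is at most
  \<open>\<Sum>\<^sub>j exp (- N (\<Gamma> j ln 2 - h j - \<delta>))\<close> (\<open>second_moment_bound\<close>). This is exponentially small, so
  almost surely \<open>W > 1/4\<close> for all large \<open>N\<close>. As no weight exceeds \<open>e\<^sup>N\<^sup>(\<^sup>h\<^sup>n\<^sup>+\<^sup>\<delta>\<^sup>)\<close>, at least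
  \<open>exp (N (ln 2 - h n - \<delta>)) / 4\<close> branches then lie in \<open>A\<close> (\<open>strict_lower_bound\<close>).
\<close>

section \<open>Relative entropy and log-moment generating functionals\<close>

definition bounded_measurable :: "'t measure \<Rightarrow> ('t \<Rightarrow> real) set" where
  "bounded_measurable M = {f \<in> borel_measurable M. bounded (f ` space M)}"

definition log_mgf :: "'t measure \<Rightarrow> ('t \<Rightarrow> real) \<Rightarrow> real" where
  "log_mgf M f = ln (\<integral>x. exp (f x) \<partial>M)"

lemma bounded_measurableI:
  assumes "f \<in> borel_measurable M" "\<And>x. x \<in> space M \<Longrightarrow> \<bar>f x\<bar> \<le> B"
  shows "f \<in> bounded_measurable M"
  using assms unfolding bounded_measurable_def by (auto simp: bounded_iff)

lemma bounded_measurable_cong: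
  "sets M = sets N \<Longrightarrow> bounded_measurable M = bounded_measurable N"
  unfolding bounded_measurable_def by (metis measurable_cong_sets sets_eq_imp_space_eq)

lemma bounded_measurableD:
  assumes "f \<in> bounded_measurable M"
  shows "f \<in> borel_measurable M" "\<exists>B. \<forall>x\<in>space M. \<bar>f x\<bar> \<le> B"
  using assms unfolding bounded_measurable_def by (auto simp: bounded_iff)

lemma (in prob_space) integrable_bounded_measurable:
  assumes "f \<in> bounded_measurable M"
  shows "integrable M f"
proof -
  from bounded_measurableD[OF assms] obtain B where "\<forall>x\<in>space M. \<bar>f x\<bar> \<le> B" "f \<in> borel_measurable M"
    by blast
  then show ?thesis by (intro integrable_const_bound[of _ B]) auto
qed

lemma exp_bounded_measurable:
  assumes "f \<in> bounded_measurable M"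
  shows "(\<lambda>x. exp (f x)) \<in> bounded_measurable M"
proof -
  from bounded_measurableD[OF assms] obtain B where *: "\<forall>x\<in>space M. \<bar>f x\<bar> \<le> B" "f \<in> borel_measurable M"
    by blast
  have "\<bar>exp (f x)\<bar> \<le> exp B" if "x \<in> space M" for x
    using *(1)[rule_format, OF that] by simp
  then show ?thesis using *(2) by (intro bounded_measurableI[of _ _ "exp B"]) auto
qed

lemma (in prob_space) integral_exp_pos:
  assumes "f \<in> bounded_measurable M"
  shows "0 < (\<integral>x. exp (f x) \<partial>M)"
proof -
  from bounded_measurableD[OF assms] obtain B where *: "\<forall>x\<in>space M. \<bar>f x\<bar> \<le> B" by blast
  have "exp (-B) = (\<integral>x. exp (-B) \<partial>M)" by (simp add: prob_space)
  also have "\<dots> \<le> (\<integral>x. exp (f x) \<partial>M)"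
  proof (rule integral_mono)
    show "integrable M (\<lambda>x. exp (f x))"
      by (intro integrable_bounded_measurable exp_bounded_measurable assms)
    show "exp (- B) \<le> exp (f x)" if "x \<in> space M" for x
      using *[rule_format, OF that] by simp
  qed simp
  finally show ?thesis using exp_gt_zero[of "-B"] by linarith
qed

lemma (in prob_space) exp_log_mgf:
  assumes "f \<in> bounded_measurable M"
  shows "exp (log_mgf M f) = (\<integral>x. exp (f x) \<partial>M)"
  using integral_exp_pos[OF assms] by (simp add: log_mgf_def)

text \<open>Jensen's inequality for \<open>exp\<close>; equivalently, \<open>H(\<mu> | \<mu>) \<le> 0\<close> in variational form.\<close>

lemma (in prob_space) integral_le_log_mgf:
  assumes f: "f \<in> bounded_measurable M"
  shows "(\<integral>x. f x \<partial>M) \<le> log_mgf M f"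
proof -
  define L where "L = log_mgf M f"
  have "(\<integral>x. 1 + (f x - L) \<partial>M) \<le> (\<integral>x. exp (f x - L) \<partial>M)"
  proof (rule integral_mono)
    show "integrable M (\<lambda>x. exp (f x - L))"
      using integrable_bounded_measurable[OF exp_bounded_measurable[OF f]] by (simp add: exp_diff)
  qed (use integrable_bounded_measurable[OF f] in auto)
  also have "\<dots> = 1"
    using exp_log_mgf[OF f] integral_exp_pos[OF f] by (simp add: exp_diff L_def)
  finally show ?thesis
    using integrable_bounded_measurable[OF f] by (simp add: prob_space L_def)
qed

lemma log_mgf_indicator:
  assumes "prob_space \<mu>" "A \<in> sets \<mu>"
  shows "log_mgf \<mu> (\<lambda>x. a * indicator A x) = ln (1 + (exp a - 1) * measure \<mu> A)"
proof -
  interpret prob_space \<mu> by fact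
  have "(\<integral>x. exp (a * indicator A x) \<partial>\<mu>) = (\<integral>x. 1 + (exp a - 1) * indicator A x \<partial>\<mu>)"
    by (intro Bochner_Integration.integral_cong refl) (auto simp: indicator_def)
  also have "\<dots> = 1 + (exp a - 1) * measure \<mu> A"
  proof -
    have "integrable \<mu> (indicator A :: _ \<Rightarrow> real)"
      using assms(2) by (intro integrable_real_indicator) (auto simp: emeasure_eq_measure)
    then show ?thesis using assms(2) by (simp add: prob_space)
  qed
  finally show ?thesis by (simp add: log_mgf_def)
qed

lemma indicator_bounded_measurable:
  "A \<in> sets M \<Longrightarrow> (\<lambda>x. a * indicator A x) \<in> bounded_measurable M"
  by (rule bounded_measurableI[of _ _ "\<bar>a\<bar>"]) (auto simp: indicator_def)

lemma rel_entropy_eq_integral_ln: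
  assumes "absolutely_continuous \<mu> \<nu>" "sets \<nu> = sets \<mu>"
    and D: "AE x in \<mu>. RN_deriv \<mu> \<nu> x = ennreal (D x)" "\<And>x. 0 \<le> D x" "D \<in> borel_measurable \<mu>"
  shows "rel_entropy \<nu> \<mu> =
    (if integrable \<nu> (\<lambda>x. ln (D x)) then ereal (\<integral>x. ln (D x) \<partial>\<nu>) else \<infinity>)"
proof -
  have [measurable]: "D \<in> borel_measurable \<nu>" "entropy_density (exp 1) \<mu> \<nu> \<in> borel_measurable \<nu>"
    using D(3) measurable_entropy_density[of "exp 1" \<mu> \<nu>] assms(2)
    by (auto simp: measurable_cong_sets[OF assms(2) refl])
  have eq: "AE x in \<nu>. entropy_density (exp 1) \<mu> \<nu> x = ln (D x)"
    using absolutely_continuous_AE[OF assms(2,1) D(1)]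
    by eventually_elim (simp add: entropy_density_def D(2) log_def)
  then have "integrable \<nu> (entropy_density (exp 1) \<mu> \<nu>) \<longleftrightarrow> integrable \<nu> (\<lambda>x. ln (D x))"
    by (intro integrable_cong_AE) auto
  moreover have "KL_divergence (exp 1) \<mu> \<nu> = (\<integral>x. ln (D x) \<partial>\<nu>)"
    unfolding KL_divergence_def using eq by (intro integral_cong_AE) auto
  ultimately show ?thesis using assms(1) by (simp add: rel_entropy_def)
qed

text \<open>A finite real-valued version of the density, in terms of which the entropy is
  \<open>\<integral>ln D d\<nu>\<close>; no case distinction at \<open>D = 0\<close> arises because \<open>D > 0\<close> holds \<open>\<nu>\<close>-almost everywhere.\<close>

lemma absolutely_continuous_real_density:
  assumes "prob_space \<mu>" "prob_space \<nu>" "sets \<nu> = sets \<mu>" "absolutely_continuous \<mu> \<nu>"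
  obtains D where "D \<in> borel_measurable \<mu>" "\<And>x. 0 \<le> D x" "AE x in \<nu>. 0 < D x"
    "\<nu> = density \<mu> D"
    "rel_entropy \<nu> \<mu> =
      (if integrable \<nu> (\<lambda>x. ln (D x)) then ereal (\<integral>x. ln (D x) \<partial>\<nu>) else \<infinity>)"
proof -
  interpret M: prob_space \<mu> by fact
  interpret N: prob_space \<nu> by fact
  have "finite_measure \<nu>" by unfold_locales
  from M.real_RN_deriv[OF this assms(4,3)] obtain D where
    D: "D \<in> borel_measurable \<mu>" "AE x in \<mu>. RN_deriv \<mu> \<nu> x = ennreal (D x)"
       "AE x in \<nu>. 0 < D x" "\<And>x. 0 \<le> D x"
    by blast
  have "\<nu> = density \<mu> (RN_deriv \<mu> \<nu>)"
    using assms(4,3) by (rule M.density_RN_deriv[symmetric])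
  also have "\<dots> = density \<mu> D"
    using D by (auto intro!: density_cong)
  finally show ?thesis
    using rel_entropy_eq_integral_ln[OF assms(4,3) D(2,4,1)] D by (intro that[of D]) auto
qed

text \<open>The easy half of the Donsker-Varadhan formula. With \<open>L = log_mgf \<mu> f\<close>, integrate the inequality
  \<open>1 + (f - ln D - L) \<le> exp (f - ln D - L) = e\<^sup>f\<^sup>-\<^sup>L / D\<close> against \<open>\<nu> = D \<mu>\<close>; the right-hand side has
  integral at most \<open>\<integral>e\<^sup>f\<^sup>-\<^sup>L d\<mu> = 1\<close>.\<close>

lemma integral_le_rel_entropy_plus_log_mgf:
  assumes "prob_space \<mu>" "prob_space \<nu>" "sets \<nu> = sets \<mu>"
    and c: "rel_entropy \<nu> \<mu> \<le> ereal c" and f: "f \<in> bounded_measurable \<mu>"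
  shows "(\<integral>x. f x \<partial>\<nu>) \<le> c + log_mgf \<mu> f"
proof -
  interpret M: prob_space \<mu> by fact
  interpret N: prob_space \<nu> by fact
  have ac: "absolutely_continuous \<mu> \<nu>"
    using c by (auto simp: rel_entropy_def split: if_splits)
  obtain D where D[measurable]: "D \<in> borel_measurable \<mu>" and D': "\<And>x. 0 \<le> D x" "AE x in \<nu>. 0 < D x"
    "\<nu> = density \<mu> D"
    and ent: "rel_entropy \<nu> \<mu> =
      (if integrable \<nu> (\<lambda>x. ln (D x)) then ereal (\<integral>x. ln (D x) \<partial>\<nu>) else \<infinity>)"
    using absolutely_continuous_real_density[OF assms(1-3) ac] by metis
  have int: "integrable \<nu> (\<lambda>x. ln (D x))" and le: "(\<integral>x. ln (D x) \<partial>\<nu>) \<le> c"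
    using c unfolding ent by (auto split: if_splits)
  have [measurable]: "f \<in> borel_measurable \<mu>" using f by (rule bounded_measurableD)
  have fN: "f \<in> bounded_measurable \<nu>" using f bounded_measurable_cong[OF assms(3)] by simp
  define L where "L = log_mgf \<mu> f"
  define h where "h = (\<lambda>x. if 0 < D x then exp (f x - L) / D x else 0)"
  have [measurable]: "h \<in> borel_measurable \<mu>" unfolding h_def by measurable
  have expint: "integrable \<mu> (\<lambda>x. exp (f x - L))"
    using M.integrable_bounded_measurable[OF exp_bounded_measurable[OF f]] by (simp add: exp_diff)
  have one: "(\<integral>x. exp (f x - L) \<partial>\<mu>) = 1"
    using M.exp_log_mgf[OF f] M.integral_exp_pos[OF f] by (simp add: exp_diff L_def)
  have Dh: "D x * h x = (if 0 < D x then exp (f x - L) else 0)" for x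
    by (simp add: h_def)
  have "integrable \<mu> (\<lambda>x. D x * h x)"
    by (rule Bochner_Integration.integrable_bound[OF expint]) (auto simp: Dh)
  then have hint: "integrable \<nu> h" unfolding D'(3) by (subst integrable_real_density) (auto simp: D')
  have "(\<integral>x. h x \<partial>\<nu>) = (\<integral>x. D x * h x \<partial>\<mu>)"
    unfolding D'(3) by (subst integral_real_density) (auto simp: D')
  also have "\<dots> \<le> 1"
    unfolding one[symmetric] by (intro integral_mono \<open>integrable \<mu> (\<lambda>x. D x * h x)\<close> expint) (simp add: Dh)
  finally have h1: "(\<integral>x. h x \<partial>\<nu>) \<le> 1" .
  have "(\<integral>x. 1 + f x - ln (D x) - L \<partial>\<nu>) \<le> (\<integral>x. h x \<partial>\<nu>)"
  proof (rule integral_mono_AE)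
    show "integrable \<nu> (\<lambda>x. 1 + f x - ln (D x) - L)"
      using int N.integrable_bounded_measurable[OF fN] by auto
    show "AE x in \<nu>. 1 + f x - ln (D x) - L \<le> h x"
      using D'(2)
    proof eventually_elim
      case (elim x)
      have "h x = exp (f x - ln (D x) - L)"
        using elim by (simp add: h_def exp_diff)
      then show ?case using exp_ge_add_one_self[of "f x - ln (D x) - L"] by linarith
    qed
  qed (rule hint)
  also have "(\<integral>x. 1 + f x - ln (D x) - L \<partial>\<nu>) = 1 + (\<integral>x. f x \<partial>\<nu>) - (\<integral>x. ln (D x) \<partial>\<nu>) - L"
    using int N.integrable_bounded_measurable[OF fN] by (simp add: N.prob_space)
  finally show ?thesis using h1 le by (simp add: L_def)
qed

text \<open>The other half. Large multiples of the indicator of a \<open>\<mu>\<close>-null set show that \<open>\<nu>\<close> is absolutely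
  continuous; then the truncations of \<open>ln D\<close> to \<open>[-k, k]\<close> are admissible test functions with
  \<open>log_mgf\<close> at most \<open>e\<^sup>-\<^sup>k\<close>, and \<open>k \<rightarrow> \<infinity>\<close> gives \<open>\<integral>ln D d\<nu> \<le> c\<close>. The integrability of \<open>ln D\<close> has to come out
  of the same estimate: the negative parts are controlled by \<open>D * max 0 (- ln D) \<le> 1\<close>, hence so are
  the absolute values, and Fatou's lemma applies.\<close>

lemma rel_entropy_le_if_integral_le:
  assumes "prob_space \<mu>" "prob_space \<nu>" "sets \<nu> = sets \<mu>"
    and le: "\<And>f. f \<in> bounded_measurable \<mu> \<Longrightarrow> (\<integral>x. f x \<partial>\<nu>) \<le> c + log_mgf \<mu> f"
  shows "rel_entropy \<nu> \<mu> \<le> ereal c"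
proof -
  interpret M: prob_space \<mu> by fact
  interpret N: prob_space \<nu> by fact
  have ac: "absolutely_continuous \<mu> \<nu>"
    unfolding absolutely_continuous_def
  proof
    fix A assume A: "A \<in> null_sets \<mu>"
    then have [measurable]: "A \<in> sets \<mu>" "A \<in> sets \<nu>" and m: "measure \<mu> A = 0"
      using assms(3) by (auto simp: null_sets_def measure_def)
    have "a * measure \<nu> A \<le> c" for a
      using le[OF indicator_bounded_measurable[of A \<mu> a]] log_mgf_indicator[OF assms(1), of A a] m
      by simp
    from this[of "(c + 1) / measure \<nu> A"] have "measure \<nu> A = 0"
      by (cases "measure \<nu> A = 0") auto
    then show "A \<in> null_sets \<nu>"
      by (auto simp: null_sets_def N.emeasure_eq_measure)
  qed
  obtain D where D[measurable]: "D \<in> borel_measurable \<mu>" and D': "\<And>x. 0 \<le> D x" "AE x in \<nu>. 0 < D x"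
    "\<nu> = density \<mu> D"
    and ent: "rel_entropy \<nu> \<mu> =
      (if integrable \<nu> (\<lambda>x. ln (D x)) then ereal (\<integral>x. ln (D x) \<partial>\<nu>) else \<infinity>)"
    using absolutely_continuous_real_density[OF assms(1-3) ac] by metis
  have [measurable]: "D \<in> borel_measurable \<nu>" using D assms(3) by (simp cong: measurable_cong_sets)
  have intD: "integrable \<mu> D"
  proof (rule integrableI_nonneg)
    show "(\<integral>\<^sup>+x. ennreal (D x) \<partial>\<mu>) < \<infinity>"
      using N.emeasure_space_1 sets_eq_imp_space_eq[OF assms(3)] unfolding D'(3)
      by (subst (asm) emeasure_density) (auto simp: cong: nn_integral_cong)
  qed (auto simp: D')
  have D1: "(\<integral>x. D x \<partial>\<mu>) = 1"
  proof -
    have "(\<integral>x. 1 \<partial>\<nu>) = (\<integral>x. D x * 1 \<partial>\<mu>)"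
      unfolding D'(3) by (subst integral_real_density) (auto simp: D'(1))
    then show ?thesis using N.prob_space by simp
  qed
  \<comment> \<open>\<open>ln D\<close> clamped to \<open>[-k, k]\<close>; clamping \<open>D\<close> itself yields \<open>-k\<close> where \<open>D = 0\<close>, while \<open>ln 0 = 0\<close>.\<close>
  define f where "f = (\<lambda>k::nat. \<lambda>x. ln (max (exp (- real k)) (min (D x) (exp (real k)))))"
  have f_bd: "\<bar>f k x\<bar> \<le> real k" for k x
  proof -
    have "f k x \<le> ln (exp (real k))" unfolding f_def by (intro ln_mono) (auto simp: less_max_iff_disj)
    moreover have "ln (exp (- real k)) \<le> f k x"
      unfolding f_def by (intro ln_mono) (auto simp: less_max_iff_disj)
    ultimately show ?thesis by simp
  qed
  have f_meas[measurable]: "f k \<in> borel_measurable \<mu>" "f k \<in> borel_measurable \<nu>" for k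
    unfolding f_def by measurable
  have f_in: "f k \<in> bounded_measurable \<mu>" for k
    by (rule bounded_measurableI[of _ _ "real k"]) (use f_bd in auto)
  have f_eq: "f k x = max (- real k) (min (ln (D x)) (real k))" if "0 < D x" for k x
  proof -
    have "ln (min (D x) (exp (real k))) = min (ln (D x)) (real k)"
    proof -
        have "D x \<le> exp (real k) \<longleftrightarrow> ln (D x) \<le> real k"
          using that by (metis exp_le_cancel_iff exp_ln)
        then show ?thesis by (simp add: min_def)
      qed
    moreover have "0 < min (D x) (exp (real k))" using that by simp
    moreover have "ln (max (exp (- real k)) y) = max (- real k) (ln y)" if "0 < y" for y
      using that by (auto simp: max_def ln_ge_iff)
    ultimately show ?thesis by (simp add: f_def)
  qed
  have f_le: "(\<integral>x. f k x \<partial>\<nu>) \<le> c + exp (- real k)" for k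
  proof -
    have "(\<integral>x. exp (f k x) \<partial>\<mu>) \<le> (\<integral>x. D x + exp (- real k) \<partial>\<mu>)"
    proof (rule integral_mono)
      show "integrable \<mu> (\<lambda>x. exp (f k x))"
        by (rule M.integrable_bounded_measurable[OF exp_bounded_measurable[OF f_in]])
      show "exp (f k x) \<le> D x + exp (- real k)" for x
      proof -
        have "exp (f k x) = max (exp (- real k)) (min (D x) (exp (real k)))"
          unfolding f_def by (rule exp_ln) (simp add: less_max_iff_disj)
        also have "\<dots> \<le> D x + exp (- real k)"
          using D'(1)[of x] exp_gt_zero[of "- real k"] by linarith
        finally show ?thesis .
      qed
    qed (use intD in auto)
    also have "\<dots> = 1 + exp (- real k)" using intD D1 by (simp add: M.prob_space)
    finally have "log_mgf \<mu> (f k) \<le> ln (1 + exp (- real k))"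
      unfolding log_mgf_def using M.integral_exp_pos[OF f_in] by (intro ln_mono) auto
    also have "\<dots> \<le> exp (- real k)" by (rule ln_add_one_self_le_self) simp
    finally show ?thesis using le[OF f_in[of k]] by linarith
  qed
  \<comment> \<open>\<open>- ln D \<le> 1 / D - 1\<close>\<close>
  have neg: "D x * max 0 (- f k x) \<le> 1" for k x
  proof (cases "0 < D x")
    case True
    then have "max 0 (- f k x) \<le> max 0 (- ln (D x))" by (auto simp: f_eq)
    moreover have "- ln (D x) \<le> inverse (D x)"
      using True ln_le_minus_one[of "inverse (D x)"] by (simp add: ln_inverse)
    then have "max 0 (- ln (D x)) \<le> inverse (D x)" using True by auto
    ultimately have "max 0 (- f k x) \<le> inverse (D x)" by (rule order_trans)
    then have "D x * max 0 (- f k x) \<le> D x * inverse (D x)"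
      using True by (intro mult_left_mono) auto
    then show ?thesis using True by simp
  qed (use D'(1)[of x] in simp)
  have fint: "integrable \<nu> (f k)" for k
    using f_in bounded_measurable_cong[OF assms(3)] N.integrable_bounded_measurable by blast
  have lim: "AE x in \<nu>. (\<lambda>k. f k x) \<longlonglongrightarrow> ln (D x)"
    using D'(2)
  proof eventually_elim
    case (elim x)
    have "eventually (\<lambda>k. f k x = ln (D x)) sequentially"
      using eventually_ge_at_top[of "nat \<lceil>\<bar>ln (D x)\<bar>\<rceil>"]
    proof eventually_elim
      case (elim k)
      then have "\<bar>ln (D x)\<bar> \<le> real k" by linarith
      then show ?case using \<open>0 < D x\<close> by (simp add: f_eq)
    qed
    then show ?case by (rule tendsto_eventually)
  qed
  have "(\<integral>\<^sup>+x. ennreal \<bar>ln (D x)\<bar> \<partial>\<nu>) \<le> ennreal (c + 3)"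
  proof -
    have bd: "(\<integral>\<^sup>+x. ennreal \<bar>f k x\<bar> \<partial>\<nu>) \<le> ennreal (c + 3)" for k
    proof -
      have ni: "integrable \<nu> (\<lambda>x. max 0 (- f k x))" using fint by auto
      have "(\<integral>x. max 0 (- f k x) \<partial>\<nu>) = (\<integral>x. D x * max 0 (- f k x) \<partial>\<mu>)"
        unfolding D'(3) by (subst integral_real_density) (auto simp: D')
      also have "\<dots> \<le> (\<integral>x. 1 \<partial>\<mu>)"
      proof (rule integral_mono)
        show "integrable \<mu> (\<lambda>x. D x * max 0 (- f k x))"
          using ni unfolding D'(3) by (subst (asm) integrable_real_density) (auto simp: D')
      qed (use neg in auto)
      finally have n1: "(\<integral>x. max 0 (- f k x) \<partial>\<nu>) \<le> 1" by (simp add: M.prob_space)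
      have "(\<integral>x. \<bar>f k x\<bar> \<partial>\<nu>) = (\<integral>x. f k x + 2 * max 0 (- f k x) \<partial>\<nu>)"
        by (intro Bochner_Integration.integral_cong) (auto simp: abs_real_def)
      also have "\<dots> = (\<integral>x. f k x \<partial>\<nu>) + 2 * (\<integral>x. max 0 (- f k x) \<partial>\<nu>)"
        using fint ni by simp
      also have "\<dots> \<le> c + 3" 
        proof -
          have "exp (- real k) \<le> 1" by simp
          then show ?thesis using f_le[of k] n1 by linarith
        qed
        finally have "(\<integral>x. \<bar>f k x\<bar> \<partial>\<nu>) \<le> c + 3" .
      then show ?thesis using fint[of k]
        by (subst nn_integral_eq_integral) (auto intro: ennreal_leI)
    qed
    have "(\<integral>\<^sup>+x. ennreal \<bar>ln (D x)\<bar> \<partial>\<nu>) = (\<integral>\<^sup>+x. liminf (\<lambda>k. ennreal \<bar>f k x\<bar>) \<partial>\<nu>)"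
    proof (rule nn_integral_cong_AE)
      show "AE x in \<nu>. ennreal \<bar>ln (D x)\<bar> = liminf (\<lambda>k. ennreal \<bar>f k x\<bar>)"
        using lim
      proof eventually_elim
        case (elim x)
        then have "(\<lambda>k. ennreal \<bar>f k x\<bar>) \<longlonglongrightarrow> ennreal \<bar>ln (D x)\<bar>"
          by (intro tendsto_ennrealI tendsto_rabs)
        then show ?case by (intro lim_imp_Liminf[symmetric]) auto
      qed
    qed
    also have "\<dots> \<le> liminf (\<lambda>k. \<integral>\<^sup>+x. ennreal \<bar>f k x\<bar> \<partial>\<nu>)"
      by (rule nn_integral_liminf) auto
    also have "\<dots> \<le> ennreal (c + 3)"
      by (rule order_trans[OF Liminf_mono[where g="\<lambda>_. ennreal (c+3)"]]) (use bd in \<open>auto simp: Liminf_const\<close>)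
    finally show ?thesis .
  qed
  then have int: "integrable \<nu> (\<lambda>x. ln (D x))"
    by (intro integrableI_bounded) (auto intro: le_less_trans)
  have "(\<lambda>k. \<integral>x. f k x \<partial>\<nu>) \<longlonglongrightarrow> (\<integral>x. ln (D x) \<partial>\<nu>)"
  proof (rule integral_dominated_convergence[where w="\<lambda>x. \<bar>ln (D x)\<bar>"])
    show "AE x in \<nu>. (\<lambda>k. f k x) \<longlonglongrightarrow> ln (D x)" by (rule lim)
    show "AE x in \<nu>. norm (f k x) \<le> \<bar>ln (D x)\<bar>" for k
      using D'(2) by eventually_elim (auto simp: f_eq)
  qed (use int in auto)
  moreover have "(\<lambda>k. c + exp (- real k)) \<longlonglongrightarrow> c + 0"
    by (intro tendsto_intros filterlim_compose[OF exp_at_bot]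
        filterlim_compose[OF filterlim_uminus_at_bot_at_top] filterlim_real_sequentially)
  ultimately have "(\<integral>x. ln (D x) \<partial>\<nu>) \<le> c + 0"
    by (rule LIMSEQ_le) (use f_le in auto)
  then show ?thesis using int ent by simp
qed

section \<open>The compact space of means\<close>

lemma bounded_measurable_add:
  assumes "f \<in> bounded_measurable M" "g \<in> bounded_measurable M"
  shows "(\<lambda>x. f x + g x) \<in> bounded_measurable M"
proof -
  from bounded_measurableD[OF assms(1)] bounded_measurableD[OF assms(2)]
  obtain A B where *: "\<forall>x\<in>space M. \<bar>f x\<bar> \<le> A" "\<forall>x\<in>space M. \<bar>g x\<bar> \<le> B"
    and [measurable]: "f \<in> borel_measurable M" "g \<in> borel_measurable M"
    by blast
  have "\<bar>f x + g x\<bar> \<le> A + B" if "x \<in> space M" for x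
    using *(1)[rule_format, OF that] *(2)[rule_format, OF that] by linarith
  then show ?thesis by (intro bounded_measurableI[of _ _ "A + B"]) auto
qed

lemma bounded_measurable_cmult:
  assumes "f \<in> bounded_measurable M"
  shows "(\<lambda>x. c * f x) \<in> bounded_measurable M"
proof -
  from bounded_measurableD[OF assms(1)]
  obtain A where *: "\<forall>x\<in>space M. \<bar>f x\<bar> \<le> A" and [measurable]: "f \<in> borel_measurable M"
    by blast
  have "\<bar>c * f x\<bar> \<le> \<bar>c\<bar> * A" if "x \<in> space M" for x
    unfolding abs_mult using *(1)[rule_format, OF that] by (intro mult_left_mono) auto
  then show ?thesis by (intro bounded_measurableI[of _ _ "\<bar>c\<bar> * A"]) auto
qed

lemma bounded_measurable_const: "(\<lambda>x. c) \<in> bounded_measurable M"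
  by (rule bounded_measurableI[of _ _ "\<bar>c\<bar>"]) auto

lemma bounded_measurable_sum:
  assumes "\<And>i. i \<in> I \<Longrightarrow> f i \<in> bounded_measurable M"
  shows "(\<lambda>x. \<Sum>i\<in>I. f i x) \<in> bounded_measurable M"
  using assms
proof (induction I rule: infinite_finite_induct)
  case (insert i I)
  then show ?case using bounded_measurable_add[of "f i" M "\<lambda>x. \<Sum>i\<in>I. f i x"] by simp
qed (simp_all add: bounded_measurable_const)

text \<open>Positive normalised linear functionals on the bounded measurable functions (finitely additive
  probabilities). The third condition says that \<open>m f \<le> sup f\<close>; with linearity it contains positivity and
  normalisation. Functions outside the domain are sent to \<open>0\<close>, so that the functionals live in one
  topological space of total functions, carrying the topology of pointwise convergence.\<close>

definition means :: "'t measure \<Rightarrow> (('t \<Rightarrow> real) \<Rightarrow> real) set" where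
  "means M = {m.
     (\<forall>f\<in>bounded_measurable M. \<forall>g\<in>bounded_measurable M. m (\<lambda>x. f x + g x) = m f + m g) \<and>
     (\<forall>f\<in>bounded_measurable M. \<forall>c. m (\<lambda>x. c * f x) = c * m f) \<and>
     (\<forall>f\<in>bounded_measurable M. \<forall>a. (\<forall>x\<in>space M. f x \<le> a) \<longrightarrow> m f \<le> a) \<and>
     (\<forall>f. f \<notin> bounded_measurable M \<longrightarrow> m f = 0)}"

definition mean_of :: "'t measure \<Rightarrow> 't measure \<Rightarrow> ('t \<Rightarrow> real) \<Rightarrow> real" where
  "mean_of M \<nu> f = (if f \<in> bounded_measurable M then \<integral>x. f x \<partial>\<nu> else 0)"

definition measure_of_mean :: "'t measure \<Rightarrow> (('t \<Rightarrow> real) \<Rightarrow> real) \<Rightarrow> 't measure" where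
  "measure_of_mean M m = measure_of (space M) (sets M) (\<lambda>A. ennreal (m (indicator A)))"

lemma means_add:
  assumes "m \<in> means M" "f \<in> bounded_measurable M" "g \<in> bounded_measurable M"
  shows "m (\<lambda>x. f x + g x) = m f + m g"
  using assms unfolding means_def mem_Collect_eq by (elim conjE) simp

lemma means_cmult:
  assumes "m \<in> means M" "f \<in> bounded_measurable M"
  shows "m (\<lambda>x. c * f x) = c * m f"
  using assms unfolding means_def mem_Collect_eq by (elim conjE) simp

lemma means_le:
  assumes "m \<in> means M" "f \<in> bounded_measurable M" "\<And>x. x \<in> space M \<Longrightarrow> f x \<le> a"
  shows "m f \<le> a"
proof -
  have "\<forall>f\<in>bounded_measurable M. \<forall>a. (\<forall>x\<in>space M. f x \<le> a) \<longrightarrow> m f \<le> a"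
    using assms(1) unfolding means_def mem_Collect_eq by (elim conjE)
  then show ?thesis using assms(2,3) by simp
qed

lemma means_sub:
  assumes "m \<in> means M" "f \<in> bounded_measurable M" "g \<in> bounded_measurable M"
  shows "m (\<lambda>x. f x - g x) = m f - m g"
proof -
  have "m (\<lambda>x. f x + (-1) * g x) = m f + (-1) * m g"
    using means_add[OF assms(1,2) bounded_measurable_cmult[OF assms(3), of "-1"]]
      means_cmult[OF assms(1,3), of "-1"] by simp
  then show ?thesis by simp
qed

lemma means_mono:
  assumes "m \<in> means M" "f \<in> bounded_measurable M" "g \<in> bounded_measurable M"
    and "\<And>x. x \<in> space M \<Longrightarrow> f x \<le> g x + a"
  shows "m f \<le> m g + a"
proof -
  have "(\<lambda>x. f x - g x) \<in> bounded_measurable M"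
    using bounded_measurable_add[OF assms(2) bounded_measurable_cmult[OF assms(3), of "-1"]] by simp
  then have "m (\<lambda>x. f x - g x) \<le> a"
    by (rule means_le[OF assms(1)]) (use assms(4) in \<open>auto simp: algebra_simps\<close>)
  then show ?thesis using means_sub[OF assms(1-3)] by linarith
qed

lemma means_const:
  assumes "m \<in> means M" shows "m (\<lambda>x. c) = c"
proof (rule antisym)
  show "m (\<lambda>x. c) \<le> c"
    by (rule means_le[OF assms bounded_measurable_const]) simp
  have "m (\<lambda>x. (-1) * c) = (-1) * m (\<lambda>x. c)"
    by (rule means_cmult[OF assms bounded_measurable_const])
  moreover have "m (\<lambda>x. - c) \<le> - c"
    by (rule means_le[OF assms bounded_measurable_const]) simp
  ultimately show "c \<le> m (\<lambda>x. c)" by simp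
qed

lemma means_abs_le:
  assumes "m \<in> means M" "f \<in> bounded_measurable M" "\<And>x. x \<in> space M \<Longrightarrow> \<bar>f x\<bar> \<le> b"
  shows "\<bar>m f\<bar> \<le> b"
proof -
  have "m f \<le> m (\<lambda>x. 0) + b"
    by (rule means_mono[OF assms(1,2) bounded_measurable_const]) (use assms(3) in \<open>simp add: abs_le_iff\<close>)
  moreover have "m (\<lambda>x. 0) \<le> m f + b"
    by (rule means_mono[OF assms(1) bounded_measurable_const assms(2)])
      (use assms(3) abs_le_D2 in fastforce)
  ultimately show ?thesis using means_const[OF assms(1)] by simp
qed

lemma means_sum:
  assumes "m \<in> means M" "\<And>i. i \<in> I \<Longrightarrow> f i \<in> bounded_measurable M" "finite I"
  shows "m (\<lambda>x. \<Sum>i\<in>I. c i * f i x) = (\<Sum>i\<in>I. c i * m (f i))"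
  using assms(3,2)
proof (induction I)
  case empty
  then show ?case using means_const[OF assms(1)] by simp
next
  case (insert i I)
  have fi: "f i \<in> bounded_measurable M" and cf: "(\<lambda>x. c i * f i x) \<in> bounded_measurable M"
    using insert.prems by (auto intro: bounded_measurable_cmult)
  have "(\<lambda>x. \<Sum>i\<in>I. c i * f i x) \<in> bounded_measurable M"
    using insert.prems by (intro bounded_measurable_sum bounded_measurable_cmult) auto
  then have "m (\<lambda>x. c i * f i x + (\<Sum>i\<in>I. c i * f i x)) =
      m (\<lambda>x. c i * f i x) + m (\<lambda>x. \<Sum>i\<in>I. c i * f i x)"
    by (rule means_add[OF assms(1) cf])
  also have "m (\<lambda>x. c i * f i x) = c i * m (f i)"
    by (rule means_cmult[OF assms(1) fi])
  finally show ?case using insert by simp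
qed

lemma means_convex:
  assumes "m0 \<in> means M" "m1 \<in> means M" "0 \<le> t" "t \<le> 1"
  shows "(\<lambda>f. (1 - t) * m0 f + t * m1 f) \<in> means M"
proof -
  have "(1 - t) * m0 f + t * m1 f \<le> a" if "f \<in> bounded_measurable M" "\<forall>x\<in>space M. f x \<le> a" for f a
  proof -
    have "(1 - t) * m0 f + t * m1 f \<le> (1 - t) * a + t * a"
      using means_le[OF assms(1) that(1), of a] means_le[OF assms(2) that(1), of a] that(2) assms(3,4)
      by (intro add_mono mult_left_mono) auto
    then show ?thesis by (simp add: algebra_simps)
  qed
  moreover have "m0 f = 0" "m1 f = 0" if "f \<notin> bounded_measurable M" for f
    using assms(1,2) that by (auto simp: means_def)
  ultimately show ?thesis
    unfolding means_def mem_Collect_eq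
    by (auto simp: means_add[OF assms(1)] means_add[OF assms(2)] means_cmult[OF assms(1)]
        means_cmult[OF assms(2)] algebra_simps)
qed

text \<open>A bounded measurable function is a uniform limit of its discretisations \<open>\<lfloor>K f\<rfloor> / K\<close>, which are finite
  linear combinations of indicators.\<close>

lemma means_eqI:
  assumes "m \<in> means M" "m' \<in> means M"
    and eq: "\<And>A. A \<in> sets M \<Longrightarrow> m (indicator A) = m' (indicator A)"
  shows "m = m'"
proof
  fix f
  show "m f = m' f"
  proof (cases "f \<in> bounded_measurable M")
    case False
    then show ?thesis using assms(1,2) by (simp add: means_def)
  next
    case True
    from bounded_measurableD[OF True] obtain b
      where b: "\<forall>x\<in>space M. \<bar>f x\<bar> \<le> b" and [measurable]: "f \<in> borel_measurable M"
      by blast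
    have le: "\<bar>m f - m' f\<bar> \<le> 2 * inverse (real (Suc k))" for k
    proof -
      define K where "K = real (Suc k)"
      have K: "0 < K" by (simp add: K_def)
      define L where "L = {- \<lceil>K * b\<rceil> - 1 .. \<lceil>K * b\<rceil>}"
      define A where "A = (\<lambda>l::int. {x\<in>space M. \<lfloor>K * f x\<rfloor> = l})"
      define g where "g = (\<lambda>x. \<Sum>l\<in>L. (of_int l / K) * indicator (A l) x)"
      have A[measurable]: "A l \<in> sets M" for l unfolding A_def by measurable
      have A_in: "indicator (A l) \<in> bounded_measurable M" for l
        using indicator_bounded_measurable[OF A, of 1] by simp
      have g_in: "g \<in> bounded_measurable M"
        unfolding g_def by (intro bounded_measurable_sum bounded_measurable_cmult A_in)
      have g_eq: "g x = of_int \<lfloor>K * f x\<rfloor> / K" if x: "x \<in> space M" for x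
      proof -
        have "K * \<bar>f x\<bar> \<le> K * b" using b x K by (intro mult_left_mono) auto
        then have "\<bar>K * f x\<bar> \<le> K * b" using K by (simp add: abs_mult)
        then have "- (K * b) \<le> K * f x" "K * f x \<le> K * b"
          by (simp_all add: abs_le_iff)
        then have "\<lfloor>K * f x\<rfloor> \<in> L" unfolding L_def by (simp; linarith)
        have "g x = (\<Sum>l\<in>L. if l = \<lfloor>K * f x\<rfloor> then of_int l / K else 0)"
          unfolding g_def using x by (intro sum.cong) (auto simp: A_def)
        then show ?thesis using \<open>\<lfloor>K * f x\<rfloor> \<in> L\<close> by (simp add: L_def)
      qed
      have d: "\<bar>f x - g x\<bar> \<le> inverse K" if x: "x \<in> space M" for x
      proof -
        have "f x - g x = (K * f x - of_int \<lfloor>K * f x\<rfloor>) / K"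
          using K by (simp add: g_eq[OF x] field_simps)
        moreover have "0 \<le> K * f x - of_int \<lfloor>K * f x\<rfloor>" "K * f x - of_int \<lfloor>K * f x\<rfloor> \<le> 1"
          by linarith+
        ultimately have "0 \<le> f x - g x" "f x - g x \<le> 1 / K"
          using K by (simp_all add: divide_le_cancel)
        then show ?thesis by (simp add: inverse_eq_divide)
      qed
      have *: "f x \<le> g x + inverse K" "g x \<le> f x + inverse K" if x: "x \<in> space M" for x
        using d[OF x] by linarith+
      have near: "\<bar>n f - n g\<bar> \<le> inverse K" if n: "n \<in> means M" for n
        using means_mono[OF n True g_in *(1)] means_mono[OF n g_in True *(2)] by linarith
      have "m g = m' g"
      proof -
        have sum: "n g = (\<Sum>l\<in>L. (of_int l / K) * n (indicator (A l)))" if n: "n \<in> means M" for n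
          unfolding g_def by (rule means_sum[OF n A_in]) (simp add: L_def)
        show ?thesis unfolding sum[OF assms(1)] sum[OF assms(2)] by (simp add: eq[OF A])
      qed
      then show ?thesis
        using near[OF assms(1)] near[OF assms(2)] unfolding K_def by linarith
    qed
    have "(\<lambda>k. 2 * inverse (real (Suc k))) \<longlonglongrightarrow> 2 * 0"
      by (intro tendsto_intros LIMSEQ_inverse_real_of_nat)
    then have "\<bar>m f - m' f\<bar> \<le> 2 * 0"
      by (rule LIMSEQ_le_const) (use le in blast)
    then show ?thesis by simp
  qed
qed

lemma mean_of_in_means:
  assumes "prob_space \<nu>" "sets \<nu> = sets M"
  shows "mean_of M \<nu> \<in> means M"
proof -
  interpret prob_space \<nu> by fact
  have *: "bounded_measurable M = bounded_measurable \<nu>" "space M = space \<nu>"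
    using assms(2) bounded_measurable_cong sets_eq_imp_space_eq by blast+
  have "(\<integral>x. f x \<partial>\<nu>) \<le> a" if "f \<in> bounded_measurable \<nu>" "\<forall>x\<in>space \<nu>. f x \<le> a" for f a
    using that integrable_bounded_measurable[OF that(1)] by (intro integral_le_const AE_I2) auto
  then show ?thesis
    unfolding means_def mean_of_def *
    by (auto simp: bounded_measurable_add bounded_measurable_cmult integrable_bounded_measurable)
qed

lemma mean_of_inj:
  assumes "prob_space \<nu>" "prob_space \<nu>'" "sets \<nu> = sets M" "sets \<nu>' = sets M"
    and eq: "mean_of M \<nu> = mean_of M \<nu>'"
  shows "\<nu> = \<nu>'"
proof (rule measure_eqI)
  interpret N: prob_space \<nu> by fact
  interpret N': prob_space \<nu>' by fact
  fix A assume "A \<in> sets \<nu>"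
  then have A: "A \<in> sets M" using assms by simp
  then have "(indicator A :: _ \<Rightarrow> real) \<in> bounded_measurable M"
    using indicator_bounded_measurable[OF A, of 1] by simp
  with fun_cong[OF eq, of "indicator A"] A assms(3,4) have "measure \<nu> A = measure \<nu>' A"
    by (simp add: mean_of_def)
  then show "emeasure \<nu> A = emeasure \<nu>' A"
    by (simp add: N.emeasure_eq_measure N'.emeasure_eq_measure)
qed (use assms in simp)

text \<open>Tychonoff: if \<open>\<bar>f\<bar> \<le> b f\<close> then \<open>m f\<close> lies in the compact interval \<open>[- b f, b f]\<close>, and the defining
  conditions are closed for pointwise convergence.\<close>

lemma compact_means: "compact (means M)"
proof -
  let ?F = "bounded_measurable M"
  have "\<forall>f\<in>?F. \<exists>b. \<forall>x\<in>space M. \<bar>f x\<bar> \<le> b" using bounded_measurableD by blast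
  then obtain b where b: "\<And>f x. f \<in> ?F \<Longrightarrow> x \<in> space M \<Longrightarrow> \<bar>f x\<bar> \<le> b f" by metis
  define S where "S = (\<lambda>f. if f \<in> ?F then {- b f .. b f} else {0})"
  have "compactin (product_topology (\<lambda>_. euclidean) UNIV) (PiE UNIV S)"
    by (subst compactin_PiE) (auto simp: S_def)
  then have cS: "compact (PiE UNIV S)"
    by (simp add: euclidean_product_topology)
  have ev: "continuous_on UNIV (\<lambda>m :: ('a \<Rightarrow> real) \<Rightarrow> real. m f)" for f :: "'a \<Rightarrow> real"
    by (rule continuous_on_product_coordinates)
  have 1: "closed {m :: ('a \<Rightarrow> real) \<Rightarrow> real. m (\<lambda>x. f x + g x) = m f + m g}" for f g :: "'a \<Rightarrow> real"
    by (rule closed_Collect_eq[OF ev continuous_on_add[OF ev ev]])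
  have 2: "closed {m :: ('a \<Rightarrow> real) \<Rightarrow> real. m (\<lambda>x. c * f x) = c * m f}" for f :: "'a \<Rightarrow> real" and c
    by (rule closed_Collect_eq[OF ev continuous_on_mult_left[OF ev]])
  have 3: "closed {m :: ('a \<Rightarrow> real) \<Rightarrow> real. m f \<le> a}" for f :: "'a \<Rightarrow> real" and a
    by (rule closed_Collect_le[OF ev continuous_on_const])
  have 4: "closed {m :: ('a \<Rightarrow> real) \<Rightarrow> real. m f = 0}" for f :: "'a \<Rightarrow> real"
    by (rule closed_Collect_eq[OF ev continuous_on_const])
  have "closed (means M)"
    unfolding means_def Ball_def
    by (intro closed_Collect_conj closed_Collect_all closed_Collect_imp[OF open_Collect_const] 1 2 3 4)
  moreover have "means M \<subseteq> PiE UNIV S"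
  proof
    fix m assume m: "m \<in> means M"
    have "m f \<in> S f" for f
    proof (cases "f \<in> ?F")
      case True
      then show ?thesis using means_abs_le[OF m True b[OF True]] by (auto simp: S_def)
    next
      case False
      then show ?thesis using m by (auto simp: S_def means_def)
    qed
    then show "m \<in> PiE UNIV S" by auto
  qed
  ultimately show ?thesis using cS by (metis compact_Int_closed inf.absorb_iff2)
qed

lemma means_indicator:
  assumes "m \<in> means M" "A \<in> sets M"
  shows "0 \<le> m (indicator A)" "m (indicator A) \<le> 1"
proof -
  have i: "indicator A \<in> bounded_measurable M"
    using indicator_bounded_measurable[OF assms(2), of 1] by simp
  show "0 \<le> m (indicator A)"
    using means_mono[OF assms(1) bounded_measurable_const[of 0] i, of 0] means_const[OF assms(1)]
    by simp
  show "m (indicator A) \<le> 1"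
    using means_abs_le[OF assms(1) i, of 1] by (simp add: abs_le_iff indicator_def)
qed

text \<open>Why finitely additive means with finite entropy are measures: applied to multiples \<open>a * 1\<^sub>A\<close>, the
  entropy bound gives \<open>m 1\<^sub>A \<le> (C + ln (1 + (e\<^sup>a - 1) \<mu> A)) / a\<close>. Along sets decreasing to \<open>{}\<close>, the limit
  superior is at most \<open>C / a\<close> for every \<open>a > 0\<close>, so \<open>m\<close> is continuous at \<open>{}\<close> and countably additive.\<close>

lemma means_represented:
  assumes "prob_space M" and m: "m \<in> means M"
    and C: "\<And>f. f \<in> bounded_measurable M \<Longrightarrow> m f \<le> C + log_mgf M f"
  defines "\<nu> \<equiv> measure_of_mean M m"
  shows "prob_space \<nu>" "sets \<nu> = sets M" "mean_of M \<nu> = m"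
proof -
  interpret M: prob_space M by fact
  let ?m = "\<lambda>A. ennreal (m (indicator A))"
  have i: "indicator A \<in> bounded_measurable M" if "A \<in> sets M" for A
    using indicator_bounded_measurable[OF that, of 1] by simp
  have pos: "positive (sets M) ?m"
    using means_const[OF m, of 0] by (simp add: positive_def indicator_def[abs_def])
  have add: "additive (sets M) ?m"
  proof (unfold additive_def, intro ballI impI)
    fix A B assume AB: "A \<in> sets M" "B \<in> sets M" "A \<inter> B = {}"
    then have "indicator (A \<union> B) = (\<lambda>x. indicator A x + indicator B x :: real)"
      by (auto simp: indicator_def fun_eq_iff)
    then have "m (indicator (A \<union> B)) = m (indicator A) + m (indicator B)"
      using means_add[OF m i[OF AB(1)] i[OF AB(2)]] by simp
    then show "?m (A \<union> B) = ?m A + ?m B"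
      using means_indicator[OF m] AB by (simp add: ennreal_plus)
  qed
  have ca: "countably_additive (sets M) ?m"
  proof (rule sets.empty_continuous_imp_countably_additive[OF pos add])
    fix A :: "nat \<Rightarrow> 'a set"
    assume A: "range A \<subseteq> sets M" "decseq A" "(\<Inter>i. A i) = {}"
    have "(\<lambda>n. measure M (A n)) \<longlonglongrightarrow> measure M (\<Inter>i. A i)"
      using A by (intro M.finite_Lim_measure_decseq) auto
    then have lim: "(\<lambda>n. measure M (A n)) \<longlonglongrightarrow> 0" using A by simp
    have "(\<lambda>n. m (indicator (A n))) \<longlonglongrightarrow> 0"
    proof (rule LIMSEQ_I)
      fix r :: real assume r: "0 < r"
      \<comment> \<open>large enough for \<open>C / a < r\<close>\<close>
      define a where "a = 2 * (\<bar>C\<bar> + 1) / r"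
      have a: "0 < a" using r by (simp add: a_def)
      have "(\<lambda>n. (C + ln (1 + (exp a - 1) * measure M (A n))) / a) \<longlonglongrightarrow> (C + ln (1 + (exp a - 1) * 0)) / a"
        using a by (intro tendsto_intros lim) auto
      moreover have "(C + ln (1 + (exp a - 1) * 0)) / a < r"
      proof -
        have "r * a = 2 * (\<bar>C\<bar> + 1)" using r by (simp add: a_def)
        moreover have "C < 2 * (\<bar>C\<bar> + 1)" by simp
        ultimately have "C < r * a" by simp
        then show ?thesis using a by (simp add: pos_divide_less_eq)
      qed
      ultimately have "eventually (\<lambda>n. (C + ln (1 + (exp a - 1) * measure M (A n))) / a < r) sequentially"
        by (rule order_tendstoD)
      then have "eventually (\<lambda>n. norm (m (indicator (A n)) - 0) < r) sequentially"
      proof eventually_elim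
        case (elim n)
        have An: "A n \<in> sets M" using A by auto
        have "m (\<lambda>x. a * indicator (A n) x) = a * m (indicator (A n))"
          by (rule means_cmult[OF m i[OF An]])
        then have "a * m (indicator (A n)) \<le> C + ln (1 + (exp a - 1) * measure M (A n))"
          using C[OF indicator_bounded_measurable[OF An, of a]] log_mgf_indicator[OF assms(1) An] by simp
        then have "m (indicator (A n)) \<le> (C + ln (1 + (exp a - 1) * measure M (A n))) / a"
          using a by (simp add: field_simps)
        then show ?case using elim means_indicator(1)[OF m An] by simp
      qed
      then show "\<exists>no. \<forall>n\<ge>no. norm (m (indicator (A n)) - 0) < r"
        by (simp add: eventually_sequentially)
    qed
    then show "(\<lambda>n. ?m (A n)) \<longlonglongrightarrow> 0"
      using tendsto_ennrealI by fastforce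
  qed auto
  show sets: "sets \<nu> = sets M"
    unfolding \<nu>_def measure_of_mean_def by simp
  have em: "emeasure \<nu> A = ?m A" if "A \<in> sets M" for A
    unfolding \<nu>_def measure_of_mean_def
    using sets.sigma_algebra_axioms pos ca that by (rule emeasure_measure_of_sigma)
  have sp: "space \<nu> = space M" using sets by (rule sets_eq_imp_space_eq)
  have "m (indicator (space M)) = 1"
  proof (rule antisym)
    show "m (indicator (space M)) \<le> 1" by (rule means_indicator[OF m]) simp
    have "m (\<lambda>x. 1) \<le> m (indicator (space M)) + 0"
      by (rule means_mono[OF m bounded_measurable_const i]) auto
    then show "1 \<le> m (indicator (space M))" using means_const[OF m] by simp
  qed
  then show prob: "prob_space \<nu>"
    by (intro prob_spaceI) (simp add: sp em)
  show "mean_of M \<nu> = m"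
  proof (rule means_eqI[OF mean_of_in_means[OF prob sets] m])
    fix A assume A: "A \<in> sets M"
    have "mean_of M \<nu> (indicator A) = measure \<nu> A"
      using A i[OF A] sets by (simp add: mean_of_def)
    also have "\<dots> = m (indicator A)"
      using em[OF A] means_indicator[OF m A] by (simp add: measure_def)
    finally show "mean_of M \<nu> (indicator A) = m (indicator A)" .
  qed
qed

section \<open>The weak topology\<close>

lemma continuous_bounded_measurable:
  assumes "continuous_map T euclideanreal f" "bounded (f ` topspace T)"
    and "sets M = sets (borel_algebra T)"
  shows "f \<in> bounded_measurable M"
proof -
  have "f \<in> borel_measurable (borel_algebra T)"
  proof (rule borel_measurableI)
    fix V :: "real set" assume "open V"
    then have "openin T {x \<in> topspace T. f x \<in> V}"
      using openin_continuous_map_preimage[OF assms(1)] by simp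
    then show "f -` V \<inter> space (borel_algebra T) \<in> sets (borel_algebra T)"
      unfolding sets_borel_algebra space_borel_algebra
      by (intro sigma_sets.Basic) (simp add: vimage_def Int_def conj_commute)
  qed
  then have "f \<in> bounded_measurable (borel_algebra T)"
    using assms(2) by (simp add: bounded_measurable_def)
  then show ?thesis using bounded_measurable_cong[OF assms(3)] by simp
qed

text \<open>Induction on how the open set is generated: for an intersection take the union of the two families of test
  functions and the smaller tolerance.\<close>

lemma weak_topology_neighbourhood:
  assumes "openin (weak_topology T) W" "\<nu> \<in> W"
  obtains F r where "finite F" "0 < r"
    "\<And>f. f \<in> F \<Longrightarrow> continuous_map T euclideanreal f \<and> bounded (f ` topspace T)"
    "\<And>\<nu>'. \<nu>' \<in> prob_measures T \<Longrightarrow> (\<And>f. f \<in> F \<Longrightarrow> \<bar>(\<integral>x. f x \<partial>\<nu>') - (\<integral>x. f x \<partial>\<nu>)\<bar> < r) \<Longrightarrow> \<nu>' \<in> W"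
proof -
  let ?S = "{{\<nu> \<in> prob_measures T. (\<integral>x. f x \<partial>\<nu>) \<in> U} | f U.
        continuous_map T euclideanreal f \<and> bounded (f ` topspace T) \<and> open U}"
  let ?near = "\<lambda>F r \<nu> W. finite F \<and> 0 < r \<and>
    (\<forall>f\<in>F. continuous_map T euclideanreal f \<and> bounded (f ` topspace T)) \<and>
    (\<forall>\<nu>'\<in>prob_measures T. (\<forall>f\<in>F. \<bar>(\<integral>x. f x \<partial>\<nu>') - (\<integral>x. f x \<partial>\<nu>)\<bar> < r) \<longrightarrow> \<nu>' \<in> W)"
  let ?P = "\<lambda>W \<nu>. \<exists>F r. ?near F r \<nu> W"
  have "generate_topology_on ?S W"
    using assms(1) unfolding weak_topology_def by (simp add: openin_topology_generated_by_iff)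
  then have "\<forall>\<nu>\<in>W. ?P W \<nu>"
  proof induction
    case Empty
    then show ?case by simp
  next
    case (Int a b)
    show ?case
    proof
      fix \<nu> assume "\<nu> \<in> a \<inter> b"
      then have "?P a \<nu>" "?P b \<nu>" using Int.IH by auto
      then obtain F r G s where "?near F r \<nu> a" "?near G s \<nu> b" by blast
      then show "?P (a \<inter> b) \<nu>"
        by (intro exI[of _ "F \<union> G"] exI[of _ "min r s"]) auto
    qed
  next
    case (UN K)
    show ?case
    proof
      fix \<nu> assume "\<nu> \<in> \<Union>K"
      then obtain k where k: "k \<in> K" "\<nu> \<in> k" by blast
      then have "?P k \<nu>" using UN.IH by blast
      then obtain F r where "?near F r \<nu> k" by blast
      then show "?P (\<Union>K) \<nu>"
        using k(1) by (intro exI[of _ F] exI[of _ r]) auto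
    qed
  next
    case (Basis s)
    then obtain f U where s: "s = {\<nu> \<in> prob_measures T. (\<integral>x. f x \<partial>\<nu>) \<in> U}"
      and f: "continuous_map T euclideanreal f" "bounded (f ` topspace T)" and U: "open U"
      by blast
    show ?case
    proof
      fix \<nu> assume "\<nu> \<in> s"
      then obtain e where e: "0 < e" "\<And>y. dist y (\<integral>x. f x \<partial>\<nu>) < e \<Longrightarrow> y \<in> U"
        using U unfolding s open_dist by blast
      show "?P s \<nu>"
        using f e by (intro exI[of _ "{f}"] exI[of _ e]) (auto simp: s dist_real_def)
    qed
  qed
  then have "?P W \<nu>" using assms(2) by blast
  then show ?thesis using that by metis
qed

text \<open>Integrals of bounded continuous functions are evaluations of the functional, so passing from
  functionals to the measures that represent them is continuous for the weak topology.\<close>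

lemma compactin_weak_topology_means:
  assumes K: "compact K" "K \<subseteq> means M" and M: "sets M = sets (borel_algebra T)"
    and rep: "\<And>m. m \<in> K \<Longrightarrow> measure_of_mean M m \<in> prob_measures T"
      "\<And>m. m \<in> K \<Longrightarrow> mean_of M (measure_of_mean M m) = m"
  shows "compactin (weak_topology T) (measure_of_mean M ` K)"
proof (rule image_compactin)
  show "compactin (top_of_set K) K"
    using K(1) by (simp add: compactin_subtopology)
  let ?S = "{{\<nu> \<in> prob_measures T. (\<integral>x. f x \<partial>\<nu>) \<in> U} | f U.
        continuous_map T euclideanreal f \<and> bounded (f ` topspace T) \<and> open U}"
  show "continuous_map (top_of_set K) (weak_topology T) (measure_of_mean M)"
    unfolding weak_topology_def
  proof (rule continuous_on_generated_topo)
    fix W assume "W \<in> ?S"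
    then obtain f U where W: "W = {\<nu> \<in> prob_measures T. (\<integral>x. f x \<partial>\<nu>) \<in> U}"
      and f: "continuous_map T euclideanreal f" "bounded (f ` topspace T)" and U: "open U"
      by blast
    have "f \<in> bounded_measurable M" using f M by (rule continuous_bounded_measurable)
    then have "(\<integral>x. f x \<partial>measure_of_mean M m) = m f" if "m \<in> K" for m
      using fun_cong[OF rep(2)[OF that], of f] by (simp add: mean_of_def)
    then have "measure_of_mean M -` W \<inter> topspace (top_of_set K) = K \<inter> (\<lambda>m. m f) -` U"
      using rep(1) by (auto simp: W)
    moreover have "open ((\<lambda>m. m f) -` U)"
      by (intro open_vimage U continuous_on_product_coordinates)
    ultimately show "openin (top_of_set K) (measure_of_mean M -` W \<inter> topspace (top_of_set K))"
      by (simp add: openin_open_Int)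
  next
    show "measure_of_mean M ` topspace (top_of_set K) \<subseteq> \<Union> ?S"
      using rep(1) topspace_weak_topology[of T]
      unfolding weak_topology_def topology_generated_by_topspace by auto
  qed
qed

section \<open>Independent samples\<close>

(* keeps index sets such as {1..N} in the form in which they are written *)

declare One_nat_def [simp del]

lemma (in prob_space) indep_vars_reindex:
  assumes ind: "indep_vars M' X I" and h: "inj_on h J" "h ` J \<subseteq> I"
  shows "indep_vars (\<lambda>j. M' (h j)) (\<lambda>j. X (h j)) J"
proof -
  have "indep_vars (\<lambda>j. PiM {h j} M') (\<lambda>j \<omega>. restrict (\<lambda>i. X i \<omega>) {h j}) J"
    using h by (intro indep_vars_restrict[OF ind]) (auto simp: disjoint_family_on_def inj_on_def)
  then have "indep_vars (\<lambda>j. M' (h j)) (\<lambda>j \<omega>. (restrict (\<lambda>i. X i \<omega>) {h j}) (h j)) J"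
    by (rule indep_vars_compose2) (auto intro!: measurable_component_singleton)
  then show ?thesis by simp
qed

lemma indep_vars_coordinates:
  assumes "prob_space M" "0 < N"
  shows "prob_space.indep_vars (PiM {1..N::nat} (\<lambda>_. M)) (\<lambda>_. M) (\<lambda>i z. z i) {1..N}"
proof -
  interpret PP: prob_space "PiM {1..N} (\<lambda>_. M)"
    using assms(1) by (intro prob_space_PiM)
  let ?P = "PiM {1..N} (\<lambda>_. M)"
  have "distr ?P ?P (\<lambda>x. \<lambda>i\<in>{1..N}. x i) = distr ?P ?P (\<lambda>x. x)"
    by (intro distr_cong) (auto simp: space_PiM PiE_def extensional_restrict)
  also have "\<dots> = ?P" by simp
  also have "\<dots> = PiM {1..N} (\<lambda>i. distr ?P M (\<lambda>x. x i))"
    using assms(1) by (intro PiM_cong refl distr_PiM_component[symmetric]) auto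
  finally show ?thesis
    using assms(2) by (subst PP.indep_vars_iff_distr_eq_PiM') auto
qed

text \<open>Change of measure for i.i.d. samples: independent samples from \<open>f M\<close> have density \<open>\<Prod>\<^sub>i f (z\<^sub>i)\<close> with
  respect to independent samples from \<open>M\<close>.\<close>

lemma density_PiM_prod:
  fixes f :: "'t \<Rightarrow> ennreal"
  assumes "prob_space M" "prob_space (density M f)" and [measurable]: "f \<in> borel_measurable M"
  shows "PiM {1..N::nat} (\<lambda>_. density M f) = density (PiM {1..N} (\<lambda>_. M)) (\<lambda>z. \<Prod>i=1..N. f (z i))"
proof (rule sym)
  interpret M: prob_space M by fact
  interpret D: prob_space "density M f" by fact
  interpret PM: product_sigma_finite "\<lambda>_::nat. M"
    by (simp add: product_sigma_finite_def M.sigma_finite_measure_axioms)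
  interpret PD: product_sigma_finite "\<lambda>_::nat. density M f"
    by (simp add: product_sigma_finite_def D.sigma_finite_measure_axioms)
  let ?P = "PiM {1..N} (\<lambda>_. M)"
  have sets_eq: "sets (PiM {1..N} (\<lambda>_. density M f)) = sets ?P"
    by (intro sets_PiM_cong) auto
  show "density ?P (\<lambda>z. \<Prod>i=1..N. f (z i)) = PiM {1..N} (\<lambda>_. density M f)"
  proof (rule PD.PiM_eqI)
    fix A assume "\<And>i. i \<in> {1..N} \<Longrightarrow> A i \<in> sets (density M f)"
    then have A[measurable]: "\<And>i. i \<in> {1..N} \<Longrightarrow> A i \<in> sets M" by simp
    have "emeasure (density ?P (\<lambda>z. \<Prod>i=1..N. f (z i))) (Pi\<^sub>E {1..N} A) =
        (\<integral>\<^sup>+z. (\<Prod>i=1..N. f (z i)) * indicator (Pi\<^sub>E {1..N} A) z \<partial>?P)"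
      using A by (intro emeasure_density) (auto intro!: sets_PiM_I_finite)
    also have "\<dots> = (\<integral>\<^sup>+z. (\<Prod>i=1..N. f (z i) * indicator (A i) (z i)) \<partial>?P)"
    proof (rule nn_integral_cong)
      fix z assume "z \<in> space ?P"
      then have "indicator (Pi\<^sub>E {1..N} A) z = (\<Prod>i=1..N. indicator (A i) (z i) :: ennreal)"
        by (auto simp: space_PiM PiE_iff indicator_def split: if_splits)
      then show "(\<Prod>i=1..N. f (z i)) * indicator (Pi\<^sub>E {1..N} A) z =
          (\<Prod>i=1..N. f (z i) * indicator (A i) (z i))"
        by (simp add: prod.distrib)
    qed
    also have "\<dots> = (\<Prod>i=1..N. \<integral>\<^sup>+x. f x * indicator (A i) x \<partial>M)"
      by (rule PM.product_nn_integral_prod) auto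
    also have "\<dots> = (\<Prod>i=1..N. emeasure (density M f) (A i))"
      using A by (intro prod.cong refl emeasure_density[symmetric]) auto
    finally show "emeasure (density ?P (\<lambda>z. \<Prod>i=1..N. f (z i))) (Pi\<^sub>E {1..N} A) =
        (\<Prod>i=1..N. emeasure (density M f) (A i))" .
  qed (simp_all only: sets_density sets_eq finite_atLeastAtMost)
qed

text \<open>Chernoff's bound: Markov's inequality for \<open>exp (\<Sum>\<^sub>i f (z\<^sub>i))\<close>, whose mean is \<open>exp (N * log_mgf M f)\<close>.\<close>

lemma sample_average_tail:
  assumes "prob_space M" and f: "f \<in> bounded_measurable M"
  shows "measure (PiM {1..N::nat} (\<lambda>_. M)) {z \<in> space (PiM {1..N} (\<lambda>_. M)). real N * a < (\<Sum>i=1..N. f (z i))}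
    \<le> exp (real N * (log_mgf M f - a))"
proof -
  interpret M: prob_space M by fact
  let ?P = "PiM {1..N} (\<lambda>_. M)"
  interpret PP: prob_space ?P using assms(1) by (intro prob_space_PiM)
  interpret PM: product_sigma_finite "\<lambda>_::nat. M"
    by (simp add: product_sigma_finite_def M.sigma_finite_measure_axioms)
  have [measurable]: "f \<in> borel_measurable M" using f by (rule bounded_measurableD)
  have exp_int: "integrable M (\<lambda>x. exp (f x))"
    by (rule M.integrable_bounded_measurable[OF exp_bounded_measurable[OF f]])
  let ?u = "\<lambda>z. \<Prod>i=1..N. exp (f (z i))"
  have u_int: "integrable ?P ?u"
    by (rule PM.product_integrable_prod[where f="\<lambda>_ x. exp (f x)"]) (use exp_int in auto)
  have u_eq: "(\<integral>z. ?u z \<partial>?P) = exp (real N * log_mgf M f)"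
  proof -
    have "(\<integral>z. ?u z \<partial>?P) = (\<Prod>i=1..N. \<integral>x. exp (f x) \<partial>M)"
      by (rule PM.product_integral_prod[where f="\<lambda>_ x. exp (f x)"]) (use exp_int in auto)
    also have "\<dots> = exp (log_mgf M f) ^ N" by (simp add: M.exp_log_mgf[OF f])
    also have "\<dots> = exp (real N * log_mgf M f)" by (simp only: exp_of_nat_mult)
    finally show ?thesis .
  qed
  have "measure ?P {z \<in> space ?P. real N * a < (\<Sum>i=1..N. f (z i))} \<le>
      measure ?P {z \<in> space ?P. exp (real N * a) \<le> ?u z}"
    by (intro PP.finite_measure_mono) (auto simp: exp_sum[symmetric])
  also have "\<dots> \<le> (\<integral>z. ?u z \<partial>?P) / exp (real N * a)"
    using u_int by (intro integral_Markov_inequality_measure[where A="{}"] AE_I2 prod_nonneg) auto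
  also have "\<dots> = exp (real N * (log_mgf M f - a))"
    unfolding u_eq by (simp add: exp_diff right_diff_distrib)
  finally show ?thesis .
qed

lemma bounded_weak_law:
  assumes "prob_space M" and [measurable]: "h \<in> borel_measurable M"
    and K: "\<And>x. x \<in> space M \<Longrightarrow> \<bar>h x\<bar> \<le> K" "0 < K" and "0 < \<delta>" "0 < N"
  shows "measure (PiM {1..N::nat} (\<lambda>_. M))
      {z \<in> space (PiM {1..N} (\<lambda>_. M)). real N * ((\<integral>x. h x \<partial>M) + \<delta>) \<le> (\<Sum>i=1..N. h (z i))}
    \<le> exp (- (real N * (\<delta>\<^sup>2 / (2 * K\<^sup>2))))"
proof -
  interpret M: prob_space M by fact
  let ?P = "PiM {1..N} (\<lambda>_. M)"
  interpret PP: prob_space ?P using assms(1) by (intro prob_space_PiM)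
  define X where "X = (\<lambda>(i::nat) z. h (z i) :: real)"
  have comp: "distr ?P M (\<lambda>z. z i) = M" if "i \<in> {1..N}" for i
    using that assms(1) by (intro distr_PiM_component) auto
  interpret H: Hoeffding_ineq ?P "{1..N}" X "\<lambda>_. - K" "\<lambda>_. K" "\<Sum>i\<in>{1..N}. PP.expectation (X i)"
  proof unfold_locales
    have "PP.indep_vars (\<lambda>_. borel) (\<lambda>i z. h (z i)) {1..N}"
      by (rule PP.indep_vars_compose2[OF indep_vars_coordinates[OF assms(1) \<open>0 < N\<close>]]) auto
    then show "PP.indep_vars (\<lambda>_. borel) X {1..N}" by (simp add: X_def)
    show "AE z in ?P. X i z \<in> {- K..K}" if "i \<in> {1..N}" for i
      unfolding X_def using that K(1)
      by (intro AE_I2) (auto simp: space_PiM PiE_iff abs_le_iff minus_le_iff)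
  qed auto
  have "PP.expectation (X i) = (\<integral>x. h x \<partial>M)" if "i \<in> {1..N}" for i
    using that integral_distr[of "\<lambda>z. z i" ?P M h] comp[OF that] by (simp add: X_def)
  then have E: "(\<Sum>i\<in>{1..N}. PP.expectation (X i)) = real N * (\<integral>x. h x \<partial>M)" by simp
  have "measure ?P {z \<in> space ?P. (\<Sum>i=1..N. X i z) \<ge> (\<Sum>i\<in>{1..N}. PP.expectation (X i)) + real N * \<delta>}
      \<le> exp (- 2 * (real N * \<delta>)\<^sup>2 / (\<Sum>i\<in>{1..N}. (K - - K)\<^sup>2))"
    using assms by (intro H.Hoeffding_ineq_ge) auto
  also have "- 2 * (real N * \<delta>)\<^sup>2 / (\<Sum>i\<in>{1..N}. (K - - K)\<^sup>2) = - (real N * (\<delta>\<^sup>2 / (2 * K\<^sup>2)))"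
    using K(2) \<open>0 < N\<close> by (simp add: power2_eq_square field_simps)
  finally show ?thesis
    by (simp only: E distrib_left) (simp only: X_def)
qed

text \<open>The logarithms of the densities are merely integrable, so this is proved by truncation: if \<open>h\<close> is \<open>g\<close>
  truncated at a high level, the average of \<open>h\<close> is controlled by Hoeffding's inequality, and that of
  \<open>g - h\<close> by Markov's inequality, since \<open>g - h\<close> is small in \<open>L\<^sup>1\<close>.\<close>

lemma weak_law_of_large_numbers:
  fixes g :: "'t \<Rightarrow> real"
  assumes "prob_space M" and g: "integrable M g" and \<delta>: "0 < \<delta>"
  shows "(\<lambda>N. measure (PiM {1..N::nat} (\<lambda>_. M))
      {z \<in> space (PiM {1..N} (\<lambda>_. M)). real N * ((\<integral>x. g x \<partial>M) + \<delta>) < (\<Sum>i=1..N. g (z i))})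
    \<longlonglongrightarrow> 0"
proof (rule LIMSEQ_I)
  fix \<eta> :: real assume \<eta>: "0 < \<eta>"
  interpret M: prob_space M by fact
  have [measurable]: "g \<in> borel_measurable M" using g by auto
  define t where "t = (\<lambda>K::nat. \<lambda>x. max (- real K) (min (g x) (real K)))"
  have [measurable]: "t K \<in> borel_measurable M" for K unfolding t_def by measurable
  have t_bd: "\<bar>t K x\<bar> \<le> real K" for K x by (auto simp: t_def)
  have "(\<lambda>K. \<integral>x. \<bar>g x - t K x\<bar> \<partial>M) \<longlonglongrightarrow> (\<integral>x. 0 \<partial>M)"
  proof (rule integral_dominated_convergence[where w="\<lambda>x. \<bar>g x\<bar>"])
    show "AE x in M. (\<lambda>K. \<bar>g x - t K x\<bar>) \<longlonglongrightarrow> 0"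
    proof (intro AE_I2 tendsto_eventually)
      fix x
      show "\<forall>\<^sub>F K in sequentially. \<bar>g x - t K x\<bar> = 0"
        using eventually_ge_at_top[of "nat \<lceil>\<bar>g x\<bar>\<rceil>"]
      proof eventually_elim
        case (elim K)
        then have "\<bar>g x\<bar> \<le> real K" by linarith
        then show ?case by (auto simp: t_def)
      qed
    qed
    show "AE x in M. norm \<bar>g x - t K x\<bar> \<le> \<bar>g x\<bar>" for K
      by (intro AE_I2) (auto simp: t_def)
  qed (use g in auto)
  moreover have "0 < min (\<delta> / 4) (\<delta> * \<eta> / 4)" using \<delta> \<eta> by simp
  ultimately have "\<forall>\<^sub>F K in sequentially. (\<integral>x. \<bar>g x - t K x\<bar> \<partial>M) < min (\<delta> / 4) (\<delta> * \<eta> / 4)"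
    by (intro order_tendstoD(2)) auto
  then have "\<forall>\<^sub>F K in sequentially. (\<integral>x. \<bar>g x - t K x\<bar> \<partial>M) < min (\<delta> / 4) (\<delta> * \<eta> / 4) \<and> 0 < K"
    using eventually_gt_at_top[of 0] by eventually_elim simp
  then obtain K where K: "(\<integral>x. \<bar>g x - t K x\<bar> \<partial>M) < min (\<delta> / 4) (\<delta> * \<eta> / 4)" "0 < K"
    using eventually_happens by fastforce
  define h where "h = t K"
  have [measurable]: "h \<in> borel_measurable M" by (simp add: h_def)
  have h_int: "integrable M h"
    using t_bd by (intro M.integrable_const_bound[of _ "real K"]) (auto simp: h_def)
  define e where "e = (\<integral>x. \<bar>g x - h x\<bar> \<partial>M)"
  have e: "e < \<delta> / 4" "e < \<delta> * \<eta> / 4" using K by (auto simp: e_def h_def)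
  have hg: "(\<integral>x. h x \<partial>M) \<le> (\<integral>x. g x \<partial>M) + \<delta> / 4"
  proof -
    have "(\<integral>x. h x - g x \<partial>M) \<le> e"
      unfolding e_def using g h_int by (intro integral_mono) auto
    then show ?thesis using e g h_int by simp
  qed
  \<comment> \<open>the exponential rate in Hoeffding's inequality with margin \<open>\<delta> / 4\<close> for values in \<open>[-K, K]\<close>\<close>
  define r where "r = (\<delta> / 4)\<^sup>2 / (2 * (real K)\<^sup>2)"
  have "0 < r" using \<delta> K by (simp add: r_def)
  then have "(\<lambda>N. exp (- (real N * r))) \<longlonglongrightarrow> 0"
    by (intro filterlim_compose[OF exp_at_bot] filterlim_compose[OF filterlim_uminus_at_bot_at_top]
        filterlim_at_top_mult_tendsto_pos[OF tendsto_const] filterlim_real_sequentially)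
      (auto intro!: filterlim_tendsto_pos_mult_at_top[OF tendsto_const] filterlim_real_sequentially simp: mult.commute)
  then have "\<forall>\<^sub>F N in sequentially. exp (- (real N * r)) < \<eta> / 2"
    using \<eta> by (intro order_tendstoD(2)) auto
  then have "\<forall>\<^sub>F N in sequentially. norm (measure (PiM {1..N::nat} (\<lambda>_. M))
      {z \<in> space (PiM {1..N} (\<lambda>_. M)). real N * ((\<integral>x. g x \<partial>M) + \<delta>) < (\<Sum>i=1..N. g (z i))} - 0) < \<eta>"
    using eventually_gt_at_top[of 0]
  proof eventually_elim
    case (elim N)
    let ?P = "PiM {1..N} (\<lambda>_. M)"
    interpret PP: prob_space ?P using assms(1) by (intro prob_space_PiM)
    let ?A = "{z \<in> space ?P. real N * ((\<integral>x. h x \<partial>M) + \<delta> / 4) \<le> (\<Sum>i=1..N. h (z i))}"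
    let ?B = "{z \<in> space ?P. real N * (\<delta> / 2) \<le> (\<Sum>i=1..N. \<bar>g (z i) - h (z i)\<bar>)}"
    have A: "measure ?P ?A < \<eta> / 2"
      using bounded_weak_law[OF assms(1), of h "real K" "\<delta> / 4" N] t_bd K \<delta> elim
      by (simp add: h_def r_def)
    have comp: "distr ?P M (\<lambda>z. z i) = M" if "i \<in> {1..N}" for i
      using that assms(1) by (intro distr_PiM_component) auto
    have int_i: "integrable ?P (\<lambda>z. \<bar>g (z i) - h (z i)\<bar>)" "(\<integral>z. \<bar>g (z i) - h (z i)\<bar> \<partial>?P) = e"
      if i: "i \<in> {1..N}" for i
      using i integral_distr[of "\<lambda>z. z i" ?P M "\<lambda>x. \<bar>g x - h x\<bar>"] comp[OF i]
        integrable_distr[of "\<lambda>z. z i" ?P M "\<lambda>x. \<bar>g x - h x\<bar>"] g h_int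
      by (auto simp: e_def)
    have "measure ?P ?B \<le> (\<integral>z. (\<Sum>i=1..N. \<bar>g (z i) - h (z i)\<bar>) \<partial>?P) / (real N * (\<delta> / 2))"
      using int_i \<delta> elim by (intro integral_Markov_inequality_measure[where A="{}"] AE_I2 sum_nonneg) auto
    also have "\<dots> = e / (\<delta> / 2)"
      using int_i elim by simp
    also have "\<dots> < \<eta> / 2" using e \<delta> by (simp add: field_simps)
    finally have B: "measure ?P ?B < \<eta> / 2" .
    have "{z \<in> space ?P. real N * ((\<integral>x. g x \<partial>M) + \<delta>) < (\<Sum>i=1..N. g (z i))} \<subseteq> ?A \<union> ?B"
    proof safe
      fix z assume z: "real N * ((\<integral>x. g x \<partial>M) + \<delta>) < (\<Sum>i=1..N. g (z i))"
        and nB: "\<not> real N * (\<delta> / 2) \<le> (\<Sum>i=1..N. \<bar>g (z i) - h (z i)\<bar>)"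
      have "(\<Sum>i=1..N. g (z i)) \<le> (\<Sum>i=1..N. h (z i) + \<bar>g (z i) - h (z i)\<bar>)"
        by (intro sum_mono) linarith
      then have "(\<Sum>i=1..N. g (z i)) < (\<Sum>i=1..N. h (z i)) + real N * (\<delta> / 2)"
        using nB by (simp add: sum.distrib)
      moreover have "real N * (\<integral>x. h x \<partial>M) \<le> real N * ((\<integral>x. g x \<partial>M) + \<delta> / 4)"
        using hg by (intro mult_left_mono) auto
      ultimately show "real N * ((\<integral>x. h x \<partial>M) + \<delta> / 4) \<le> (\<Sum>i=1..N. h (z i))"
        using z by (simp add: distrib_left)
    qed
    then have "measure ?P {z \<in> space ?P. real N * ((\<integral>x. g x \<partial>M) + \<delta>) < (\<Sum>i=1..N. g (z i))}
        \<le> measure ?P (?A \<union> ?B)"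
      by (intro PP.finite_measure_mono) auto
    also have "\<dots> \<le> measure ?P ?A + measure ?P ?B"
      by (rule measure_Un_le) measurable
    finally show ?case using A B by simp
  qed
  then show "\<exists>no. \<forall>N\<ge>no. norm (measure (PiM {1..N::nat} (\<lambda>_. M))
      {z \<in> space (PiM {1..N} (\<lambda>_. M)). real N * ((\<integral>x. g x \<partial>M) + \<delta>) < (\<Sum>i=1..N. g (z i))} - 0) < \<eta>"
    by (simp add: eventually_sequentially)
qed

text \<open>Under i.i.d. samples from \<open>M\<close>, the one-sided law of large numbers holds for finitely many functions at
  once, with a probability that is eventually at least \<open>1 / 2\<close> (it tends to 1).\<close>

lemma eventually_sample_averages_typical:
  fixes G :: "('t \<Rightarrow> real) set"
  assumes "prob_space M" "finite G" and int: "\<And>g. g \<in> G \<Longrightarrow> integrable M g" and "0 < \<delta>"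
  shows "\<forall>\<^sub>F N in sequentially. 1 / 2 \<le> measure (PiM {1..N::nat} (\<lambda>_. M))
    {z \<in> space (PiM {1..N} (\<lambda>_. M)). \<forall>g\<in>G. (\<Sum>i=1..N. g (z i)) \<le> real N * ((\<integral>x. g x \<partial>M) + \<delta>)}"
proof -
  let ?P = "\<lambda>N. PiM {1..N::nat} (\<lambda>_. M)"
  let ?B = "\<lambda>N g. {z \<in> space (?P N). real N * ((\<integral>x. g x \<partial>M) + \<delta>) < (\<Sum>i=1..N. g (z i))}"
  have "(\<lambda>N. \<Sum>g\<in>G. measure (?P N) (?B N g)) \<longlonglongrightarrow> 0"
    using int assms by (intro tendsto_null_sum weak_law_of_large_numbers) auto
  then have "\<forall>\<^sub>F N in sequentially. (\<Sum>g\<in>G. measure (?P N) (?B N g)) < 1 / 2"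
    by (intro order_tendstoD(2)) auto
  then show ?thesis
  proof eventually_elim
    case (elim N)
    interpret PP: prob_space "?P N" using assms(1) by (intro prob_space_PiM)
    have B: "?B N g \<in> sets (?P N)" if "g \<in> G" for g
    proof -
      have [measurable]: "g \<in> borel_measurable M" using int[OF that] by auto
      show ?thesis by measurable
    qed
    have U: "(\<Union>g\<in>G. ?B N g) \<in> sets (?P N)" using B assms(2) by (intro sets.finite_UN) auto
    have "measure (?P N) (\<Union>g\<in>G. ?B N g) \<le> (\<Sum>g\<in>G. measure (?P N) (?B N g))"
      using assms(2) B by (intro PP.finite_measure_subadditive_finite) auto
    moreover have "measure (?P N) (space (?P N) - (\<Union>g\<in>G. ?B N g)) = 1 - measure (?P N) (\<Union>g\<in>G. ?B N g)"
      using U by (rule PP.prob_compl)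
    moreover have "space (?P N) - (\<Union>g\<in>G. ?B N g) =
        {z \<in> space (?P N). \<forall>g\<in>G. (\<Sum>i=1..N. g (z i)) \<le> real N * ((\<integral>x. g x \<partial>M) + \<delta>)}"
      by (auto simp: not_less)
    ultimately show ?case using elim by simp
  qed
qed

text \<open>The Borel-Cantelli lemma in the form used below. Only the \<open>N\<close> in \<open>S\<close> are considered since the model makes
  statements about admissible sizes only.\<close>

lemma (in prob_space) AE_eventually_of_exp_bound:
  assumes meas: "\<And>N. N \<in> S \<Longrightarrow> B N \<in> events"
    and le: "\<And>N. N \<in> S \<Longrightarrow> N \<ge> N0 \<Longrightarrow> prob (B N) \<le> C * exp (- (real N * c))" and c: "0 < c"
  shows "AE \<omega> in M. \<forall>\<^sub>F N in inf sequentially (principal S). \<omega> \<notin> B N"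
proof -
  define B' where "B' = (\<lambda>N. if N \<in> S then B N else {})"
  have "summable (\<lambda>N. \<bar>C\<bar> * exp (- c) ^ N)"
    using c by (intro summable_mult summable_geometric) simp
  then have "summable (\<lambda>N. prob (B' N))"
  proof (rule summable_comparison_test_ev[rotated])
    show "\<forall>\<^sub>F N in sequentially. norm (prob (B' N)) \<le> \<bar>C\<bar> * exp (- c) ^ N"
      using eventually_ge_at_top[of N0]
    proof eventually_elim
      case (elim N)
      have "exp (- (real N * c)) = exp (- c) ^ N"
        by (simp add: exp_of_nat_mult[symmetric])
      moreover have "prob (B N) \<le> \<bar>C\<bar> * exp (- (real N * c))" if "N \<in> S"
        using order_trans[OF le[OF that elim] mult_right_mono[OF abs_ge_self]] by simp
      ultimately show ?case by (auto simp: B'_def)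
    qed
  qed
  then have "AE \<omega> in M. \<forall>\<^sub>F N in sequentially. \<omega> \<in> space M - B' N"
    using meas by (intro borel_cantelli_AE1) (auto simp: B'_def emeasure_eq_measure)
  then show ?thesis
  proof eventually_elim
    case (elim \<omega>)
    then show ?case unfolding eventually_inf_principal by eventually_elim (auto simp: B'_def)
  qed
qed

section \<open>The law of the hierarchical model\<close>

text \<open>Both sides are means of \<open>f\<close>, so by \<open>means_eqI\<close> it suffices to compare them on indicators, where
  \<open>emeasure_empirical_measure\<close> applies.\<close>

lemma integral_empirical_measure:
  assumes N: "0 < N" and x: "\<And>i. i \<in> {1..N} \<Longrightarrow> x i \<in> topspace T"
    and M: "sets M = sets (borel_algebra T)" and f: "f \<in> bounded_measurable M"
  shows "(\<integral>y. f y \<partial>empirical_measure T N x) = (\<Sum>i=1..N. f (x i)) / real N"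
proof -
  let ?E = "empirical_measure T N x"
  let ?m = "\<lambda>f. if f \<in> bounded_measurable M then (\<Sum>i=1..N. f (x i)) / real N else 0"
  have sp: "space M = topspace T" using sets_eq_imp_space_eq[OF M] by simp
  have prob: "prob_space ?E"
    using empirical_measure_in_prob_measures[OF N x] by (simp add: prob_measures_def)
  have "?m \<in> means M"
  proof -
    have "(\<Sum>i=1..N. f (x i)) / real N \<le> a" if "\<forall>x\<in>space M. f x \<le> a" for f a
    proof -
      have "(\<Sum>i=1..N. f (x i)) \<le> (\<Sum>i=1..N. a)"
        using that x unfolding sp by (intro sum_mono) auto
      then show ?thesis using N by (simp add: divide_simps mult.commute)
    qed
    then show ?thesis
      unfolding means_def
      by (auto simp: bounded_measurable_add bounded_measurable_cmult sum.distrib add_divide_distrib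
          sum_distrib_left)
  qed
  moreover have "mean_of M ?E \<in> means M"
    using prob M by (intro mean_of_in_means) auto
  ultimately have "?m = mean_of M ?E"
  proof (rule means_eqI)
    fix A assume A: "A \<in> sets M"
    have i: "(indicator A :: _ \<Rightarrow> real) \<in> bounded_measurable M"
      using indicator_bounded_measurable[OF A, of 1] by simp
    have "measure ?E A = (\<Sum>i=1..N. indicator A (x i)) / real N"
    proof -
      have "emeasure ?E A = ennreal ((\<Sum>i=1..N. indicator A (x i)) / real N)"
        using A M N
        by (simp add: emeasure_empirical_measure ennreal_of_nat_eq_real_of_nat divide_ennreal[symmetric]
            sum_nonneg sum_ennreal[symmetric] ennreal_indicator del: sum_ennreal)
      then show ?thesis by (simp add: measure_def sum_nonneg)
    qed
    then show "?m (indicator A) = mean_of M ?E (indicator A)"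
      using i A M by (simp add: mean_of_def)
  qed
  from fun_cong[OF this, of f] show ?thesis using f by (simp add: mean_of_def)
qed

lemma finite_branches: "finite (branches \<gamma> N j)"
  by (auto simp: branches_def intro!: finite_PiE)

lemma restrict_branches:
  assumes "\<beta> \<in> branches \<gamma> N j" "k \<le> j"
  shows "restrict \<beta> {1..k} \<in> branches \<gamma> N k"
  using assms by (auto simp: branches_def PiE_iff)

lemma num_branches_eq_exp:
  assumes "N \<in> admissible n \<gamma>" "k \<in> {1..n}" "0 < \<gamma> k"
  shows "real (num_branches \<gamma> N k) = exp (real N * (\<gamma> k * ln 2))"
proof -
  have "of_int \<lfloor>\<gamma> k * real N\<rfloor> = \<gamma> k * real N"
    using assms by (auto simp: admissible_def elim!: Ints_cases)
  moreover have "0 \<le> \<gamma> k * real N" using assms by simp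
  ultimately have "real (nat \<lfloor>\<gamma> k * real N\<rfloor>) = \<gamma> k * real N" by simp
  moreover have "real (num_branches \<gamma> N k) = exp (real (nat \<lfloor>\<gamma> k * real N\<rfloor>) * ln 2)"
    by (simp add: num_branches_def exp_of_nat_mult)
  ultimately show ?thesis by (simp add: mult_ac)
qed

text \<open>All \<open>\<mu> k\<close>, and not just those with \<open>1 \<le> k \<le> n\<close>, are probability measures here, because the locales for
  products of measures ask this of the whole family.\<close>

locale hierarchical_model = prob_space P for P :: "'w measure" +
  fixes n :: nat and \<gamma> :: "nat \<Rightarrow> real" and \<mu> :: "nat \<Rightarrow> 'a::polish_space measure"
    and X :: "nat \<Rightarrow> nat \<Rightarrow> (nat \<Rightarrow> nat) \<Rightarrow> nat \<Rightarrow> 'w \<Rightarrow> 'a"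
  assumes prob_\<mu>: "\<And>k. prob_space (\<mu> k)" and sets_\<mu>: "\<And>k. sets (\<mu> k) = sets borel"
    and \<gamma>_pos: "\<And>k. k \<in> {1..n} \<Longrightarrow> \<gamma> k > 0"
    and \<gamma>_sum: "(\<Sum>k=1..n. \<gamma> k) = 1"
    and X_indep: "\<And>N. N \<in> admissible n \<gamma> \<Longrightarrow>
      indep_vars (\<lambda>_. borel) (\<lambda>(j, \<beta>, i). X N j \<beta> i) (rv_indices n \<gamma> N)"
    and X_distr: "\<And>N j \<beta> i. N \<in> admissible n \<gamma> \<Longrightarrow> (j, \<beta>, i) \<in> rv_indices n \<gamma> N \<Longrightarrow>
      distr P borel (X N j \<beta> i) = \<mu> j"
begin

abbreviation \<Gamma> :: "nat \<Rightarrow> real" where "\<Gamma> j \<equiv> \<Sum>k=1..j. \<gamma> k"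

abbreviation M where "M \<equiv> PiM {1..n} \<mu>"

abbreviation laws :: "(nat \<Rightarrow> 'a) measure set" where "laws \<equiv> prob_measures (power_top n)"

abbreviation L :: "nat \<Rightarrow> (nat \<Rightarrow> nat) \<Rightarrow> 'w \<Rightarrow> (nat \<Rightarrow> 'a) measure" where
  "L N \<alpha> \<omega> \<equiv> path_empirical n X N \<alpha> \<omega>"

text \<open>Limits along \<open>N \<rightarrow> \<infinity>\<close> restricted to admissible \<open>N\<close>.\<close>

abbreviation sizes :: "nat filter" where "sizes \<equiv> inf sequentially (principal (admissible n \<gamma>))"

lemma eventually_admissible: "\<forall>\<^sub>F N in sizes. N \<in> admissible n \<gamma>"
  by (simp add: eventually_inf_principal)

lemma eventually_sizesI: "eventually Q sequentially \<Longrightarrow> eventually Q sizes"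
  by (rule filter_leD[OF inf_le1])

abbreviation samples :: "nat \<Rightarrow> nat set \<Rightarrow> (nat \<Rightarrow> nat \<Rightarrow> 'a) measure" where
  "samples N J \<equiv> PiM {1..N} (\<lambda>_. PiM J \<mu>)"

text \<open>The data seen along the branch \<open>\<beta>\<close> at the levels in \<open>J\<close>: site \<open>i\<close>, then level \<open>k\<close>. For \<open>J = {1..j}\<close> this
  collects the points \<open>path_point j X N \<beta> i\<close>; other \<open>J\<close> describe the part that a branch does not share with
  another one.\<close>

definition sample_block :: "nat \<Rightarrow> nat set \<Rightarrow> (nat \<Rightarrow> nat) \<Rightarrow> 'w \<Rightarrow> nat \<Rightarrow> nat \<Rightarrow> 'a" where
  "sample_block N J \<beta> \<omega> = (\<lambda>i\<in>{1..N}. \<lambda>k\<in>J. X N k (restrict \<beta> {1..k}) i \<omega>)"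

lemma n_pos: "1 \<le> n"
  using \<gamma>_sum by (cases n) auto

lemma prob_PiM: "prob_space (PiM J \<mu>)"
  by (intro prob_space_PiM prob_\<mu>)

lemma prob_samples: "prob_space (samples N J)"
  by (intro prob_space_PiM prob_\<mu>)

lemma sets_PiM_\<mu>: "sets (PiM J \<mu>) = sets (PiM J (\<lambda>_. borel))"
  by (intro sets_PiM_cong refl sets_\<mu>)

lemma sets_PiM_power_top: "sets (PiM {1..j} \<mu>) = sets (borel_algebra (power_top j))"
  by (simp only: sets_borel_algebra_power_top sets_PiM_\<mu>)

lemma space_PiM_\<mu>: "space (PiM J \<mu>) = (J \<rightarrow>\<^sub>E UNIV)"
  using sets_eq_imp_space_eq[OF sets_PiM_\<mu>] by (simp add: space_PiM)

lemma card_branches: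
  assumes N: "N \<in> admissible n \<gamma>" and j: "j \<le> n"
  shows "real (card (branches \<gamma> N j)) = exp (real N * (\<Gamma> j * ln 2))"
proof -
  have "card (branches \<gamma> N j) = (\<Prod>k=1..j. num_branches \<gamma> N k)"
    by (simp add: branches_def card_PiE)
  then have "real (card (branches \<gamma> N j)) = (\<Prod>k=1..j. real (num_branches \<gamma> N k))"
    by simp
  also have "\<dots> = (\<Prod>k=1..j. exp (real N * (\<gamma> k * ln 2)))"
    using j \<gamma>_pos by (intro prod.cong refl num_branches_eq_exp[OF N]) auto
  also have "\<dots> = exp (real N * (\<Gamma> j * ln 2))"
    by (simp add: exp_sum[symmetric] sum_distrib_left sum_distrib_right)
  finally show ?thesis .
qed

lemma branches_prefix:
  assumes "\<alpha> \<in> branches \<gamma> N n" "k \<in> {1..n}"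
  shows "restrict \<alpha> {1..k} \<in> branches \<gamma> N k"
  using restrict_branches[OF assms(1)] assms(2) by simp

lemma random_variable_site:
  assumes N: "N \<in> admissible n \<gamma>" and J: "J \<subseteq> {1..n}"
    and \<beta>: "\<And>k. k \<in> J \<Longrightarrow> restrict \<beta> {1..k} \<in> branches \<gamma> N k" and k: "k \<in> J" and i: "i \<in> {1..N}"
  shows "random_variable borel (X N k (restrict \<beta> {1..k}) i)"
proof -
  have "(k, restrict \<beta> {1..k}, i) \<in> rv_indices n \<gamma> N"
    using assms by (auto simp: rv_indices_def)
  then show ?thesis using X_indep[OF N] unfolding indep_vars_def2 by force
qed

text \<open>The sites are independent because they use disjoint sets of variables; within one site the variables at
  different levels are independent with laws \<open>\<mu> k\<close>.\<close>

lemma distr_sample_block: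
  assumes N: "N \<in> admissible n \<gamma>" and J: "J \<subseteq> {1..n}" "J \<noteq> {}"
    and \<beta>: "\<And>k. k \<in> J \<Longrightarrow> restrict \<beta> {1..k} \<in> branches \<gamma> N k"
  shows "distr P (samples N J) (sample_block N J \<beta>) = samples N J"
proof -
  have N0: "0 < N" using N by (simp add: admissible_def)
  define Y where "Y = (\<lambda>(k, i). X N k (restrict \<beta> {1..k}) i)"
  let ?h = "\<lambda>(k, i). (k, restrict \<beta> {1..k}, i)"
  have h: "inj_on ?h (J \<times> {1..N})" "?h ` (J \<times> {1..N}) \<subseteq> rv_indices n \<gamma> N"
    using J \<beta> by (auto simp: inj_on_def rv_indices_def)
  have Y_indep: "indep_vars (\<lambda>_. borel) Y (J \<times> {1..N})"
    using indep_vars_reindex[OF X_indep[OF N] h] by (simp add: Y_def case_prod_unfold)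
  have Y_distr: "distr P borel (Y (k, i)) = \<mu> k" if "k \<in> J" "i \<in> {1..N}" for k i
  proof -
    have "(k, restrict \<beta> {1..k}, i) \<in> rv_indices n \<gamma> N"
      using that J \<beta> by (auto simp: rv_indices_def)
    then show ?thesis using X_distr[OF N] by (simp add: Y_def)
  qed
  have Y_rv[measurable]: "random_variable borel (Y (k, i))" if "k \<in> J" "i \<in> {1..N}" for k i
    using random_variable_site[OF N J(1) \<beta> that] by (simp add: Y_def)
  let ?B = "\<lambda>i \<omega>. \<lambda>k\<in>J. Y (k, i) \<omega>"
  have B_rv: "random_variable (PiM J \<mu>) (?B i)" if "i \<in> {1..N}" for i
    using that unfolding measurable_cong_sets[OF refl sets_PiM_\<mu>] by measurable
  have "indep_vars (\<lambda>i. PiM (J \<times> {i}) (\<lambda>_. borel)) (\<lambda>i \<omega>. restrict (\<lambda>t. Y t \<omega>) (J \<times> {i})) {1..N}"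
    by (rule indep_vars_restrict[OF Y_indep]) (auto simp: disjoint_family_on_def)
  then have "indep_vars (\<lambda>_. PiM J \<mu>) (\<lambda>i \<omega>. \<lambda>k\<in>J. restrict (\<lambda>t. Y t \<omega>) (J \<times> {i}) (k, i)) {1..N}"
  proof (rule indep_vars_compose2)
    fix i assume "i \<in> {1..N}"
    show "(\<lambda>v. \<lambda>k\<in>J. v (k, i)) \<in> measurable (PiM (J \<times> {i}) (\<lambda>_. borel)) (PiM J \<mu>)"
      unfolding measurable_cong_sets[OF refl sets_PiM_\<mu>]
      by (intro measurable_restrict measurable_component_singleton) auto
  qed
  then have "indep_vars (\<lambda>_. PiM J \<mu>) ?B {1..N}"
    by (simp cong: restrict_cong)
  then have "distr P (samples N J) (\<lambda>\<omega>. \<lambda>i\<in>{1..N}. ?B i \<omega>) = PiM {1..N} (\<lambda>i. distr P (PiM J \<mu>) (?B i))"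
    using N0 B_rv by (subst (asm) indep_vars_iff_distr_eq_PiM') auto
  also have "\<dots> = samples N J"
  proof (intro PiM_cong refl)
    fix i assume i: "i \<in> {1..N}"
    have "indep_vars (\<lambda>_. borel) (\<lambda>k. Y (k, i)) J"
      by (rule indep_vars_reindex[OF Y_indep]) (use i in \<open>auto simp: inj_on_def\<close>)
    then have "distr P (PiM J (\<lambda>_. borel)) (?B i) = PiM J (\<lambda>k. distr P borel (Y (k, i)))"
      using J(2) i by (subst (asm) indep_vars_iff_distr_eq_PiM') auto
    also have "\<dots> = PiM J \<mu>" using i by (intro PiM_cong refl Y_distr)
    finally show "distr P (PiM J \<mu>) (?B i) = PiM J \<mu>"
      by (simp add: distr_cong[OF refl sets_PiM_\<mu> refl])
  qed
  also have "(\<lambda>\<omega>. \<lambda>i\<in>{1..N}. ?B i \<omega>) = sample_block N J \<beta>"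
    by (simp add: sample_block_def Y_def fun_eq_iff)
  finally show ?thesis .
qed

lemma measurable_sample_block:
  assumes "N \<in> admissible n \<gamma>" "J \<subseteq> {1..n}"
    and "\<And>k. k \<in> J \<Longrightarrow> restrict \<beta> {1..k} \<in> branches \<gamma> N k"
  shows "sample_block N J \<beta> \<in> measurable P (samples N J)"
proof -
  have [measurable]: "random_variable borel (X N k (restrict \<beta> {1..k}) i)" if "k \<in> J" "i \<in> {1..N}" for k i
    using random_variable_site[OF assms that] .
  have "(\<lambda>\<omega>. \<lambda>k\<in>J. X N k (restrict \<beta> {1..k}) i \<omega>) \<in> measurable P (PiM J \<mu>)" if "i \<in> {1..N}" for i
    using that unfolding measurable_cong_sets[OF refl sets_PiM_\<mu>] by measurable
  then show ?thesis unfolding sample_block_def[abs_def] by (rule measurable_restrict)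
qed

text \<open>Blocks that share no variable are independent. A variable is shared exactly if, at a common level, both
  branches have the same prefix.\<close>

lemma indep_sample_blocks:
  assumes N: "N \<in> admissible n \<gamma>"
    and J: "J \<subseteq> {1..n}" "\<And>k. k \<in> J \<Longrightarrow> restrict \<beta> {1..k} \<in> branches \<gamma> N k"
    and J': "J' \<subseteq> {1..n}" "\<And>k. k \<in> J' \<Longrightarrow> restrict \<beta>' {1..k} \<in> branches \<gamma> N k"
    and disj: "\<And>k. k \<in> J \<Longrightarrow> k \<in> J' \<Longrightarrow> restrict \<beta> {1..k} \<noteq> restrict \<beta>' {1..k}"
  shows "indep_var (samples N J) (sample_block N J \<beta>) (samples N J') (sample_block N J' \<beta>')"
proof -
  let ?X = "\<lambda>(j, \<beta>, i). X N j \<beta> i"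
  let ?A = "\<lambda>J \<beta>. (\<lambda>(k, i). (k, restrict \<beta> {1..k}, i)) ` (J \<times> {1..N})"
  let ?Y = "\<lambda>J \<beta> v. \<lambda>i\<in>{1..N}. \<lambda>k\<in>J. v (k, restrict \<beta> {1..k}, i)"
  have ind: "indep_var (PiM (?A J \<beta>) (\<lambda>_. borel)) (\<lambda>\<omega>. restrict (\<lambda>t. ?X t \<omega>) (?A J \<beta>))
      (PiM (?A J' \<beta>') (\<lambda>_. borel)) (\<lambda>\<omega>. restrict (\<lambda>t. ?X t \<omega>) (?A J' \<beta>'))"
    using J J' disj by (intro indep_var_restrict[OF X_indep[OF N]]) (auto simp: rv_indices_def)
  have meas: "?Y J \<beta> \<in> measurable (PiM (?A J \<beta>) (\<lambda>_. borel)) (samples N J)" for J \<beta>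
  proof (rule measurable_restrict)
    fix i assume "i \<in> {1..N}"
    then show "(\<lambda>v. \<lambda>k\<in>J. v (k, restrict \<beta> {1..k}, i)) \<in> measurable (PiM (?A J \<beta>) (\<lambda>_. borel)) (PiM J \<mu>)"
      unfolding measurable_cong_sets[OF refl sets_PiM_\<mu>]
      by (intro measurable_restrict measurable_component_singleton) auto
  qed
  have "indep_var (samples N J) (?Y J \<beta> \<circ> (\<lambda>\<omega>. restrict (\<lambda>t. ?X t \<omega>) (?A J \<beta>)))
      (samples N J') (?Y J' \<beta>' \<circ> (\<lambda>\<omega>. restrict (\<lambda>t. ?X t \<omega>) (?A J' \<beta>')))"
    by (rule indep_var_compose[OF ind meas meas])
  moreover have "?Y J \<beta> \<circ> (\<lambda>\<omega>. restrict (\<lambda>t. ?X t \<omega>) (?A J \<beta>)) = sample_block N J \<beta>" for J \<beta>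
    by (auto simp: fun_eq_iff sample_block_def restrict_def)
  ultimately show ?thesis by simp
qed

lemma sample_block_path_point:
  "i \<in> {1..N} \<Longrightarrow> sample_block N {1..j} \<beta> \<omega> i = path_point j X N \<beta> i \<omega>"
  by (simp add: sample_block_def path_point_def)

lemma restrict_path_point:
  "j \<le> n \<Longrightarrow> restrict (path_point n X N \<alpha> i \<omega>) {1..j} = path_point j X N (restrict \<alpha> {1..j}) i \<omega>"
  by (auto simp: path_point_def fun_eq_iff restrict_def intro!: arg_cong[where f="\<lambda>b. X N _ b i \<omega>"])

lemma integral_path_empirical:
  assumes "0 < N" "f \<in> bounded_measurable (PiM {1..n} \<mu>)"
  shows "(\<integral>y. f y \<partial>L N \<alpha> \<omega>) = (\<Sum>i=1..N. f (path_point n X N \<alpha> i \<omega>)) / real N"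
  unfolding path_empirical_def using assms
  by (intro integral_empirical_measure[OF _ _ sets_PiM_power_top]) (auto simp: path_point_def)

lemma path_empirical_in_prob_measures:
  "0 < N \<Longrightarrow> L N \<alpha> \<omega> \<in> laws"
  unfolding path_empirical_def by (rule empirical_measure_in_prob_measures) (auto simp: path_point_def)

lemma mean_of_path_empirical:
  assumes "0 < N" "f \<in> bounded_measurable M"
  shows "mean_of M (L N \<alpha> \<omega>) f = (\<Sum>i=1..N. f (path_point n X N \<alpha> i \<omega>)) / real N"
  using integral_path_empirical[OF assms] assms(2) by (simp add: mean_of_def)

section \<open>Counting nodes by their sample averages\<close>

abbreviation nodes_above ::
    "nat \<Rightarrow> nat \<Rightarrow> ((nat \<Rightarrow> 'a) \<Rightarrow> real) \<Rightarrow> real \<Rightarrow> 'w \<Rightarrow> (nat \<Rightarrow> nat) set" where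
  "nodes_above N j f a \<omega> \<equiv> {\<beta> \<in> branches \<gamma> N j. real N * a < (\<Sum>i=1..N. f (path_point j X N \<beta> i \<omega>))}"

text \<open>First moment method: by Chernoff's bound the expected number is at most the right-hand side without
  \<open>\<epsilon>\<close>, so Markov's inequality bounds the probability of exceeding the right-hand side by \<open>e\<^sup>-\<^sup>N\<^sup>\<epsilon>\<close>.\<close>

lemma eventually_count_branches_le:
  assumes j: "j \<in> {1..n}" and f: "f \<in> bounded_measurable (PiM {1..j} \<mu>)" and \<epsilon>: "0 < \<epsilon>"
  shows "AE \<omega> in P. \<forall>\<^sub>F N in sizes.
    real (card (nodes_above N j f a \<omega>))
      \<le> exp (real N * (\<Gamma> j * ln 2 - a + log_mgf (PiM {1..j} \<mu>) f + \<epsilon>))"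
proof -
  let ?M = "PiM {1..j} \<mu>"
  define c where "c = (\<lambda>N. exp (real N * (\<Gamma> j * ln 2 - a + log_mgf ?M f + \<epsilon>)))"
  define E where "E = (\<lambda>N \<beta>. {\<omega> \<in> space P. real N * a < (\<Sum>i=1..N. f (path_point j X N \<beta> i \<omega>))})"
  define C where "C = (\<lambda>N \<omega>. \<Sum>\<beta>\<in>branches \<gamma> N j. indicator (E N \<beta>) \<omega> :: real)"
  have [measurable]: "f \<in> borel_measurable ?M" using f by (rule bounded_measurableD)
  have E: "E N \<beta> \<in> events" "prob (E N \<beta>) \<le> exp (real N * (log_mgf ?M f - a))"
    if N: "N \<in> admissible n \<gamma>" and \<beta>: "\<beta> \<in> branches \<gamma> N j" for N \<beta>
  proof -
    let ?A = "{z \<in> space (samples N {1..j}). real N * a < (\<Sum>i=1..N. f (z i))}"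
    have br: "restrict \<beta> {1..k} \<in> branches \<gamma> N k" if "k \<in> {1..j}" for k
      using restrict_branches[OF \<beta>] that by auto
    have J: "{1..j} \<subseteq> {1..n}" "{1..j} \<noteq> {}" using j by auto
    have meas: "sample_block N {1..j} \<beta> \<in> measurable P (samples N {1..j})"
      using measurable_sample_block[OF N J(1) br] .
    have A: "?A \<in> sets (samples N {1..j})" by measurable
    have eq: "E N \<beta> = sample_block N {1..j} \<beta> -` ?A \<inter> space P"
      using measurable_space[OF meas] by (auto simp: E_def sample_block_path_point)
    show "E N \<beta> \<in> events" unfolding eq by (rule measurable_sets[OF meas A])
    have "prob (E N \<beta>) = measure (distr P (samples N {1..j}) (sample_block N {1..j} \<beta>)) ?A"
      unfolding eq using meas A by (simp add: measure_distr)
    also have "\<dots> = measure (samples N {1..j}) ?A"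
      by (subst distr_sample_block[OF N J br]) auto
    also have "\<dots> \<le> exp (real N * (log_mgf ?M f - a))"
      by (rule sample_average_tail[OF prob_PiM f])
    finally show "prob (E N \<beta>) \<le> exp (real N * (log_mgf ?M f - a))" .
  qed
  have C_int: "integrable P (C N)" "expectation (C N) \<le> c N * exp (- (real N * \<epsilon>))"
    if N: "N \<in> admissible n \<gamma>" for N
  proof -
    show "integrable P (C N)" unfolding C_def
      using E(1)[OF N] by (intro Bochner_Integration.integrable_sum) (auto intro!: integrable_real_indicator simp: emeasure_eq_measure)
    have "expectation (C N) = (\<Sum>\<beta>\<in>branches \<gamma> N j. prob (E N \<beta>))"
      unfolding C_def using E(1)[OF N]
      by (subst Bochner_Integration.integral_sum) (auto intro!: integrable_real_indicator simp: emeasure_eq_measure Int_absorb2 sets.sets_into_space)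
    also have "\<dots> \<le> (\<Sum>\<beta>\<in>branches \<gamma> N j. exp (real N * (log_mgf ?M f - a)))"
      by (intro sum_mono E(2)[OF N])
    also have "\<dots> = exp (real N * (\<Gamma> j * ln 2)) * exp (real N * (log_mgf ?M f - a))"
      using card_branches[OF N] j by simp
    also have "\<dots> = c N * exp (- (real N * \<epsilon>))"
      unfolding c_def exp_add[symmetric] by (simp add: algebra_simps)
    finally show "expectation (C N) \<le> c N * exp (- (real N * \<epsilon>))" .
  qed
  have "AE \<omega> in P. \<forall>\<^sub>F N in sizes. \<omega> \<notin> {\<omega> \<in> space P. c N \<le> C N \<omega>}"
  proof (rule AE_eventually_of_exp_bound)
    fix N assume N: "N \<in> admissible n \<gamma>"
    have [measurable]: "C N \<in> borel_measurable P" using C_int[OF N] by auto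
    show "{\<omega> \<in> space P. c N \<le> C N \<omega>} \<in> events" by measurable
    have "prob {\<omega> \<in> space P. c N \<le> C N \<omega>} \<le> expectation (C N) / c N"
      using C_int[OF N]
      by (intro integral_Markov_inequality_measure[where A="{}"] AE_I2) (auto simp: c_def C_def sum_nonneg)
    also have "\<dots> \<le> c N * exp (- (real N * \<epsilon>)) / c N"
      using C_int(2)[OF N] by (intro divide_right_mono) (auto simp: c_def)
    also have "\<dots> = 1 * exp (- (real N * \<epsilon>))" by (simp add: c_def)
    finally show "prob {\<omega> \<in> space P. c N \<le> C N \<omega>} \<le> 1 * exp (- (real N * \<epsilon>))" .
  qed fact
  then show ?thesis
  proof (rule AE_mp, intro AE_I2 impI)
    fix \<omega> assume \<omega>: "\<omega> \<in> space P"
      and few: "\<forall>\<^sub>F N in sizes. \<omega> \<notin> {\<omega> \<in> space P. c N \<le> C N \<omega>}"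
    show "\<forall>\<^sub>F N in sizes.
      real (card (nodes_above N j f a \<omega>))
        \<le> exp (real N * (\<Gamma> j * ln 2 - a + log_mgf ?M f + \<epsilon>))"
      using few
    proof eventually_elim
      case (elim N)
      have "C N \<omega> = (\<Sum>\<beta>\<in>branches \<gamma> N j. if real N * a < (\<Sum>i=1..N. f (path_point j X N \<beta> i \<omega>)) then 1 else 0)"
        unfolding C_def using \<omega> by (intro sum.cong) (auto simp: E_def)
      also have "\<dots> = real (card (nodes_above N j f a \<omega>))"
        by (simp add: sum.If_cases finite_branches Int_def)
      finally show ?case using elim \<omega> by (auto simp: c_def)
    qed
  qed
qed

section \<open>Marginals and compactness of the level sets\<close>

lemma prob_measuresD:
  assumes "\<nu> \<in> laws"
  shows "prob_space \<nu>" "sets \<nu> = sets M"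
  using assms sets_PiM_power_top[of n] by (auto simp: prob_measures_def)

lemma prob_measuresI:
  fixes \<nu> :: "(nat \<Rightarrow> 'a) measure"
  assumes "prob_space \<nu>" "sets \<nu> = sets M"
  shows "\<nu> \<in> laws"
  using assms sets_PiM_power_top[of n] by (simp add: prob_measures_def)

lemma restrict_measurable:
  "J \<subseteq> K \<Longrightarrow> (\<lambda>x. restrict x J) \<in> measurable (PiM K \<mu>) (PiM J \<mu>)"
  by (rule measurable_restrict_subset)

lemma sets_marginal: "sets (marginal j (\<nu> :: (nat \<Rightarrow> 'a) measure)) = sets (PiM {1..j} \<mu>)"
  by (simp only: marginal_def sets_distr sets_PiM_power_top)

lemma restrict_measurable_marginal:
  assumes \<nu>: "\<nu> \<in> laws" and j: "j \<le> n"
  shows "(\<lambda>x. restrict x {1..j}) \<in> measurable \<nu> (borel_algebra (power_top j))"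
  using restrict_measurable[of "{1..j}" "{1..n}"] j
  unfolding measurable_cong_sets[OF prob_measuresD(2)[OF \<nu>] sets_PiM_power_top[of j, symmetric]] by auto

lemma prob_marginal:
  assumes "\<nu> \<in> laws" "j \<le> n"
  shows "prob_space (marginal j \<nu>)"
  unfolding marginal_def
  by (rule prob_space.prob_space_distr[OF prob_measuresD(1)[OF assms(1)] restrict_measurable_marginal[OF assms]])

lemma restrict_bounded_measurable:
  assumes f: "f \<in> bounded_measurable (PiM {1..j} \<mu>)" and j: "j \<le> n"
  shows "(\<lambda>x. f (restrict x {1..j})) \<in> bounded_measurable M"
proof -
  have r: "(\<lambda>x. restrict x {1..j}) \<in> measurable M (PiM {1..j} \<mu>)"
    using j by (intro restrict_measurable) auto
  from bounded_measurableD[OF f] obtain B where B: "\<forall>x\<in>space (PiM {1..j} \<mu>). \<bar>f x\<bar> \<le> B"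
    and m: "f \<in> borel_measurable (PiM {1..j} \<mu>)" by blast
  show ?thesis
    using measurable_compose[OF r m] B measurable_space[OF r] by (intro bounded_measurableI[of _ _ B]) auto
qed

lemma integral_marginal:
  assumes "\<nu> \<in> laws" "j \<le> n" "f \<in> bounded_measurable (PiM {1..j} \<mu>)"
  shows "(\<integral>x. f x \<partial>marginal j \<nu>) = (\<integral>x. f (restrict x {1..j}) \<partial>\<nu>)"
proof -
  have "f \<in> borel_measurable (borel_algebra (power_top j))"
    using bounded_measurableD(1)[OF assms(3)]
    unfolding measurable_cong_sets[OF sets_PiM_power_top[of j] refl] .
  then show ?thesis
    unfolding marginal_def by (rule integral_distr[OF restrict_measurable_marginal[OF assms(1,2)]])
qed

lemma marginal_full:
  assumes "\<nu> \<in> laws"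
  shows "marginal n \<nu> = \<nu>"
proof -
  have sp: "space \<nu> = ({1..n} \<rightarrow>\<^sub>E UNIV)"
    using sets_eq_imp_space_eq[OF prob_measuresD(2)[OF assms]] by (simp add: space_PiM_\<mu>)
  have "marginal n \<nu> = distr \<nu> \<nu> (\<lambda>x. x)"
    unfolding marginal_def
    by (rule distr_cong) (use prob_measuresD(2)[OF assms] sets_PiM_power_top[of n] sp in
        \<open>auto simp: PiE_def extensional_restrict\<close>)
  then show ?thesis by simp
qed

lemma rel_entropy_marginal_le_iff:
  assumes \<nu>: "\<nu> \<in> laws" and j: "j \<le> n"
  shows "rel_entropy (marginal j \<nu>) (PiM {1..j} \<mu>) \<le> ereal c \<longleftrightarrow>
    (\<forall>f\<in>bounded_measurable (PiM {1..j} \<mu>).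
       (\<integral>x. f (restrict x {1..j}) \<partial>\<nu>) \<le> c + log_mgf (PiM {1..j} \<mu>) f)"
  using integral_le_rel_entropy_plus_log_mgf[OF prob_PiM prob_marginal[OF assms] sets_marginal]
    rel_entropy_le_if_integral_le[OF prob_PiM prob_marginal[OF assms] sets_marginal]
    integral_marginal[OF assms] by metis

lemma rel_entropy_le_iff:
  assumes \<nu>: "\<nu> \<in> laws"
  shows "rel_entropy \<nu> M \<le> ereal c \<longleftrightarrow>
    (\<forall>f\<in>bounded_measurable M. (\<integral>x. f x \<partial>\<nu>) \<le> c + log_mgf M f)"
  using integral_le_rel_entropy_plus_log_mgf[OF prob_PiM prob_measuresD[OF assms]]
    rel_entropy_le_if_integral_le[OF prob_PiM prob_measuresD[OF assms]] by metis

text \<open>The functionals that satisfy, in variational form, all the constraints \<open>H(\<nu>\<^sup>j | \<mu>\<^sup>j) \<le> \<Gamma> j ln 2\<close>.\<close>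

definition region_means :: "(((nat \<Rightarrow> 'a) \<Rightarrow> real) \<Rightarrow> real) set" where
  "region_means = {m \<in> means M. \<forall>j\<in>{1..n}. \<forall>f\<in>bounded_measurable (PiM {1..j} \<mu>).
     m (\<lambda>x. f (restrict x {1..j})) \<le> \<Gamma> j * ln 2 + log_mgf (PiM {1..j} \<mu>) f}"

lemma mean_of_in_region_means_iff:
  assumes \<nu>: "\<nu> \<in> laws"
  shows "mean_of M \<nu> \<in> region_means \<longleftrightarrow> \<nu> \<in> (\<Inter>j\<in>{1..n}. entropy_region n \<gamma> \<mu> j)"
proof -
  have "mean_of M \<nu> (\<lambda>x. f (restrict x {1..j})) = (\<integral>x. f (restrict x {1..j}) \<partial>\<nu>)"
    if "j \<in> {1..n}" "f \<in> bounded_measurable (PiM {1..j} \<mu>)" for j f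
    using restrict_bounded_measurable[of f j] that by (simp add: mean_of_def)
  then show ?thesis
    unfolding region_means_def entropy_region_def
    using rel_entropy_marginal_le_iff[OF \<nu>] mean_of_in_means[OF prob_measuresD[OF \<nu>]] \<nu> by simp
qed

text \<open>The constraint at level \<open>n\<close> reads \<open>H(\<nu> | \<mu>) \<le> ln 2\<close>; it makes \<open>means_represented\<close> applicable to every
  element of \<open>region_means\<close>.\<close>

lemma region_means_le:
  assumes m: "m \<in> region_means" and f: "f \<in> bounded_measurable M"
  shows "m f \<le> ln 2 + log_mgf M f"
proof -
  have mm: "m \<in> means M" using m by (simp add: region_means_def)
  have "m (\<lambda>x. f (restrict x {1..n})) \<le> \<Gamma> n * ln 2 + log_mgf M f"
    using m f n_pos by (auto simp: region_means_def)
  moreover have "m f \<le> m (\<lambda>x. f (restrict x {1..n})) + 0"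
    by (rule means_mono[OF mm f restrict_bounded_measurable[OF f]])
      (auto simp: space_PiM_\<mu> PiE_def extensional_restrict)
  ultimately show ?thesis using \<gamma>_sum by simp
qed

lemma region_means_represented:
  assumes m: "m \<in> region_means"
  shows "measure_of_mean M m \<in> laws" "mean_of M (measure_of_mean M m) = m"
proof -
  have mm: "m \<in> means M" using m by (simp add: region_means_def)
  note r = means_represented[OF prob_PiM mm region_means_le[OF m]]
  show "measure_of_mean M m \<in> laws" using r(1,2) by (rule prob_measuresI)
  show "mean_of M (measure_of_mean M m) = m" by (rule r(3))
qed

lemma compact_region_means: "compact region_means"
proof -
  have ev: "continuous_on UNIV (\<lambda>m :: ((nat \<Rightarrow> 'a) \<Rightarrow> real) \<Rightarrow> real. m f)" for f
    by (rule continuous_on_product_coordinates)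
  have "closed {m :: ((nat \<Rightarrow> 'a) \<Rightarrow> real) \<Rightarrow> real. m f \<le> a}" for f a
    by (rule closed_Collect_le[OF ev continuous_on_const])
  then have c: "closed {m :: ((nat \<Rightarrow> 'a) \<Rightarrow> real) \<Rightarrow> real.
      \<forall>j\<in>{1..n}. \<forall>f\<in>bounded_measurable (PiM {1..j} \<mu>).
        m (\<lambda>x. f (restrict x {1..j})) \<le> \<Gamma> j * ln 2 + log_mgf (PiM {1..j} \<mu>) f}"
    unfolding Ball_def by (intro closed_Collect_all closed_Collect_imp[OF open_Collect_const])
  have eq: "region_means = means M \<inter> {m. \<forall>j\<in>{1..n}. \<forall>f\<in>bounded_measurable (PiM {1..j} \<mu>).
        m (\<lambda>x. f (restrict x {1..j})) \<le> \<Gamma> j * ln 2 + log_mgf (PiM {1..j} \<mu>) f}"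
    by (auto simp: region_means_def)
  show ?thesis unfolding eq by (rule compact_Int_closed[OF compact_means c])
qed

text \<open>The level set is the image, under representation by measures, of the functionals in \<open>region_means\<close>
  whose entropy with respect to \<open>\<mu>\<close> is at most \<open>c\<close>: a closed part of a compact set.\<close>

lemma compactin_rate_level_set:
  "compactin (weak_topology (power_top n)) {\<nu> \<in> laws. rate n \<gamma> \<mu> \<nu> \<le> ereal c}"
proof -
  define K where "K = {m \<in> region_means. \<forall>f\<in>bounded_measurable M. m f \<le> c + log_mgf M f}"
  have ev: "continuous_on UNIV (\<lambda>m :: ((nat \<Rightarrow> 'a) \<Rightarrow> real) \<Rightarrow> real. m f)" for f
    by (rule continuous_on_product_coordinates)
  have "closed {m :: ((nat \<Rightarrow> 'a) \<Rightarrow> real) \<Rightarrow> real. m f \<le> a}" for f a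
    by (rule closed_Collect_le[OF ev continuous_on_const])
  then have c: "closed {m :: ((nat \<Rightarrow> 'a) \<Rightarrow> real) \<Rightarrow> real. \<forall>f\<in>bounded_measurable M. m f \<le> c + log_mgf M f}"
    unfolding Ball_def by (intro closed_Collect_all closed_Collect_imp[OF open_Collect_const])
  have eq: "K = region_means \<inter> {m. \<forall>f\<in>bounded_measurable M. m f \<le> c + log_mgf M f}"
    by (auto simp: K_def)
  have "compact K" unfolding eq by (rule compact_Int_closed[OF compact_region_means c])
  then have "compactin (weak_topology (power_top n)) (measure_of_mean M ` K)"
    using region_means_represented
    by (intro compactin_weak_topology_means sets_PiM_power_top) (auto simp: K_def region_means_def)
  moreover have level: "mean_of M \<nu> \<in> K \<longleftrightarrow> rate n \<gamma> \<mu> \<nu> \<le> ereal c"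
    if \<nu>: "\<nu> \<in> laws" for \<nu>
    using mean_of_in_region_means_iff[OF \<nu>] rel_entropy_le_iff[OF \<nu>, of c]
    by (auto simp: K_def rate_def mean_of_def)
  have "measure_of_mean M ` K = {\<nu> \<in> laws. rate n \<gamma> \<mu> \<nu> \<le> ereal c}"
  proof (intro equalityI subsetI)
    fix \<nu> assume "\<nu> \<in> measure_of_mean M ` K"
    then obtain m where m: "m \<in> K" "\<nu> = measure_of_mean M m" by blast
    then have "m \<in> region_means" by (simp add: K_def)
    from region_means_represented[OF this] level[of \<nu>] m
    show "\<nu> \<in> {\<nu> \<in> laws. rate n \<gamma> \<mu> \<nu> \<le> ereal c}" by simp
  next
    fix \<nu> assume "\<nu> \<in> {\<nu> \<in> laws. rate n \<gamma> \<mu> \<nu> \<le> ereal c}"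
    then have \<nu>: "\<nu> \<in> laws" and K: "mean_of M \<nu> \<in> K" using level by auto
    then have "mean_of M \<nu> \<in> region_means" by (simp add: K_def)
    note r = region_means_represented[OF this]
    have "measure_of_mean M (mean_of M \<nu>) = \<nu>"
      using prob_measuresD[OF r(1)] prob_measuresD[OF \<nu>] r(2) by (intro mean_of_inj) auto
    then show "\<nu> \<in> measure_of_mean M ` K" using K by force
  qed
  ultimately show ?thesis by simp
qed

section \<open>The upper bound\<close>

abbreviation partition_sum_in ::
    "(((nat \<Rightarrow> 'a) \<Rightarrow> real) \<Rightarrow> real) set \<Rightarrow> ((nat \<Rightarrow> 'a) measure \<Rightarrow> real) \<Rightarrow> nat \<Rightarrow> 'w \<Rightarrow> real" where
  "partition_sum_in U \<Phi> N \<omega> \<equiv> \<Sum>\<alpha> | \<alpha> \<in> branches \<gamma> N n \<and> mean_of M (L N \<alpha> \<omega>) \<in> U.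
     exp (real N * \<Phi> (L N \<alpha> \<omega>))"

abbreviation partition_sum :: "((nat \<Rightarrow> 'a) measure \<Rightarrow> real) \<Rightarrow> nat \<Rightarrow> 'w \<Rightarrow> real" where
  "partition_sum \<Phi> N \<omega> \<equiv> \<Sum>\<alpha>\<in>branches \<gamma> N n. exp (real N * \<Phi> (L N \<alpha> \<omega>))"

lemma weak_neighbourhood_bounded_measurable:
  fixes W :: "(nat \<Rightarrow> 'a) measure set"
  assumes W: "openin (weak_topology (power_top n)) W" "\<nu> \<in> W"
  obtains F r where "finite F" "0 < r" "F \<subseteq> bounded_measurable M"
    "\<And>\<nu>'. \<nu>' \<in> laws \<Longrightarrow>
      (\<And>f. f \<in> F \<Longrightarrow> \<bar>(\<integral>x. f x \<partial>\<nu>') - (\<integral>x. f x \<partial>\<nu>)\<bar> < r) \<Longrightarrow> \<nu>' \<in> W"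
proof -
  obtain F r where F: "finite F" "0 < r"
    "\<And>f. f \<in> F \<Longrightarrow> continuous_map (power_top n) euclideanreal f \<and> bounded (f ` topspace (power_top n))"
    "\<And>\<nu>'. \<nu>' \<in> laws \<Longrightarrow>
      (\<And>f. f \<in> F \<Longrightarrow> \<bar>(\<integral>x. f x \<partial>\<nu>') - (\<integral>x. f x \<partial>\<nu>)\<bar> < r) \<Longrightarrow> \<nu>' \<in> W"
    using W by (rule weak_topology_neighbourhood) blast
  have "F \<subseteq> bounded_measurable M"
    using F(3) sets_PiM_power_top by (intro subsetI continuous_bounded_measurable) auto
  then show ?thesis using that F by blast
qed

text \<open>Every functional has a neighbourhood in which the branches contribute no more than they should. If some
  constraint is violated at \<open>m\<close>, strictly by a test function \<open>f\<close> at level \<open>j\<close>, then the number of level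
  \<open>j\<close> nodes with average above an intermediate value \<open>a\<close> is eventually less than one. Otherwise \<open>m\<close>
  is a measure \<open>\<nu>\<close> of finite entropy \<open>h\<close>, a nearly optimal test function bounds the number of branches near it
  by \<open>exp (N (ln 2 - h + 2 \<epsilon>))\<close>, and by continuity \<open>\<Phi>\<close> is at most \<open>\<Phi> \<nu> + \<epsilon>\<close> there.\<close>

lemma local_upper_bound:
  assumes \<Phi>: "continuous_map (weak_topology (power_top n)) euclideanreal \<Phi>"
    and S: "\<And>\<nu>. \<nu> \<in> laws \<Longrightarrow> ereal (\<Phi> \<nu>) - rate n \<gamma> \<mu> \<nu> \<le> ereal S"
    and \<epsilon>: "0 < \<epsilon>" and m: "m \<in> means M"
  shows "\<exists>U. open U \<and> m \<in> U \<and>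
    (AE \<omega> in P. \<forall>\<^sub>F N in sizes.
      partition_sum_in U \<Phi> N \<omega> \<le> exp (real N * (ln 2 + S + 3 * \<epsilon>)))"
proof (cases "m \<in> region_means")
  case False
  then obtain j f where j: "j \<in> {1..n}" and f: "f \<in> bounded_measurable (PiM {1..j} \<mu>)"
    and gt: "\<Gamma> j * ln 2 + log_mgf (PiM {1..j} \<mu>) f < m (\<lambda>x. f (restrict x {1..j}))"
    using m by (auto simp: region_means_def not_le)
  let ?g = "\<lambda>x. f (restrict x {1..j})"
  have g: "?g \<in> bounded_measurable M" using restrict_bounded_measurable[OF f] j by auto
  obtain a where a: "\<Gamma> j * ln 2 + log_mgf (PiM {1..j} \<mu>) f < a" "a < m ?g"
    using dense[OF gt] by blast
  \<comment> \<open>half of the gap, so that the exponent of the count, \<open>- 2 \<eta> + \<eta>\<close>, is negative\<close>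
  define \<eta> where "\<eta> = (a - \<Gamma> j * ln 2 - log_mgf (PiM {1..j} \<mu>) f) / 2"
  have \<eta>: "0 < \<eta>" using a by (simp add: \<eta>_def)
  let ?U = "{m. a < m ?g}"
  have "open ?U"
    by (intro open_Collect_less continuous_on_const continuous_on_product_coordinates)
  moreover have "AE \<omega> in P. \<forall>\<^sub>F N in sizes.
      partition_sum_in ?U \<Phi> N \<omega> \<le> exp (real N * (ln 2 + S + 3 * \<epsilon>))"
    using eventually_count_branches_le[OF j f \<eta>, of a]
  proof eventually_elim
    case (elim \<omega>)
    show ?case
      using elim eventually_admissible
    proof eventually_elim
      case (elim N)
      then have N0: "0 < N" by (simp add: admissible_def)
      let ?C = "nodes_above N j f a \<omega>"
      have "real (card ?C) \<le> exp (real N * (\<Gamma> j * ln 2 - a + log_mgf (PiM {1..j} \<mu>) f + \<eta>))"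
        by (rule elim(1))
      also have "\<Gamma> j * ln 2 - a + log_mgf (PiM {1..j} \<mu>) f + \<eta> = - \<eta>"
        by (simp add: \<eta>_def field_simps)
      also have "exp (real N * - \<eta>) < 1" using N0 \<eta> by simp
      finally have "card ?C = 0" by simp
      then have C: "?C = {}" using finite_branches[of \<gamma> N j] by simp
      have "{\<alpha> \<in> branches \<gamma> N n. mean_of M (L N \<alpha> \<omega>) \<in> ?U} = {}"
      proof safe
        fix \<alpha> assume \<alpha>: "\<alpha> \<in> branches \<gamma> N n" and "a < mean_of M (L N \<alpha> \<omega>) ?g"
        then have "real N * a < (\<Sum>i=1..N. ?g (path_point n X N \<alpha> i \<omega>))"
          using N0 by (simp add: mean_of_path_empirical[OF N0 g] field_simps)
        then have "restrict \<alpha> {1..j} \<in> ?C"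
          using restrict_branches[OF \<alpha>, of j] j by (simp add: restrict_path_point)
        then show "\<alpha> \<in> {}" using C by blast
      qed
      then show ?case by (simp only: sum.empty) simp
    qed
  qed
  ultimately show ?thesis using a by (intro exI[of _ ?U]) simp
next
  case True
  define \<nu> where "\<nu> = measure_of_mean M m"
  have \<nu>: "\<nu> \<in> laws" and m_eq: "mean_of M \<nu> = m"
    using region_means_represented[OF True] by (auto simp: \<nu>_def)
  have reg: "\<nu> \<in> (\<Inter>j\<in>{1..n}. entropy_region n \<gamma> \<mu> j)"
    using mean_of_in_region_means_iff[OF \<nu>] m_eq True by simp
  have "rel_entropy \<nu> M \<le> ereal (ln 2)"
    unfolding rel_entropy_le_iff[OF \<nu>]
  proof
    fix f assume "f \<in> bounded_measurable M"
    then show "(\<integral>x. f x \<partial>\<nu>) \<le> ln 2 + log_mgf M f"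
      using region_means_le[OF True] m_eq by (auto simp: mean_of_def dest: fun_cong[of _ _ f])
  qed
  moreover have "0 \<le> rel_entropy \<nu> M"
    by (rule rel_entropy_nonneg[OF prob_PiM prob_measuresD[OF \<nu>]])
  ultimately obtain h where h: "rel_entropy \<nu> M = ereal h"
    by (cases "rel_entropy \<nu> M") auto
  have S_ge: "\<Phi> \<nu> - h \<le> S" using S[OF \<nu>] reg h by (simp add: rate_def)
  have "\<not> rel_entropy \<nu> M \<le> ereal (h - \<epsilon>)" using h \<epsilon> by simp
  then obtain f0 where f0: "f0 \<in> bounded_measurable M" and gt: "h - \<epsilon> + log_mgf M f0 < (\<integral>x. f0 x \<partial>\<nu>)"
    unfolding rel_entropy_le_iff[OF \<nu>] by (auto simp: not_le)
  \<comment> \<open>\<open>f0\<close> is optimal up to \<open>\<epsilon>\<close> in the variational formula for \<open>h\<close>; the count of averages above this \<open>a\<close> has the exponent \<open>ln 2 - h + 2 \<epsilon>\<close>.\<close>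
  define a where "a = h - \<epsilon> + log_mgf M f0"
  define W where "W = {\<nu>' \<in> laws. \<Phi> \<nu>' < \<Phi> \<nu> + \<epsilon>}"
  have "openin (weak_topology (power_top n)) W"
    using openin_continuous_map_preimage[OF \<Phi>, of "{..<\<Phi> \<nu> + \<epsilon>}"] by (simp add: W_def)
  moreover have "\<nu> \<in> W" using \<nu> \<epsilon> by (simp add: W_def)
  ultimately obtain F r where F: "finite F" "0 < r" "F \<subseteq> bounded_measurable M"
    "\<And>\<nu>'. \<nu>' \<in> laws \<Longrightarrow>
      (\<And>f. f \<in> F \<Longrightarrow> \<bar>(\<integral>x. f x \<partial>\<nu>') - (\<integral>x. f x \<partial>\<nu>)\<bar> < r) \<Longrightarrow> \<nu>' \<in> W"
    using weak_neighbourhood_bounded_measurable by metis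
  have F_in: "f \<in> bounded_measurable M" if "f \<in> F" for f
    using F(3) that by blast
  let ?U = "{m'. a < m' f0} \<inter> (\<Inter>f\<in>F. {m'. \<bar>m' f - m f\<bar> < r})"
  have o1: "open {m' :: ((nat \<Rightarrow> 'a) \<Rightarrow> real) \<Rightarrow> real. a < m' f0}"
    by (rule open_Collect_less[OF continuous_on_const continuous_on_product_coordinates])
  have o2: "open {m' :: ((nat \<Rightarrow> 'a) \<Rightarrow> real) \<Rightarrow> real. \<bar>m' f - m f\<bar> < r}" for f
    by (rule open_Collect_less[OF continuous_on_rabs[OF continuous_on_diff[OF continuous_on_product_coordinates
        continuous_on_const]] continuous_on_const])
  have "open ?U"
    by (intro open_Int o1 open_INT[OF F(1)] ballI o2)
  moreover have "m \<in> ?U"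
  proof -
    have "m f0 = (\<integral>x. f0 x \<partial>\<nu>)" using f0 m_eq[symmetric] by (simp add: mean_of_def)
    then show ?thesis using gt F(2) by (simp add: a_def)
  qed
  moreover have "AE \<omega> in P. \<forall>\<^sub>F N in sizes.
      partition_sum_in ?U \<Phi> N \<omega> \<le> exp (real N * (ln 2 + S + 3 * \<epsilon>))"
    using eventually_count_branches_le[OF _ f0 \<epsilon>, of a] n_pos
  proof (simp, elim AE_mp, intro AE_I2 impI)
    fix \<omega>
    assume count: "\<forall>\<^sub>F N in sizes.
      real (card (nodes_above N n f0 a \<omega>))
        \<le> exp (real N * (\<Gamma> n * ln 2 - a + log_mgf M f0 + \<epsilon>))"
    show "\<forall>\<^sub>F N in sizes. (\<Sum>\<alpha> | \<alpha> \<in> branches \<gamma> N n \<and> a < mean_of M (L N \<alpha> \<omega>) f0 \<and>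
          (\<forall>f\<in>F. \<bar>mean_of M (L N \<alpha> \<omega>) f - m f\<bar> < r).
        exp (real N * \<Phi> (L N \<alpha> \<omega>))) \<le> exp (real N * (ln 2 + S + 3 * \<epsilon>))"
      using count eventually_admissible
    proof eventually_elim
      case (elim N)
      then have N0: "0 < N" by (simp add: admissible_def)
      let ?C = "nodes_above N n f0 a \<omega>"
      let ?A = "{\<alpha> \<in> branches \<gamma> N n. a < mean_of M (L N \<alpha> \<omega>) f0 \<and>
          (\<forall>f\<in>F. \<bar>mean_of M (L N \<alpha> \<omega>) f - m f\<bar> < r)}"
      have AC: "?A \<subseteq> ?C"
        using N0 by (auto simp: mean_of_path_empirical[OF N0 f0] field_simps)
      have "(\<Sum>\<alpha>\<in>?A. exp (real N * \<Phi> (L N \<alpha> \<omega>))) \<le> (\<Sum>\<alpha>\<in>?A. exp (real N * (\<Phi> \<nu> + \<epsilon>)))"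
      proof (rule sum_mono)
        fix \<alpha> assume \<alpha>: "\<alpha> \<in> ?A"
        have "L N \<alpha> \<omega> \<in> W"
        proof (rule F(4)[OF path_empirical_in_prob_measures[OF N0]])
          fix f assume f: "f \<in> F"
          have "mean_of M (L N \<alpha> \<omega>) f = (\<integral>x. f x \<partial>L N \<alpha> \<omega>)"
            "m f = (\<integral>x. f x \<partial>\<nu>)"
            using F_in[OF f] m_eq[symmetric] by (simp_all add: mean_of_def)
          then show "\<bar>(\<integral>x. f x \<partial>L N \<alpha> \<omega>) - (\<integral>x. f x \<partial>\<nu>)\<bar> < r"
            using \<alpha> f by auto
        qed
        then have "\<Phi> (L N \<alpha> \<omega>) \<le> \<Phi> \<nu> + \<epsilon>" by (simp add: W_def)
        then show "exp (real N * \<Phi> (L N \<alpha> \<omega>)) \<le> exp (real N * (\<Phi> \<nu> + \<epsilon>))"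
          using N0 by simp
      qed
      also have "\<dots> = real (card ?A) * exp (real N * (\<Phi> \<nu> + \<epsilon>))" by simp
      also have "\<dots> \<le> real (card ?C) * exp (real N * (\<Phi> \<nu> + \<epsilon>))"
        using card_mono[OF _ AC] finite_branches[of \<gamma> N n] by (intro mult_right_mono) auto
      also have "\<dots> \<le> exp (real N * (\<Gamma> n * ln 2 - a + log_mgf M f0 + \<epsilon>)) * exp (real N * (\<Phi> \<nu> + \<epsilon>))"
        using elim(1) by (intro mult_right_mono) auto
      also have "\<dots> = exp (real N * (ln 2 + (\<Phi> \<nu> - h) + 3 * \<epsilon>))"
        unfolding exp_add[symmetric] distrib_left[symmetric] using \<gamma>_sum by (simp add: a_def)
      also have "\<dots> \<le> exp (real N * (ln 2 + S + 3 * \<epsilon>))"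
        using S_ge N0 by simp
      finally show ?case .
    qed
  qed
  ultimately show ?thesis by (intro exI[of _ ?U] conjI)
qed

lemma upper_bound:
  assumes \<Phi>: "continuous_map (weak_topology (power_top n)) euclideanreal \<Phi>"
    and S: "\<And>\<nu>. \<nu> \<in> laws \<Longrightarrow> ereal (\<Phi> \<nu>) - rate n \<gamma> \<mu> \<nu> \<le> ereal S"
    and \<epsilon>: "0 < \<epsilon>"
  shows "AE \<omega> in P. \<forall>\<^sub>F N in sizes.
      ln (partition_sum \<Phi> N \<omega>) / real N \<le> ln 2 + S + 4 * \<epsilon>"
proof -
  have "\<forall>m\<in>means M. \<exists>U. open U \<and> m \<in> U \<and>
    (AE \<omega> in P. \<forall>\<^sub>F N in sizes.
      partition_sum_in U \<Phi> N \<omega> \<le> exp (real N * (ln 2 + S + 3 * \<epsilon>)))"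
    using local_upper_bound[OF \<Phi> S \<epsilon>] by blast
  from bchoice[OF this] obtain U where all: "\<forall>m\<in>means M. open (U m) \<and> m \<in> U m \<and>
    (AE \<omega> in P. \<forall>\<^sub>F N in sizes.
      partition_sum_in (U m) \<Phi> N \<omega> \<le> exp (real N * (ln 2 + S + 3 * \<epsilon>)))"
    by (rule exE)
  have U: "\<And>m. m \<in> means M \<Longrightarrow> open (U m)" "\<And>m. m \<in> means M \<Longrightarrow> m \<in> U m"
    using all by simp_all
  have AE_U: "AE \<omega> in P. \<forall>\<^sub>F N in sizes.
      partition_sum_in (U m) \<Phi> N \<omega> \<le> exp (real N * (ln 2 + S + 3 * \<epsilon>))" if "m \<in> means M" for m
    using bspec[OF all that] by (elim conjE)
  have "means M \<subseteq> (\<Union>m\<in>means M. U m)" using U(2) by blast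
  then obtain D where D: "D \<subseteq> means M" "finite D" "means M \<subseteq> (\<Union>m\<in>D. U m)"
    using compactE_image[OF compact_means, of "means M" U] U(1) by blast
  have "AE \<omega> in P. \<forall>m\<in>D. \<forall>\<^sub>F N in sizes.
      partition_sum_in (U m) \<Phi> N \<omega> \<le> exp (real N * (ln 2 + S + 3 * \<epsilon>))"
    using AE_U D by (intro AE_finite_allI) auto
  then show ?thesis
  proof eventually_elim
    case (elim \<omega>)
    let ?L = "\<lambda>N \<alpha>. L N \<alpha> \<omega>"
    have cover: "\<forall>\<^sub>F N in sizes. \<forall>m\<in>D. partition_sum_in (U m) \<Phi> N \<omega> \<le> exp (real N * (ln 2 + S + 3 * \<epsilon>))"
      using D(2) elim by (intro eventually_ball_finite) auto
    have large: "\<forall>\<^sub>F N in sequentially. ln (real (card D)) \<le> real N * \<epsilon>"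
      using eventually_ge_at_top[of "nat \<lceil>ln (real (card D)) / \<epsilon>\<rceil>"]
    proof eventually_elim
      case (elim N)
      then have "ln (real (card D)) / \<epsilon> \<le> real N" by linarith
      then show ?case using \<epsilon> by (simp add: field_simps)
    qed
    show ?case
      using cover eventually_sizesI[OF large] eventually_admissible
    proof eventually_elim
      case (elim N)
      note N = elim(3)
      then have N0: "0 < N" by (simp add: admissible_def)
      have L_in: "mean_of M (?L N \<alpha>) \<in> means M" for \<alpha>
        by (rule mean_of_in_means[OF prob_measuresD[OF path_empirical_in_prob_measures[OF N0]]])
      have bne: "branches \<gamma> N n \<noteq> {}"
        using card_branches[OF N, of n] by (intro notI) simp
      then have pos: "0 < partition_sum \<Phi> N \<omega>"
        using finite_branches by (intro sum_pos) auto
      have Dne: "D \<noteq> {}" using D(3) L_in by blast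
      have "partition_sum \<Phi> N \<omega> \<le> (\<Sum>\<alpha>\<in>branches \<gamma> N n. \<Sum>m\<in>D.
          if mean_of M (?L N \<alpha>) \<in> U m then exp (real N * \<Phi> (?L N \<alpha>)) else 0)"
      proof (rule sum_mono)
        fix \<alpha>
        obtain m where m: "m \<in> D" "mean_of M (?L N \<alpha>) \<in> U m" using D(3) L_in by blast
        have "exp (real N * \<Phi> (?L N \<alpha>)) =
            (if mean_of M (?L N \<alpha>) \<in> U m then exp (real N * \<Phi> (?L N \<alpha>)) else 0)"
          using m by simp
        also have "\<dots> \<le> (\<Sum>m\<in>D. if mean_of M (?L N \<alpha>) \<in> U m then exp (real N * \<Phi> (?L N \<alpha>)) else 0)"
          using D(2) m(1) by (intro member_le_sum) auto
        finally show "exp (real N * \<Phi> (?L N \<alpha>)) \<le> (\<Sum>m\<in>D.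
          if mean_of M (?L N \<alpha>) \<in> U m then exp (real N * \<Phi> (?L N \<alpha>)) else 0)" .
      qed
      also have "\<dots> = (\<Sum>m\<in>D. \<Sum>\<alpha>\<in>branches \<gamma> N n.
          if mean_of M (?L N \<alpha>) \<in> U m then exp (real N * \<Phi> (?L N \<alpha>)) else 0)"
        by (rule sum.swap)
      also have "\<dots> = (\<Sum>m\<in>D. \<Sum>\<alpha> | \<alpha> \<in> branches \<gamma> N n \<and> mean_of M (?L N \<alpha>) \<in> U m.
          exp (real N * \<Phi> (?L N \<alpha>)))"
        by (rule sum.cong[OF refl]) (simp add: sum.inter_filter[OF finite_branches])
      also have "\<dots> \<le> (\<Sum>m\<in>D. exp (real N * (ln 2 + S + 3 * \<epsilon>)))"
        using elim(1) by (intro sum_mono) blast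
      also have "\<dots> = exp (ln (real (card D))) * exp (real N * (ln 2 + S + 3 * \<epsilon>))"
        using Dne D(2) by (simp add: card_gt_0_iff)
      also have "\<dots> \<le> exp (real N * \<epsilon>) * exp (real N * (ln 2 + S + 3 * \<epsilon>))"
        using elim(2) by (intro mult_right_mono) auto
      also have "\<dots> = exp (real N * (ln 2 + S + 4 * \<epsilon>))"
        unfolding exp_add[symmetric] by (simp add: algebra_simps)
      finally have "ln (partition_sum \<Phi> N \<omega>) \<le> ln (exp (real N * (ln 2 + S + 4 * \<epsilon>)))"
        using pos by (rule ln_mono)
      then have "ln (partition_sum \<Phi> N \<omega>) \<le> real N * (ln 2 + S + 4 * \<epsilon>)"
        by simp
      then show ?case using N0 by (simp add: divide_le_eq mult.commute)
    qed
  qed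
qed

section \<open>Pairs of branches and the second moment\<close>

lemma product_sigma_finite_\<mu>: "product_sigma_finite \<mu>"
  by (simp add: product_sigma_finite_def prob_\<mu> prob_space_imp_sigma_finite)

lemma distr_restrict_PiM: "j \<le> n \<Longrightarrow> distr M (PiM {1..j} \<mu>) (\<lambda>x. restrict x {1..j}) = PiM {1..j} \<mu>"
proof -
  assume "j \<le> n"
  interpret product_prob_space \<mu>
    using product_sigma_finite_\<mu> prob_\<mu> by (simp add: product_prob_space_def product_prob_space_axioms_def)
  show ?thesis using \<open>j \<le> n\<close> by (intro distr_restrict[symmetric]) auto
qed

text \<open>When \<open>D\<close> is the density of \<open>\<nu>\<close>, this is a version of the density of the marginal \<open>\<nu>\<^sup>j\<close>.\<close>

definition integrate_tail :: "nat \<Rightarrow> ((nat \<Rightarrow> 'a) \<Rightarrow> real) \<Rightarrow> (nat \<Rightarrow> 'a) \<Rightarrow> ennreal" where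
  "integrate_tail j D x = (\<integral>\<^sup>+t. ennreal (D (merge {1..j} {j+1..n} (x, t))) \<partial>PiM {j+1..n} \<mu>)"

lemma merge_measurable:
  assumes "j \<le> n"
  shows "merge {1..j} {j+1..n} \<in> measurable (PiM {1..j} \<mu> \<Otimes>\<^sub>M PiM {j+1..n} \<mu>) M"
proof -
  have "{1..j} \<union> {j+1..n} = {1..n}" using assms by auto
  then show ?thesis using measurable_merge[of "{1..j}" "{j+1..n}" \<mu>] by simp
qed

lemma integrate_tail_measurable:
  assumes j: "j \<le> n" and [measurable]: "D \<in> borel_measurable M"
  shows "integrate_tail j D \<in> borel_measurable (PiM {1..j} \<mu>)"
proof -
  interpret T: prob_space "PiM {j+1..n} \<mu>" by (rule prob_PiM)
  have [measurable]: "merge {1..j} {j+1..n} \<in> measurable (PiM {1..j} \<mu> \<Otimes>\<^sub>M PiM {j+1..n} \<mu>) M"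
    using j by (rule merge_measurable)
  show ?thesis unfolding integrate_tail_def[abs_def] by measurable
qed

lemma density_integrate_tail:
  assumes \<nu>: "\<nu> \<in> laws" and j: "j \<le> n"
    and D[measurable]: "D \<in> borel_measurable M" and eq: "\<nu> = density M D"
  shows "marginal j \<nu> = density (PiM {1..j} \<mu>) (integrate_tail j D)"
proof (rule measure_eqI)
  interpret product_sigma_finite \<mu> by (rule product_sigma_finite_\<mu>)
  show "sets (marginal j \<nu>) = sets (density (PiM {1..j} \<mu>) (integrate_tail j D))"
    by (simp add: sets_marginal)
  fix A assume "A \<in> sets (marginal j \<nu>)"
  then have A[measurable]: "A \<in> sets (PiM {1..j} \<mu>)" by (simp add: sets_marginal)
  have U: "{1..j} \<union> {j+1..n} = {1..n}" using j by auto
  have r[measurable]: "(\<lambda>x. restrict x {1..j}) \<in> measurable M (PiM {1..j} \<mu>)"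
    using j by (intro restrict_measurable) auto
  have m[measurable]: "merge {1..j} {j+1..n} \<in> measurable (PiM {1..j} \<mu> \<Otimes>\<^sub>M PiM {j+1..n} \<mu>) M"
    using j by (rule merge_measurable)
  have sp: "space \<nu> = space M" by (simp add: eq)
  have "emeasure (marginal j \<nu>) A = emeasure \<nu> ((\<lambda>x. restrict x {1..j}) -` A \<inter> space M)"
    using A restrict_measurable_marginal[OF \<nu> j] unfolding marginal_def sp[symmetric]
    by (intro emeasure_distr) (auto simp only: sets_PiM_power_top)
  also have "\<dots> = (\<integral>\<^sup>+x. ennreal (D x) * indicator ((\<lambda>x. restrict x {1..j}) -` A \<inter> space M) x \<partial>M)"
    unfolding eq by (rule emeasure_density) (use measurable_sets[OF r A] in auto)
  also have "\<dots> = (\<integral>\<^sup>+x. ennreal (D x) * indicator A (restrict x {1..j}) \<partial>M)"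
    by (intro nn_integral_cong) (auto simp: indicator_def)
  also have "\<dots> = (\<integral>\<^sup>+x. (\<integral>\<^sup>+t. ennreal (D (merge {1..j} {j+1..n} (x, t))) *
      indicator A (restrict (merge {1..j} {j+1..n} (x, t)) {1..j}) \<partial>PiM {j+1..n} \<mu>) \<partial>PiM {1..j} \<mu>)"
    unfolding U[symmetric] by (rule product_nn_integral_fold) (auto simp: U)
  also have "\<dots> = (\<integral>\<^sup>+x. integrate_tail j D x * indicator A x \<partial>PiM {1..j} \<mu>)"
  proof (rule nn_integral_cong)
    fix x assume x: "x \<in> space (PiM {1..j} \<mu>)"
    have "restrict (merge {1..j} {j+1..n} (x, t)) {1..j} = x" for t
      using x by (auto simp: space_PiM_\<mu> merge_def PiE_def extensional_def fun_eq_iff)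
    then have "(\<integral>\<^sup>+t. ennreal (D (merge {1..j} {j+1..n} (x, t))) *
        indicator A (restrict (merge {1..j} {j+1..n} (x, t)) {1..j}) \<partial>PiM {j+1..n} \<mu>) =
      (\<integral>\<^sup>+t. ennreal (D (merge {1..j} {j+1..n} (x, t))) * indicator A x \<partial>PiM {j+1..n} \<mu>)"
      by simp
    also have "\<dots> = integrate_tail j D x * indicator A x"
      unfolding integrate_tail_def using x by (intro nn_integral_multc) measurable
    finally show "(\<integral>\<^sup>+t. ennreal (D (merge {1..j} {j+1..n} (x, t))) *
        indicator A (restrict (merge {1..j} {j+1..n} (x, t)) {1..j}) \<partial>PiM {j+1..n} \<mu>) =
      integrate_tail j D x * indicator A x" .
  qed
  also have "\<dots> = emeasure (density (PiM {1..j} \<mu>) (integrate_tail j D)) A"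
    by (rule emeasure_density[symmetric]) (use integrate_tail_measurable[OF j D] in auto)
  finally show "emeasure (marginal j \<nu>) A = emeasure (density (PiM {1..j} \<mu>) (integrate_tail j D)) A" .
qed

text \<open>The second branch shares its first \<open>j\<close> levels with the first one and is independent of it beyond. By
  Fubini's theorem its fresh coordinates can be integrated out first; for fixed data of the first branch,
  the product over the sites factorises.\<close>

lemma nn_integral_branching_pair:
  assumes N: "N \<in> admissible n \<gamma>" and \<alpha>: "\<alpha> \<in> branches \<gamma> N n" and \<alpha>': "\<alpha>' \<in> branches \<gamma> N n"
    and j: "j < n" and common: "restrict \<alpha> {1..j} = restrict \<alpha>' {1..j}"
    and differ: "\<And>k. k \<in> {j+1..n} \<Longrightarrow> restrict \<alpha> {1..k} \<noteq> restrict \<alpha>' {1..k}"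
    and D[measurable]: "D \<in> borel_measurable M" and F[measurable]: "F \<in> borel_measurable (samples N {1..n})"
  shows "(\<integral>\<^sup>+\<omega>. F (sample_block N {1..n} \<alpha> \<omega>) * (\<Prod>i=1..N. ennreal (D (sample_block N {1..n} \<alpha>' \<omega> i))) \<partial>P)
    = (\<integral>\<^sup>+z. F z * (\<Prod>i=1..N. integrate_tail j D (restrict (z i) {1..j})) \<partial>samples N {1..n})"
proof -
  let ?J = "{j+1..n}"
  let ?Y = "sample_block N {1..n} \<alpha>" and ?T = "sample_block N ?J \<alpha>'"
  let ?m = "\<lambda>y t. merge {1..j} ?J (restrict y {1..j}, t)"
  let ?g = "\<lambda>(y, t). F y * (\<Prod>i=1..N. ennreal (D (?m (y i) (t i))))"
  interpret TS: prob_space "samples N ?J" by (rule prob_samples)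
  interpret TJ: prob_space "PiM ?J \<mu>" by (rule prob_PiM)
  interpret TP: product_sigma_finite "\<lambda>_::nat. PiM ?J \<mu>"
    by (simp add: product_sigma_finite_def TJ.sigma_finite_measure_axioms)
  have [measurable]: "merge {1..j} ?J \<in> measurable (PiM {1..j} \<mu> \<Otimes>\<^sub>M PiM ?J \<mu>) M"
    using j by (intro merge_measurable) auto
  have [measurable]: "(\<lambda>x. restrict x {1..j}) \<in> measurable M (PiM {1..j} \<mu>)"
    using j by (intro restrict_measurable) auto
  have g[measurable]: "?g \<in> borel_measurable (samples N {1..n} \<Otimes>\<^sub>M samples N ?J)"
    by measurable
  have n: "{1..n} \<noteq> {}" using n_pos by auto
  have Y: "?Y \<in> measurable P (samples N {1..n})" "distr P (samples N {1..n}) ?Y = samples N {1..n}"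
    using measurable_sample_block[OF N, of "{1..n}"] distr_sample_block[OF N _ n] branches_prefix[OF \<alpha>]
    by auto
  have T: "?T \<in> measurable P (samples N ?J)" "distr P (samples N ?J) ?T = samples N ?J"
    using measurable_sample_block[OF N, of ?J \<alpha>'] distr_sample_block[OF N, of ?J \<alpha>'] branches_prefix[OF \<alpha>'] j
    by auto
  have "indep_var (samples N {1..n}) ?Y (samples N ?J) ?T"
    using branches_prefix[OF \<alpha>] branches_prefix[OF \<alpha>'] differ by (intro indep_sample_blocks[OF N]) auto
  then have joint: "distr P (samples N {1..n} \<Otimes>\<^sub>M samples N ?J) (\<lambda>\<omega>. (?Y \<omega>, ?T \<omega>)) =
      samples N {1..n} \<Otimes>\<^sub>M samples N ?J"
    unfolding indep_var_distribution_eq using Y(2) T(2) by simp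
  have eq: "sample_block N {1..n} \<alpha>' \<omega> i = ?m (?Y \<omega> i) (?T \<omega> i)" if i: "i \<in> {1..N}" for \<omega> i
  proof
    fix k
    have "restrict \<alpha> {1..k} = restrict \<alpha>' {1..k}" if "k \<le> j"
    proof -
      have "restrict \<beta> {1..k} = restrict (restrict \<beta> {1..j}) {1..k}" for \<beta> :: "nat \<Rightarrow> nat"
        using that by (auto simp: fun_eq_iff)
      then show ?thesis using common by metis
    qed
    then show "sample_block N {1..n} \<alpha>' \<omega> i k = ?m (?Y \<omega> i) (?T \<omega> i) k"
      using i j by (auto simp: sample_block_def merge_def)
  qed
  have "(\<integral>\<^sup>+\<omega>. F (?Y \<omega>) * (\<Prod>i=1..N. ennreal (D (sample_block N {1..n} \<alpha>' \<omega> i))) \<partial>P) =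
      (\<integral>\<^sup>+\<omega>. ?g (?Y \<omega>, ?T \<omega>) \<partial>P)"
    by (intro nn_integral_cong) (simp add: eq)
  also have "\<dots> = (\<integral>\<^sup>+p. ?g p \<partial>distr P (samples N {1..n} \<Otimes>\<^sub>M samples N ?J) (\<lambda>\<omega>. (?Y \<omega>, ?T \<omega>)))"
    by (rule nn_integral_distr[OF measurable_Pair[OF Y(1) T(1)], symmetric]) (simp only: measurable_distr_eq1 g)
  also have "\<dots> = (\<integral>\<^sup>+p. ?g p \<partial>(samples N {1..n} \<Otimes>\<^sub>M samples N ?J))" by (simp only: joint)
  also have "\<dots> = (\<integral>\<^sup>+y. \<integral>\<^sup>+t. ?g (y, t) \<partial>samples N ?J \<partial>samples N {1..n})"
    by (rule TS.nn_integral_fst[symmetric, OF g])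
  also have "\<dots> = (\<integral>\<^sup>+z. F z * (\<Prod>i=1..N. integrate_tail j D (restrict (z i) {1..j})) \<partial>samples N {1..n})"
  proof (rule nn_integral_cong)
    fix y assume y: "y \<in> space (samples N {1..n})"
    have yi: "restrict (y i) {1..j} \<in> space (PiM {1..j} \<mu>)" if "i \<in> {1..N}" for i
      by (auto simp: space_PiM_\<mu>)
    have m1: "(\<lambda>t. ennreal (D (?m (y i) t))) \<in> borel_measurable (PiM ?J \<mu>)" if "i \<in> {1..N}" for i
      by (rule measurable_compose[OF measurable_Pair1'[OF yi[OF that]]]) measurable
    have m2: "(\<lambda>t. ennreal (D (?m (y i) (t i)))) \<in> borel_measurable (samples N ?J)" if "i \<in> {1..N}" for i
      by (rule measurable_compose[OF measurable_component_singleton[OF that] m1[OF that]])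
    have "(\<integral>\<^sup>+t. ?g (y, t) \<partial>samples N ?J) = F y * (\<integral>\<^sup>+t. (\<Prod>i=1..N. ennreal (D (?m (y i) (t i)))) \<partial>samples N ?J)"
      unfolding prod.case by (intro nn_integral_cmult borel_measurable_prod_ennreal m2)
    also have "(\<integral>\<^sup>+t. (\<Prod>i=1..N. ennreal (D (?m (y i) (t i)))) \<partial>samples N ?J) =
        (\<Prod>i=1..N. \<integral>\<^sup>+t. ennreal (D (?m (y i) t)) \<partial>PiM ?J \<mu>)"
      by (rule TP.product_nn_integral_prod[where f="\<lambda>i t. ennreal (D (?m (y i) t))"]) (use m1 in auto)
    finally show "(\<integral>\<^sup>+t. ?g (y, t) \<partial>samples N ?J) =
        F y * (\<Prod>i=1..N. integrate_tail j D (restrict (y i) {1..j}))"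
      unfolding integrate_tail_def .
  qed
  finally show ?thesis .
qed

text \<open>The first \<open>j\<close> coordinates are fixed and the others are free.\<close>

lemma card_common_prefix:
  assumes N: "N \<in> admissible n \<gamma>" and \<alpha>: "\<alpha> \<in> branches \<gamma> N n" and j: "j \<le> n"
  shows "real (card {\<alpha>' \<in> branches \<gamma> N n. restrict \<alpha> {1..j} = restrict \<alpha>' {1..j}})
    = exp (real N * ((1 - \<Gamma> j) * ln 2))"
proof -
  have "{\<alpha>' \<in> branches \<gamma> N n. restrict \<alpha> {1..j} = restrict \<alpha>' {1..j}} =
      PiE {1..n} (\<lambda>k. if k \<le> j then {\<alpha> k} else {1..num_branches \<gamma> N k})" (is "?L = ?R")
  proof (intro equalityI subsetI)
    fix \<alpha>' assume a: "\<alpha>' \<in> ?L"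
    have "\<alpha>' k = \<alpha> k" if "k \<in> {1..n}" "k \<le> j" for k
      using a that by (auto dest!: fun_cong[of _ _ k])
    with a show "\<alpha>' \<in> ?R" by (auto simp: branches_def PiE_iff)
  next
    fix \<alpha>' assume a: "\<alpha>' \<in> ?R"
    have eq: "\<alpha>' k = \<alpha> k" if "k \<in> {1..j}" for k
      using a that j by (auto simp: PiE_iff dest!: bspec[of _ _ k])
    have "\<alpha>' k \<in> {1..num_branches \<gamma> N k}" if k: "k \<in> {1..n}" for k
    proof (cases "k \<le> j")
      case True
      then show ?thesis using eq[of k] \<alpha> k by (auto simp: branches_def PiE_iff)
    next
      case False
      then show ?thesis using a k by (auto simp: PiE_iff dest!: bspec[of _ _ k])
    qed
    with a eq show "\<alpha>' \<in> ?L" by (auto simp: branches_def PiE_iff restrict_def fun_eq_iff)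
  qed
  then have "real (card {\<alpha>' \<in> branches \<gamma> N n. restrict \<alpha> {1..j} = restrict \<alpha>' {1..j}}) =
      (\<Prod>k=1..n. if k \<le> j then 1 else real (num_branches \<gamma> N k))"
    by (simp add: card_PiE) (intro prod.cong, auto)
  also have "\<dots> = (\<Prod>k=1..n. exp (real N * ln 2 * (if k \<le> j then 0 else \<gamma> k)))"
    by (intro prod.cong refl) (auto simp: num_branches_eq_exp[OF N] \<gamma>_pos mult_ac)
  also have "\<dots> = exp (real N * ln 2 * (\<Sum>k=1..n. if k \<le> j then 0 else \<gamma> k))"
    by (simp add: exp_sum[symmetric] sum_distrib_left)
  also have "(\<Sum>k=1..n. if k \<le> j then 0 else \<gamma> k) = (\<Sum>k=1..n. \<gamma> k) - (\<Sum>k=1..n. if k \<le> j then \<gamma> k else 0)"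
    unfolding sum_subtractf[symmetric] by (intro sum.cong) auto
  also have "(\<Sum>k=1..n. if k \<le> j then \<gamma> k else 0) = \<Gamma> j"
    using j by (intro sum.mono_neutral_cong_right) auto
  finally show ?thesis unfolding \<gamma>_sum by (simp only: mult_ac)
qed

text \<open>The second moment compares the density of \<open>\<nu>\<close> with those of its marginals, so versions of all of them are
  fixed.\<close>

context
  fixes \<nu> :: "(nat \<Rightarrow> 'a) measure" and D :: "nat \<Rightarrow> (nat \<Rightarrow> 'a) \<Rightarrow> real"
  assumes \<nu>: "\<nu> \<in> laws"
    and D_meas: "\<And>j. j \<in> {1..n} \<Longrightarrow> D j \<in> borel_measurable (PiM {1..j} \<mu>)"
    and D_nonneg: "\<And>j x. j \<in> {1..n} \<Longrightarrow> 0 \<le> D j x"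
    and D_density: "\<And>j. j \<in> {1..n} \<Longrightarrow> marginal j \<nu> = density (PiM {1..j} \<mu>) (D j)"
begin

lemma n_in: "n \<in> {1..n}" using n_pos by simp

lemma AE_integrate_tail_samples:
  assumes j: "j \<in> {1..n}"
  shows "AE z in samples N {1..n}. \<forall>i\<in>{1..N}.
    integrate_tail j (D n) (restrict (z i) {1..j}) = ennreal (D j (restrict (z i) {1..j}))"
proof -
  interpret PJ: prob_space "PiM {1..j} \<mu>" by (rule prob_PiM)
  have jn: "j \<le> n" using j by simp
  have [measurable]: "D n \<in> borel_measurable M" by (rule D_meas[OF n_in])
  have "density (PiM {1..j} \<mu>) (integrate_tail j (D n)) = density (PiM {1..j} \<mu>) (D j)"
    using density_integrate_tail[OF \<nu> jn D_meas[OF n_in]] D_density[OF n_in] D_density[OF j] marginal_full[OF \<nu>]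
    by simp
  then have "AE x in PiM {1..j} \<mu>. integrate_tail j (D n) x = ennreal (D j x)"
    using integrate_tail_measurable[OF jn D_meas[OF n_in]] D_meas[OF j] by (intro PJ.density_unique) auto
  then have "AE x in distr M (PiM {1..j} \<mu>) (\<lambda>x. restrict x {1..j}). integrate_tail j (D n) x = ennreal (D j x)"
    by (simp only: distr_restrict_PiM[OF jn])
  then have ae: "AE x in M. integrate_tail j (D n) (restrict x {1..j}) = ennreal (D j (restrict x {1..j}))"
    by (rule AE_distrD[rotated]) (use jn in \<open>auto intro!: restrict_measurable\<close>)
  have "AE z in samples N {1..n}. integrate_tail j (D n) (restrict (z i) {1..j}) = ennreal (D j (restrict (z i) {1..j}))"
    if "i \<in> {1..N}" for i
    by (rule AE_PiM_component[where M="\<lambda>_. M", OF prob_PiM that ae])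
  then show ?thesis by (intro AE_finite_allI) auto
qed

lemma samples_density:
  "PiM {1..N} (\<lambda>_. \<nu>) = density (samples N {1..n}) (\<lambda>z. \<Prod>i=1..N. ennreal (D n (z i)))"
proof -
  have eq: "\<nu> = density M (D n)" using D_density[OF n_in] marginal_full[OF \<nu>] by simp
  show ?thesis
    using density_PiM_prod[OF prob_PiM[of "{1..n}"], of "\<lambda>x. ennreal (D n x)" N] prob_measuresD(1)[OF \<nu>]
      D_meas[OF n_in] eq by simp
qed

text \<open>In \<open>W\<close> the branches are weighted by a truncated density, so that \<open>W\<close> has mean \<open>p\<close>. Pairs of branches that
  split at the root are independent and contribute \<open>p\<^sup>2\<close>. If a pair shares exactly \<open>j \<ge> 1\<close> levels, drop the
  truncation of the second weight and integrate out its fresh part: what remains is a product of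
  \<open>D j\<close>, which the truncation of the first weight bounds by \<open>c j\<close>. Counting pairs gives the
  variance, and Chebyshev's inequality the claim.\<close>

lemma second_moment_bound:
  assumes N: "N \<in> admissible n \<gamma>" and A: "A \<in> sets (samples N {1..n})"
    and c: "\<And>j. j \<in> {1..n} \<Longrightarrow> 0 \<le> c j"
      "\<And>j z. j \<in> {1..n} \<Longrightarrow> z \<in> A \<Longrightarrow> (\<Prod>i=1..N. D j (restrict (z i) {1..j})) \<le> c j"
  defines "V \<equiv> \<lambda>z. indicator A z * (\<Prod>i=1..N. D n (z i))"
    and "p \<equiv> measure (PiM {1..N} (\<lambda>_. \<nu>)) A"
  defines "W \<equiv> \<lambda>\<omega>. (\<Sum>\<alpha>\<in>branches \<gamma> N n. V (sample_block N {1..n} \<alpha> \<omega>)) / real (card (branches \<gamma> N n))"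
  shows "W \<in> borel_measurable P"
    "prob {\<omega> \<in> space P. 1 / 4 \<le> \<bar>W \<omega> - p\<bar>} \<le> 16 * (\<Sum>j=1..n. c j * exp (- (real N * (\<Gamma> j * ln 2))))"
proof -
  let ?S = "samples N {1..n}"
  let ?B = "branches \<gamma> N n"
  let ?c = "\<lambda>\<alpha> \<alpha>' j. if restrict \<alpha> {1..j} = restrict \<alpha>' {1..j} then c j else 0"
  let ?Y = "sample_block N {1..n}"
  interpret S: prob_space ?S by (rule prob_samples)
  interpret NS: prob_space "PiM {1..N} (\<lambda>_. \<nu>)"
    by (intro prob_space_PiM prob_measuresD(1)[OF \<nu>])
  note [measurable] = A D_meas[OF n_in]
  have V_meas[measurable]: "V \<in> borel_measurable ?S" unfolding V_def by measurable
  have Pn: "0 \<le> (\<Prod>i=1..N. D n (z i))" for z by (intro prod_nonneg D_nonneg[OF n_in] ballI)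
  have V0: "0 \<le> V z" for z using Pn[of z] by (simp add: V_def)
  have Vc: "V z \<le> c n" for z
  proof (cases "z \<in> A")
    case True
    then have "restrict (z i) {1..n} = z i" if "i \<in> {1..N}" for i
      using that sets.sets_into_space[OF A] by (auto simp: space_PiM space_PiM_\<mu> PiE_iff extensional_restrict)
    then show ?thesis using c(2)[OF n_in True] True by (simp add: V_def)
  qed (use c(1)[OF n_in] in \<open>simp add: V_def\<close>)
  have V_le: "ennreal (V z) \<le> (\<Prod>i=1..N. ennreal (D n (z i)))" for z
    using Pn[of z] D_nonneg[OF n_in] by (auto simp: V_def indicator_def prod_ennreal)
  have "(\<integral>\<^sup>+z. ennreal (V z) \<partial>?S) = (\<integral>\<^sup>+z. (\<Prod>i=1..N. ennreal (D n (z i))) * indicator A z \<partial>?S)"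
    using D_nonneg[OF n_in] by (intro nn_integral_cong) (auto simp: V_def indicator_def prod_ennreal)
  also have "\<dots> = emeasure (PiM {1..N} (\<lambda>_. \<nu>)) A"
    unfolding samples_density by (rule emeasure_density[symmetric]) (auto simp: A)
  also have "\<dots> = ennreal p" by (simp add: p_def NS.emeasure_eq_measure)
  finally have VS: "(\<integral>\<^sup>+z. ennreal (V z) \<partial>?S) = ennreal p" .
  have p: "0 \<le> p" "p \<le> 1" by (auto simp: p_def)
  have n_ne: "{1..n} \<noteq> {}" using n_pos by simp
  have Y[measurable]: "?Y \<alpha> \<in> measurable P ?S" and Yd: "distr P ?S (?Y \<alpha>) = ?S" if "\<alpha> \<in> ?B" for \<alpha>
    using measurable_sample_block[OF N, of "{1..n}" \<alpha>] distr_sample_block[OF N _ n_ne, of \<alpha>]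
      branches_prefix[OF that] by auto
  define U where "U = (\<lambda>\<alpha> \<omega>. V (?Y \<alpha> \<omega>))"
  have U_meas[measurable]: "U \<alpha> \<in> borel_measurable P" if "\<alpha> \<in> ?B" for \<alpha>
    unfolding U_def using Y[OF that] by measurable
  have U0: "0 \<le> U \<alpha> \<omega>" and Uc: "U \<alpha> \<omega> \<le> c n" for \<alpha> \<omega> using V0 Vc by (auto simp: U_def)
  have U_int: "integrable P (U \<alpha>)" if "\<alpha> \<in> ?B" for \<alpha>
    using U0 Uc U_meas[OF that] by (intro integrable_const_bound[of _ "c n"]) (auto intro!: AE_I2)
  have UU_int: "integrable P (\<lambda>\<omega>. U \<alpha> \<omega> * U \<alpha>' \<omega>)" if "\<alpha> \<in> ?B" "\<alpha>' \<in> ?B" for \<alpha> \<alpha>'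
    using U0 Uc c(1)[OF n_in] U_meas[OF that(1)] U_meas[OF that(2)]
    by (intro integrable_const_bound[of _ "c n * c n"]) (auto intro!: AE_I2 mult_mono simp: abs_mult)
  have EU: "expectation (U \<alpha>) = p" if \<alpha>: "\<alpha> \<in> ?B" for \<alpha>
  proof -
    have "(\<integral>\<^sup>+\<omega>. ennreal (U \<alpha> \<omega>) \<partial>P) = (\<integral>\<^sup>+z. ennreal (V z) \<partial>distr P ?S (?Y \<alpha>))"
      unfolding U_def using Y[OF \<alpha>] by (subst nn_integral_distr) auto
    then have "(\<integral>\<^sup>+\<omega>. ennreal (U \<alpha> \<omega>) \<partial>P) = ennreal p" by (simp only: Yd[OF \<alpha>] VS)
    then show ?thesis using U0 p U_meas[OF \<alpha>] by (subst integral_eq_nn_integral) auto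
  qed
  have EUU: "expectation (\<lambda>\<omega>. U \<alpha> \<omega> * U \<alpha>' \<omega>) \<le>
      p\<^sup>2 + (\<Sum>j=1..n. ?c \<alpha> \<alpha>' j)"
    if \<alpha>: "\<alpha> \<in> ?B" and \<alpha>': "\<alpha>' \<in> ?B" for \<alpha> \<alpha>'
  proof (cases "restrict \<alpha> {1..1} = restrict \<alpha>' {1..1}")
    case False
    have prefix: "restrict \<alpha> {1..k} \<noteq> restrict \<alpha>' {1..k}" if "k \<in> {1..n}" for k
    proof
      assume "restrict \<alpha> {1..k} = restrict \<alpha>' {1..k}"
      then have "restrict (restrict \<alpha> {1..k}) {1..1} = restrict (restrict \<alpha>' {1..k}) {1..1}" by simp
      then show False using that False by simp
    qed
    have "indep_var ?S (?Y \<alpha>) ?S (?Y \<alpha>')"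
      using branches_prefix[OF \<alpha>] branches_prefix[OF \<alpha>'] prefix by (intro indep_sample_blocks[OF N]) auto
    then have "indep_var borel (V \<circ> ?Y \<alpha>) borel (V \<circ> ?Y \<alpha>')"
      by (rule indep_var_compose) auto
    then have "indep_var borel (U \<alpha>) borel (U \<alpha>')" by (simp add: U_def comp_def)
    then have "expectation (\<lambda>\<omega>. U \<alpha> \<omega> * U \<alpha>' \<omega>) = p * p"
      using indep_var_lebesgue_integral[OF _ U_int[OF \<alpha>] U_int[OF \<alpha>']] EU[OF \<alpha>] EU[OF \<alpha>'] by simp
    then show ?thesis
      using sum_nonneg[of "{1..n}" "?c \<alpha> \<alpha>'"] c(1)
      by (simp only: power2_eq_square) simp
  next
    case True
    \<comment> \<open>the last level at which the two branches agree\<close>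
    define j where "j = Max {j \<in> {1..n}. restrict \<alpha> {1..j} = restrict \<alpha>' {1..j}}"
    have "1 \<in> {j \<in> {1..n}. restrict \<alpha> {1..j} = restrict \<alpha>' {1..j}}" using True n_pos by simp
    then have "j \<in> {j \<in> {1..n}. restrict \<alpha> {1..j} = restrict \<alpha>' {1..j}}"
      unfolding j_def by (intro Max_in) auto
    then have j: "j \<in> {1..n}" "restrict \<alpha> {1..j} = restrict \<alpha>' {1..j}" by auto
    have differ: "restrict \<alpha> {1..k} \<noteq> restrict \<alpha>' {1..k}" if "k \<in> {j+1..n}" for k
    proof
      assume "restrict \<alpha> {1..k} = restrict \<alpha>' {1..k}"
      then have "k \<le> j" unfolding j_def using that by (intro Max_ge) auto
      then show False using that by simp
    qed
    have "expectation (\<lambda>\<omega>. U \<alpha> \<omega> * U \<alpha>' \<omega>) \<le> c j * p"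
    proof (cases "j = n")
      case True
      have "\<alpha> = \<alpha>'" using j(2) True \<alpha> \<alpha>' by (simp add: branches_def PiE_iff extensional_restrict)
      have "expectation (\<lambda>\<omega>. U \<alpha> \<omega> * U \<alpha>' \<omega>) \<le> expectation (\<lambda>\<omega>. c n * U \<alpha>' \<omega>)"
        using Uc U0 by (intro integral_mono UU_int \<alpha> \<alpha>' integrable_mult_right U_int mult_right_mono)
      then show ?thesis using EU[OF \<alpha>'] True by simp
    next
      case False
      have jn: "j < n" using False j(1) by simp
      have "ennreal (expectation (\<lambda>\<omega>. U \<alpha> \<omega> * U \<alpha>' \<omega>)) = (\<integral>\<^sup>+\<omega>. ennreal (U \<alpha> \<omega> * U \<alpha>' \<omega>) \<partial>P)"
        using U0 by (intro nn_integral_eq_integral[symmetric] UU_int \<alpha> \<alpha>' AE_I2) auto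
      also have "\<dots> \<le> (\<integral>\<^sup>+\<omega>. ennreal (V (?Y \<alpha> \<omega>)) * (\<Prod>i=1..N. ennreal (D n (?Y \<alpha>' \<omega> i))) \<partial>P)"
        using V_le V0 by (intro nn_integral_mono) (auto simp: U_def ennreal_mult intro!: mult_left_mono)
      also have "\<dots> = (\<integral>\<^sup>+z. ennreal (V z) * (\<Prod>i=1..N. integrate_tail j (D n) (restrict (z i) {1..j})) \<partial>?S)"
        by (rule nn_integral_branching_pair[OF N \<alpha> \<alpha>' jn j(2) differ D_meas[OF n_in]]) auto
      also have "\<dots> \<le> (\<integral>\<^sup>+z. ennreal (c j) * ennreal (V z) \<partial>?S)"
      proof (rule nn_integral_mono_AE)
        show "AE z in ?S. ennreal (V z) * (\<Prod>i=1..N. integrate_tail j (D n) (restrict (z i) {1..j})) \<le> ennreal (c j) * ennreal (V z)"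
          using AE_integrate_tail_samples[OF j(1)]
        proof eventually_elim
          case (elim z)
          show ?case
          proof (cases "z \<in> A")
            case True
            have "(\<Prod>i=1..N. integrate_tail j (D n) (restrict (z i) {1..j})) = (\<Prod>i=1..N. ennreal (D j (restrict (z i) {1..j})))"
              using elim by (intro prod.cong) auto
            also have "\<dots> = ennreal (\<Prod>i=1..N. D j (restrict (z i) {1..j}))"
              by (intro prod_ennreal D_nonneg[OF j(1)])
            also have "\<dots> \<le> ennreal (c j)" using c(2)[OF j(1) True] by (rule ennreal_leI)
            finally show ?thesis by (subst mult.commute) (rule mult_right_mono, auto)
          qed (simp add: V_def)
        qed
      qed
      also have "\<dots> = ennreal (c j * p)"
        using c(1)[OF j(1)] p by (subst nn_integral_cmult) (auto simp: VS ennreal_mult)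
      finally show ?thesis using c(1)[OF j(1)] p by (simp add: ennreal_le_iff)
    qed
    also have "\<dots> \<le> c j * 1" using c(1)[OF j(1)] p by (intro mult_left_mono)
    also have "c j * 1 = (if restrict \<alpha> {1..j} = restrict \<alpha>' {1..j} then c j else 0)" using j(2) by simp
    also have "\<dots> \<le> (\<Sum>j=1..n. ?c \<alpha> \<alpha>' j)"
      using j(1) c(1) by (intro member_le_sum) auto
    finally show ?thesis using zero_le_power2[of p] by linarith
  qed
  define K where "K = real (card ?B)"
  have K: "K = exp (real N * ln 2)" using card_branches[OF N, of n] \<gamma>_sum by (simp add: K_def)
  then have K0: "0 < K" by simp
  have W: "W = (\<lambda>\<omega>. (\<Sum>\<alpha>\<in>?B. U \<alpha> \<omega>) / K)" by (simp add: W_def U_def K_def)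
  show W_meas: "W \<in> borel_measurable P" unfolding W using U_meas by measurable
  have W_sq: "(W \<omega>)\<^sup>2 = (\<Sum>\<alpha>\<in>?B. \<Sum>\<alpha>'\<in>?B. U \<alpha> \<omega> * U \<alpha>' \<omega>) / K\<^sup>2" for \<omega>
    by (simp add: W power_divide power2_eq_square sum_product)
  have W_sq_int: "integrable P (\<lambda>\<omega>. (W \<omega>)\<^sup>2)"
    unfolding W_sq by (intro Bochner_Integration.integrable_divide Bochner_Integration.integrable_sum UU_int)
  have W_int: "integrable P W"
    unfolding W by (intro Bochner_Integration.integrable_divide Bochner_Integration.integrable_sum U_int)
  have EW: "expectation W = p"
  proof -
    have "expectation W = (\<Sum>\<alpha>\<in>?B. expectation (U \<alpha>)) / K"
      unfolding W using U_int by (simp add: Bochner_Integration.integral_sum)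
    then show ?thesis using EU K0 by (simp add: K_def)
  qed
  have "expectation (\<lambda>\<omega>. (W \<omega>)\<^sup>2) = (\<Sum>\<alpha>\<in>?B. \<Sum>\<alpha>'\<in>?B. expectation (\<lambda>\<omega>. U \<alpha> \<omega> * U \<alpha>' \<omega>)) / K\<^sup>2"
    unfolding W_sq using UU_int by (simp add: Bochner_Integration.integral_sum)
  also have "\<dots> \<le> (\<Sum>\<alpha>\<in>?B. \<Sum>\<alpha>'\<in>?B. p\<^sup>2 + (\<Sum>j=1..n. ?c \<alpha> \<alpha>' j)) / K\<^sup>2"
    by (intro divide_right_mono sum_mono EUU) auto
  also have "(\<Sum>\<alpha>\<in>?B. \<Sum>\<alpha>'\<in>?B. p\<^sup>2 + (\<Sum>j=1..n. ?c \<alpha> \<alpha>' j)) =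
      (\<Sum>\<alpha>\<in>?B. K * p\<^sup>2 + (\<Sum>j=1..n. c j * exp (real N * ((1 - \<Gamma> j) * ln 2))))"
  proof (rule sum.cong[OF refl])
    fix \<alpha> assume \<alpha>: "\<alpha> \<in> ?B"
    have "(\<Sum>\<alpha>'\<in>?B. \<Sum>j=1..n. ?c \<alpha> \<alpha>' j) =
        (\<Sum>j=1..n. \<Sum>\<alpha>'\<in>?B. ?c \<alpha> \<alpha>' j)"
      by (rule sum.swap)
    also have "\<dots> = (\<Sum>j=1..n. c j * exp (real N * ((1 - \<Gamma> j) * ln 2)))"
    proof (rule sum.cong[OF refl])
      fix j assume "j \<in> {1..n}"
      then have "real (card {\<alpha>' \<in> ?B. restrict \<alpha> {1..j} = restrict \<alpha>' {1..j}}) = exp (real N * ((1 - \<Gamma> j) * ln 2))"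
        by (intro card_common_prefix[OF N \<alpha>]) simp
      moreover have "(\<Sum>\<alpha>'\<in>?B. ?c \<alpha> \<alpha>' j) =
          (\<Sum>\<alpha>'\<in>{\<alpha>' \<in> ?B. restrict \<alpha> {1..j} = restrict \<alpha>' {1..j}}. c j)"
        by (rule sum.inter_filter[OF finite_branches, symmetric])
      ultimately show "(\<Sum>\<alpha>'\<in>?B. ?c \<alpha> \<alpha>' j) =
          c j * exp (real N * ((1 - \<Gamma> j) * ln 2))" by (simp only: sum_constant mult.commute)
    qed
    finally show "(\<Sum>\<alpha>'\<in>?B. p\<^sup>2 + (\<Sum>j=1..n. ?c \<alpha> \<alpha>' j)) =
        K * p\<^sup>2 + (\<Sum>j=1..n. c j * exp (real N * ((1 - \<Gamma> j) * ln 2)))"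
      by (simp add: sum.distrib K_def)
  qed
  also have "\<dots> / K\<^sup>2 = p\<^sup>2 + (\<Sum>j=1..n. c j * exp (real N * ((1 - \<Gamma> j) * ln 2))) / K"
    using K0 by (simp add: K_def[symmetric] power2_eq_square field_simps)
  also have "(\<Sum>j=1..n. c j * exp (real N * ((1 - \<Gamma> j) * ln 2))) / K = (\<Sum>j=1..n. c j * exp (- (real N * (\<Gamma> j * ln 2))))"
  proof -
    have "exp (real N * ((1 - g) * ln 2)) = exp (- (real N * (g * ln 2))) * K" for g
      unfolding K exp_add[symmetric] by (simp add: algebra_simps)
    then show ?thesis using K0 by (simp add: sum_divide_distrib)
  qed
  finally have var: "variance W \<le> (\<Sum>j=1..n. c j * exp (- (real N * (\<Gamma> j * ln 2))))"
    using variance_eq[OF W_int W_sq_int] by (simp add: EW)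
  have "prob {\<omega> \<in> space P. 1 / 4 \<le> \<bar>W \<omega> - p\<bar>} \<le> variance W / (1 / 4)\<^sup>2"
    using Chebyshev_inequality[OF W_meas W_sq_int, of "1 / 4"] by (simp add: EW)
  also have "\<dots> = 16 * variance W" by (simp add: power2_eq_square)
  finally show "prob {\<omega> \<in> space P. 1 / 4 \<le> \<bar>W \<omega> - p\<bar>} \<le> 16 * (\<Sum>j=1..n. c j * exp (- (real N * (\<Gamma> j * ln 2))))"
    using var by simp
qed

end

section \<open>The lower bound\<close>

lemma marginal_densities:
  assumes \<nu>: "\<nu> \<in> laws"
    and fin: "\<And>j. j \<in> {1..n} \<Longrightarrow> rel_entropy (marginal j \<nu>) (PiM {1..j} \<mu>) \<noteq> \<infinity>"
  obtains D :: "nat \<Rightarrow> (nat \<Rightarrow> 'a) \<Rightarrow> real" where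
    "\<And>j. j \<in> {1..n} \<Longrightarrow> D j \<in> borel_measurable (PiM {1..j} \<mu>)" "\<And>j x. j \<in> {1..n} \<Longrightarrow> 0 \<le> D j x"
    "\<And>j. j \<in> {1..n} \<Longrightarrow> marginal j \<nu> = density (PiM {1..j} \<mu>) (D j)"
    "\<And>j. j \<in> {1..n} \<Longrightarrow> integrable (marginal j \<nu>) (\<lambda>x. ln (D j x))"
    "\<And>j. j \<in> {1..n} \<Longrightarrow>
      rel_entropy (marginal j \<nu>) (PiM {1..j} \<mu>) = ereal (\<integral>x. ln (D j x) \<partial>marginal j \<nu>)"
proof -
  let ?Q = "\<lambda>j D. D \<in> borel_measurable (PiM {1..j} \<mu>) \<and> (\<forall>x. 0 \<le> D x) \<and>
    marginal j \<nu> = density (PiM {1..j} \<mu>) (\<lambda>x. ennreal (D x)) \<and>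
    integrable (marginal j \<nu>) (\<lambda>x. ln (D x)) \<and>
    rel_entropy (marginal j \<nu>) (PiM {1..j} \<mu>) = ereal (\<integral>x. ln (D x) \<partial>marginal j \<nu>)"
  have "\<forall>j\<in>{1..n}. \<exists>D. ?Q j D"
  proof
    fix j assume j: "j \<in> {1..n}"
    then have jn: "j \<le> n" by simp
    have ac: "absolutely_continuous (PiM {1..j} \<mu>) (marginal j \<nu>)"
      using fin[OF j] by (auto simp: rel_entropy_def split: if_splits)
    obtain D where D: "D \<in> borel_measurable (PiM {1..j} \<mu>)" "\<And>x. 0 \<le> D x"
      "marginal j \<nu> = density (PiM {1..j} \<mu>) D"
      and ent: "rel_entropy (marginal j \<nu>) (PiM {1..j} \<mu>) =
        (if integrable (marginal j \<nu>) (\<lambda>x. ln (D x)) then ereal (\<integral>x. ln (D x) \<partial>marginal j \<nu>) else \<infinity>)"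
      using absolutely_continuous_real_density[OF prob_PiM prob_marginal[OF \<nu> jn] sets_marginal ac] by metis
    have "integrable (marginal j \<nu>) (\<lambda>x. ln (D x))" using fin[OF j] ent by (auto split: if_splits)
    with D ent show "\<exists>D. ?Q j D" by (intro exI[of _ D]) simp
  qed
  from bchoice[OF this] obtain D where all: "\<forall>j\<in>{1..n}. ?Q j (D j)" by (rule exE)
  have "?Q j (D j)" if "j \<in> {1..n}" for j by (rule bspec[OF all that])
  then show ?thesis by (intro that[of D]) blast+
qed

text \<open>Here \<open>A N\<close> collects the samples that are typical for \<open>\<nu>\<close>: averages of the functions in \<open>F\<close> and of their
  negatives force the empirical measure into a neighbourhood of \<open>\<nu>\<close> where \<open>\<Phi> > \<Phi> \<nu> - \<epsilon>\<close>, and averages of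
  the log-densities bound the products of the \<open>D j\<close>, which is the truncation that
  \<open>second_moment_bound\<close> asks for. Strictness of the entropy constraints makes its bound exponentially
  small.\<close>

lemma strict_lower_bound:
  assumes \<Phi>: "continuous_map (weak_topology (power_top n)) euclideanreal \<Phi>"
    and \<nu>: "\<nu> \<in> laws"
    and strict: "\<And>j. j \<in> {1..n} \<Longrightarrow> rel_entropy (marginal j \<nu>) (PiM {1..j} \<mu>) < ereal (\<Gamma> j * ln 2)"
    and h: "rel_entropy \<nu> M = ereal h" and \<epsilon>: "0 < \<epsilon>"
  shows "AE \<omega> in P. \<forall>\<^sub>F N in sizes.
    ln 2 + (\<Phi> \<nu> - h) - 3 * \<epsilon> \<le> ln (partition_sum \<Phi> N \<omega>) / real N"
proof -
  have fin: "rel_entropy (marginal j \<nu>) (PiM {1..j} \<mu>) \<noteq> \<infinity>" if "j \<in> {1..n}" for j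
    using strict[OF that] by auto
  obtain D where D: "\<And>j. j \<in> {1..n} \<Longrightarrow> D j \<in> borel_measurable (PiM {1..j} \<mu>)"
    "\<And>j x. j \<in> {1..n} \<Longrightarrow> 0 \<le> D j x"
    "\<And>j. j \<in> {1..n} \<Longrightarrow> marginal j \<nu> = density (PiM {1..j} \<mu>) (D j)"
    and lnD: "\<And>j. j \<in> {1..n} \<Longrightarrow> integrable (marginal j \<nu>) (\<lambda>x. ln (D j x))"
    and ent: "\<And>j. j \<in> {1..n} \<Longrightarrow>
      rel_entropy (marginal j \<nu>) (PiM {1..j} \<mu>) = ereal (\<integral>x. ln (D j x) \<partial>marginal j \<nu>)"
    using marginal_densities[OF \<nu> fin] by blast
  define H where "H j = (\<integral>x. ln (D j x) \<partial>marginal j \<nu>)" for j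
  have H: "rel_entropy (marginal j \<nu>) (PiM {1..j} \<mu>) = ereal (H j)" "H j < \<Gamma> j * ln 2"
    if "j \<in> {1..n}" for j
    using ent[OF that] strict[OF that] by (simp_all add: H_def)
  have n_in: "n \<in> {1..n}" using n_pos by simp
  have hH: "h = H n" using H(1)[OF n_in] h marginal_full[OF \<nu>] by simp
  define W where "W = {\<nu>' \<in> laws. \<Phi> \<nu> - \<epsilon> < \<Phi> \<nu>'}"
  have Wo: "openin (weak_topology (power_top n)) W"
    using openin_continuous_map_preimage[OF \<Phi>, of "{\<Phi> \<nu> - \<epsilon><..}"] by (simp add: W_def)
  have \<nu>W: "\<nu> \<in> W" using \<nu> \<epsilon> by (simp add: W_def)
  obtain F r where F: "finite F" "0 < r" "F \<subseteq> bounded_measurable M"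
    "\<And>\<nu>'. \<nu>' \<in> laws \<Longrightarrow>
      (\<And>f. f \<in> F \<Longrightarrow> \<bar>(\<integral>x. f x \<partial>\<nu>') - (\<integral>x. f x \<partial>\<nu>)\<bar> < r) \<Longrightarrow> \<nu>' \<in> W"
    using weak_neighbourhood_bounded_measurable[OF Wo \<nu>W] by metis
  define \<delta>0 where "\<delta>0 = Min ((\<lambda>j. \<Gamma> j * ln 2 - H j) ` {1..n})"
  have \<delta>0: "0 < \<delta>0" "\<And>j. j \<in> {1..n} \<Longrightarrow> \<delta>0 \<le> \<Gamma> j * ln 2 - H j"
    unfolding \<delta>0_def using H(2) n_in by (subst Min_gr_iff) auto
  \<comment> \<open>small for the neighbourhood of \<open>\<nu>\<close> and for the gaps \<open>\<Gamma> j ln 2 - H j\<close>, of which half is left\<close>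
  define \<delta> where "\<delta> = min \<epsilon> (min (r / 2) (\<delta>0 / 2))"
  have \<delta>: "0 < \<delta>" "\<delta> \<le> \<epsilon>" "\<delta> < r" "\<delta> \<le> \<delta>0 / 2" using \<epsilon> F(2) \<delta>0(1) by (auto simp: \<delta>_def)
  define g where "g = (\<lambda>j x. ln (D j (restrict x {1..j})))"
  have g_meas: "g j \<in> borel_measurable M" if j: "j \<in> {1..n}" for j
  proof -
    have [measurable]: "D j \<in> borel_measurable (PiM {1..j} \<mu>)" by (rule D(1)[OF j])
    have [measurable]: "(\<lambda>x. restrict x {1..j}) \<in> measurable M (PiM {1..j} \<mu>)"
      using j by (intro restrict_measurable) auto
    show ?thesis unfolding g_def by measurable
  qed
  have g_int: "integrable \<nu> (g j)" "(\<integral>x. g j x \<partial>\<nu>) = H j" if j: "j \<in> {1..n}" for j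
  proof -
    have jn: "j \<le> n" using j by simp
    note r = restrict_measurable_marginal[OF \<nu> jn]
    have m: "(\<lambda>x. ln (D j x)) \<in> borel_measurable (borel_algebra (power_top j))"
    proof -
      have "(\<lambda>x. ln (D j x)) \<in> borel_measurable (PiM {1..j} \<mu>)"
        using D(1)[OF j] by measurable
      then show ?thesis unfolding measurable_cong_sets[OF sets_PiM_power_top[of j] refl] .
    qed
    show "integrable \<nu> (g j)"
      using lnD[OF j] unfolding marginal_def g_def by (rule integrable_distr[OF r])
    show "(\<integral>x. g j x \<partial>\<nu>) = H j"
      unfolding H_def marginal_def g_def integral_distr[OF r m] ..
  qed
  interpret V: prob_space \<nu> by (rule prob_measuresD(1)[OF \<nu>])
  define G where "G = F \<union> (\<lambda>f x. - f x) ` F \<union> g ` {1..n}"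
  have F_bm: "f \<in> bounded_measurable M" "f \<in> borel_measurable M" "integrable \<nu> f" if "f \<in> F" for f
  proof -
    show 1: "f \<in> bounded_measurable M" using F(3) that by blast
    then show "f \<in> borel_measurable M" by (rule bounded_measurableD)
    show "integrable \<nu> f"
      using 1 bounded_measurable_cong[OF prob_measuresD(2)[OF \<nu>]] by (intro V.integrable_bounded_measurable) simp
  qed
  have G: "finite G" "\<And>k. k \<in> G \<Longrightarrow> integrable \<nu> k" "\<And>k. k \<in> G \<Longrightarrow> k \<in> borel_measurable M"
    using F(1) F_bm g_int g_meas by (auto simp: G_def)
  define A where "A = (\<lambda>N. {z \<in> space (samples N {1..n}). \<forall>k\<in>G. (\<Sum>i=1..N. k (z i)) \<le> real N * ((\<integral>x. k x \<partial>\<nu>) + \<delta>)})"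
  have A_sets: "A N \<in> sets (samples N {1..n})" for N
  proof -
    have "{z \<in> space (samples N {1..n}). (\<Sum>i=1..N. k (z i)) \<le> real N * ((\<integral>x. k x \<partial>\<nu>) + \<delta>)} \<in> sets (samples N {1..n})"
      if "k \<in> G" for k
    proof -
      have [measurable]: "k \<in> borel_measurable M" by (rule G(3)[OF that])
      show ?thesis by measurable
    qed
    then show ?thesis unfolding A_def by (rule sets.sets_Collect_finite_All'[OF _ G(1)]) (use n_pos in \<open>auto simp: G_def\<close>)
  qed
  have A_avg: "(\<Sum>i=1..N. k (z i)) \<le> real N * ((\<integral>x. k x \<partial>\<nu>) + \<delta>)" if "z \<in> A N" "k \<in> G" for N z k
    using that by (simp add: A_def)
  define c where "c = (\<lambda>N j. exp (real N * (H j + \<delta>)))"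
  have A_le: "(\<Prod>i=1..N. D j (restrict (z i) {1..j})) \<le> c N j" if j: "j \<in> {1..n}" and z: "z \<in> A N" for N j z
  \<comment> \<open>The product is \<open>exp (\<Sum>\<^sub>i ln (D j (z\<^sub>i)))\<close> only if no factor vanishes, as \<open>ln 0 = 0\<close>.\<close>
  proof (cases "\<exists>i\<in>{1..N}. D j (restrict (z i) {1..j}) = 0")
    case True
    then have zero: "(\<Prod>i=1..N. D j (restrict (z i) {1..j})) = 0" by (intro prod_zero) auto
    show ?thesis unfolding zero c_def by simp
  next
    case False
    then have pos: "0 < D j (restrict (z i) {1..j})" if "i \<in> {1..N}" for i
      using D(2)[OF j] that by (metis less_eq_real_def)
    have "(\<Prod>i=1..N. D j (restrict (z i) {1..j})) = (\<Prod>i=1..N. exp (g j (z i)))"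
      using pos by (intro prod.cong) (auto simp: g_def)
    also have "\<dots> = exp (\<Sum>i=1..N. g j (z i))" by (simp add: exp_sum)
    also have "\<dots> \<le> c N j"
    proof -
      have "g j \<in> G" using j by (auto simp: G_def)
      then have "(\<Sum>i=1..N. g j (z i)) \<le> real N * ((\<integral>x. g j x \<partial>\<nu>) + \<delta>)"
        by (rule A_avg[OF z])
      then show ?thesis by (simp add: c_def g_int(2)[OF j])
    qed
    finally show ?thesis .
  qed
  define p where "p = (\<lambda>N. measure (PiM {1..N} (\<lambda>_. \<nu>)) (A N))"
  have p: "\<forall>\<^sub>F N in sequentially. 1 / 2 \<le> p N"
  proof -
    have "space (PiM {1..N::nat} (\<lambda>_. \<nu>)) = space (samples N {1..n})" for N
      using prob_measuresD(2)[OF \<nu>] by (intro sets_eq_imp_space_eq sets_PiM_cong) auto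
    then show ?thesis
      using eventually_sample_averages_typical[OF prob_measuresD(1)[OF \<nu>] G(1,2) \<delta>(1)]
      by (simp add: p_def A_def)
  qed
  let ?B = "\<lambda>N. branches \<gamma> N n"
  let ?Y = "\<lambda>N. sample_block N {1..n}"
  define Q where "Q = (\<lambda>N z. indicator (A N) z * (\<Prod>i=1..N. D n (z i)))"
  define w where "w = (\<lambda>N \<omega>. (\<Sum>\<alpha>\<in>?B N. Q N (?Y N \<alpha> \<omega>)) / real (card (?B N)))"
  have sm: "w N \<in> borel_measurable P"
    "prob {\<omega> \<in> space P. 1 / 4 \<le> \<bar>w N \<omega> - p N\<bar>} \<le> 16 * (\<Sum>j=1..n. c N j * exp (- (real N * (\<Gamma> j * ln 2))))"
    if N: "N \<in> admissible n \<gamma>" for N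
    using second_moment_bound[OF \<nu> D(1) D(2) D(3) N A_sets _ A_le] unfolding w_def Q_def p_def
    by (auto simp: c_def)
  have "AE \<omega> in P. \<forall>\<^sub>F N in sizes. \<omega> \<notin> {\<omega> \<in> space P. 1 / 4 \<le> \<bar>w N \<omega> - p N\<bar>}"
  proof (rule AE_eventually_of_exp_bound)
    fix N assume N: "N \<in> admissible n \<gamma>"
    have [measurable]: "w N \<in> borel_measurable P" by (rule sm(1)[OF N])
    show "{\<omega> \<in> space P. 1 / 4 \<le> \<bar>w N \<omega> - p N\<bar>} \<in> events" by measurable
    have "(\<Sum>j=1..n. c N j * exp (- (real N * (\<Gamma> j * ln 2)))) \<le> (\<Sum>j=1..n. exp (- (real N * (\<delta>0 / 2))))"
    proof (rule sum_mono)
      fix j assume j: "j \<in> {1..n}"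
      have "c N j * exp (- (real N * (\<Gamma> j * ln 2))) = exp (real N * (H j + \<delta> - \<Gamma> j * ln 2))"
        unfolding c_def exp_add[symmetric] by (simp add: algebra_simps)
      also have "\<dots> \<le> exp (real N * - (\<delta>0 / 2))"
        using \<delta>0(2)[OF j] \<delta>(4) by (subst exp_le_cancel_iff, intro mult_left_mono) auto
      finally show "c N j * exp (- (real N * (\<Gamma> j * ln 2))) \<le> exp (- (real N * (\<delta>0 / 2)))" by simp
    qed
    then show "prob {\<omega> \<in> space P. 1 / 4 \<le> \<bar>w N \<omega> - p N\<bar>} \<le> (16 * real n) * exp (- (real N * (\<delta>0 / 2)))"
      using sm(2)[OF N] by simp
  qed (use \<delta>0 in simp)
  then show ?thesis
  proof (rule AE_mp, intro AE_I2 impI)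
    fix \<omega> assume \<omega>: "\<omega> \<in> space P"
      and close: "\<forall>\<^sub>F N in sizes. \<omega> \<notin> {\<omega> \<in> space P. 1 / 4 \<le> \<bar>w N \<omega> - p N\<bar>}"
    have large: "\<forall>\<^sub>F N in sequentially. ln 4 \<le> real N * \<epsilon>"
      using eventually_ge_at_top[of "nat \<lceil>ln 4 / \<epsilon>\<rceil>"]
    proof eventually_elim
      case (elim N)
      then have "ln 4 / \<epsilon> \<le> real N" by linarith
      then show ?case using \<epsilon> by (simp add: field_simps)
    qed
    show "\<forall>\<^sub>F N in sizes.
      ln 2 + (\<Phi> \<nu> - h) - 3 * \<epsilon> \<le> ln (partition_sum \<Phi> N \<omega>) / real N"
      using close eventually_sizesI[OF large] eventually_sizesI[OF p] eventually_admissible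
    proof eventually_elim
      case (elim N)
      note N = elim(4)
      then have N0: "0 < N" by (simp add: admissible_def)
      let ?L = "\<lambda>\<alpha>. L N \<alpha> \<omega>"
      have K: "real (card (?B N)) = exp (real N * ln 2)"
        using card_branches[OF N, of n] \<gamma>_sum by simp
      have "1 / 4 < w N \<omega>" using elim \<omega> by (auto simp: abs_real_def split: if_splits)
      then have "exp (real N * ln 2) / 4 < (\<Sum>\<alpha>\<in>?B N. Q N (?Y N \<alpha> \<omega>))"
        by (simp add: w_def K field_simps)
      then have lower: "exp (real N * ln 2) / 4 * exp (real N * (\<Phi> \<nu> - \<epsilon> - h - \<delta>)) \<le>
          (\<Sum>\<alpha>\<in>?B N. Q N (?Y N \<alpha> \<omega>)) * exp (real N * (\<Phi> \<nu> - \<epsilon> - h - \<delta>))"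
        by (intro mult_right_mono) auto
      also have "\<dots> = (\<Sum>\<alpha>\<in>?B N. Q N (?Y N \<alpha> \<omega>) * exp (real N * (\<Phi> \<nu> - \<epsilon> - h - \<delta>)))"
        by (rule sum_distrib_right)
      also have "\<dots> \<le> partition_sum \<Phi> N \<omega>"
      proof (rule sum_mono)
        fix \<alpha> assume \<alpha>: "\<alpha> \<in> ?B N"
        show "Q N (?Y N \<alpha> \<omega>) * exp (real N * (\<Phi> \<nu> - \<epsilon> - h - \<delta>)) \<le> exp (real N * \<Phi> (?L \<alpha>))"
        proof (cases "?Y N \<alpha> \<omega> \<in> A N")
          case True
          let ?z = "?Y N \<alpha> \<omega>"
          have z: "?z i = path_point n X N \<alpha> i \<omega>" if "i \<in> {1..N}" for i
            using that by (rule sample_block_path_point)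
          have "restrict (?z i) {1..n} = ?z i" if "i \<in> {1..N}" for i
            using that by (simp add: sample_block_def)
          then have "(\<Prod>i=1..N. D n (?z i)) = (\<Prod>i=1..N. D n (restrict (?z i) {1..n}))" by simp
          also have "\<dots> \<le> exp (real N * (h + \<delta>))"
            using A_le[OF n_in True] by (simp add: c_def hH)
          finally have Q: "Q N ?z \<le> exp (real N * (h + \<delta>))" using True by (simp add: Q_def)
          have L_W: "?L \<alpha> \<in> W"
          proof (rule F(4)[OF path_empirical_in_prob_measures[OF N0]])
            fix f assume f: "f \<in> F"
            have avg: "(\<integral>x. f x \<partial>?L \<alpha>) = (\<Sum>i=1..N. f (?z i)) / real N"
              using integral_path_empirical[OF N0 F_bm(1)[OF f]] z by simp
            have "f \<in> G" "(\<lambda>x. - f x) \<in> G" using f by (auto simp: G_def)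
            then have "(\<Sum>i=1..N. f (?z i)) \<le> real N * ((\<integral>x. f x \<partial>\<nu>) + \<delta>)"
              "(\<Sum>i=1..N. - f (?z i)) \<le> real N * ((\<integral>x. - f x \<partial>\<nu>) + \<delta>)"
              using A_avg[OF True, of f] A_avg[OF True, of "\<lambda>x. - f x"] by simp_all
            then have "(\<integral>x. f x \<partial>?L \<alpha>) \<le> (\<integral>x. f x \<partial>\<nu>) + \<delta>" "(\<integral>x. f x \<partial>\<nu>) - \<delta> \<le> (\<integral>x. f x \<partial>?L \<alpha>)"
              unfolding avg using N0 by (simp_all add: sum_negf divide_le_eq le_divide_eq algebra_simps)
            then show "\<bar>(\<integral>x. f x \<partial>?L \<alpha>) - (\<integral>x. f x \<partial>\<nu>)\<bar> < r" using \<delta>(3) by linarith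
          qed
          have "Q N ?z * exp (real N * (\<Phi> \<nu> - \<epsilon> - h - \<delta>)) \<le> exp (real N * (h + \<delta>)) * exp (real N * (\<Phi> \<nu> - \<epsilon> - h - \<delta>))"
            using Q by (intro mult_right_mono) auto
          also have "\<dots> = exp (real N * (\<Phi> \<nu> - \<epsilon>))"
            unfolding exp_add[symmetric] distrib_left[symmetric] by simp
          also have "\<dots> \<le> exp (real N * \<Phi> (?L \<alpha>))"
            using L_W by (auto simp: W_def intro!: mult_left_mono)
          finally show ?thesis .
        qed (simp add: Q_def)
      qed
      finally have "ln (exp (real N * ln 2) / 4 * exp (real N * (\<Phi> \<nu> - \<epsilon> - h - \<delta>))) \<le> ln (partition_sum \<Phi> N \<omega>)"
        by (intro ln_mono) auto
      moreover have "ln (exp (real N * ln 2) / 4 * exp (real N * (\<Phi> \<nu> - \<epsilon> - h - \<delta>))) =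
          real N * (ln 2 + (\<Phi> \<nu> - \<epsilon> - h - \<delta>)) - ln 4"
        by (simp add: ln_mult ln_div distrib_left)
      moreover have "real N * (ln 2 + (\<Phi> \<nu> - h) - 3 * \<epsilon>) \<le> real N * (ln 2 + (\<Phi> \<nu> - \<epsilon> - h - \<delta>)) - ln 4"
      proof -
        have "real N * (ln 2 + (\<Phi> \<nu> - h) - 3 * \<epsilon>) \<le> real N * (ln 2 + (\<Phi> \<nu> - \<epsilon> - h - \<delta>) - \<epsilon>)"
          using \<delta>(2) by (intro mult_left_mono) auto
        then show ?thesis using elim(2) by (simp add: algebra_simps)
      qed
      ultimately have "real N * (ln 2 + (\<Phi> \<nu> - h) - 3 * \<epsilon>) \<le> ln (partition_sum \<Phi> N \<omega>)" by linarith
      then show ?case using N0 by (simp add: le_divide_eq mult.commute)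
    qed
  qed
qed

lemma M_in_prob_measures: "M \<in> laws"
  by (rule prob_measuresI[OF prob_PiM refl])

text \<open>In variational form, the marginals of the reference measure have entropy at most \<open>0\<close>.\<close>

lemma mean_of_M_le:
  assumes f: "f \<in> bounded_measurable (PiM {1..j} \<mu>)" and j: "j \<le> n"
  shows "mean_of M M (\<lambda>x. f (restrict x {1..j})) \<le> log_mgf (PiM {1..j} \<mu>) f"
proof -
  interpret MM: prob_space M by (rule prob_PiM)
  have r: "(\<lambda>x. restrict x {1..j}) \<in> measurable M (PiM {1..j} \<mu>)"
    using j by (intro restrict_measurable) auto
  have g: "(\<lambda>x. f (restrict x {1..j})) \<in> bounded_measurable M"
    by (rule restrict_bounded_measurable[OF f j])
  have m: "(\<lambda>x. exp (f x)) \<in> borel_measurable (PiM {1..j} \<mu>)"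
    using bounded_measurableD(1)[OF f] by measurable
  have "log_mgf M (\<lambda>x. f (restrict x {1..j})) = log_mgf (distr M (PiM {1..j} \<mu>) (\<lambda>x. restrict x {1..j})) f"
    unfolding log_mgf_def integral_distr[OF r m] ..
  then show ?thesis
    using MM.integral_le_log_mgf[OF g] g unfolding distr_restrict_PiM[OF j] by (simp add: mean_of_def)
qed

lemma \<Gamma>_pos: "j \<in> {1..n} \<Longrightarrow> 0 < \<Gamma> j"
  using \<gamma>_pos by (intro sum_pos) auto

lemma rate_M_le: "rate n \<gamma> \<mu> M \<le> 0"
proof -
  have "mean_of M M \<in> region_means"
    unfolding region_means_def
  proof (intro CollectI conjI ballI)
    fix j f assume j: "j \<in> {1..n}" and f: "f \<in> bounded_measurable (PiM {1..j} \<mu>)"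
    have "0 \<le> \<Gamma> j * ln 2" using \<Gamma>_pos[OF j] by simp
    then show "mean_of M M (\<lambda>x. f (restrict x {1..j})) \<le> \<Gamma> j * ln 2 + log_mgf (PiM {1..j} \<mu>) f"
      using mean_of_M_le[OF f] j by fastforce
  qed (rule mean_of_in_means[OF prob_PiM refl])
  moreover have "rel_entropy M M \<le> ereal 0"
    unfolding rel_entropy_le_iff[OF M_in_prob_measures]
    using prob_space.integral_le_log_mgf[OF prob_PiM] by simp
  ultimately show ?thesis
    using mean_of_in_region_means_iff[OF M_in_prob_measures] by (simp add: rate_def zero_ereal_def)
qed

text \<open>The approximation is \<open>(1 - t) \<nu> + t \<mu>\<close> with small \<open>t > 0\<close>, constructed as a functional. The entropy bounds are
  linear in the functional, so mixing them with those of \<open>\<mu>\<close>, where the constant is \<open>0\<close>, multiplies the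
  constants by \<open>1 - t < 1\<close>.\<close>

lemma approximate_strictly:
  assumes \<nu>: "\<nu> \<in> laws" and reg: "\<nu> \<in> (\<Inter>j\<in>{1..n}. entropy_region n \<gamma> \<mu> j)"
    and h: "rel_entropy \<nu> M = ereal h" and W: "openin (weak_topology (power_top n)) W" "\<nu> \<in> W"
  obtains \<nu>' h' where "\<nu>' \<in> laws" "\<nu>' \<in> W"
    "\<And>j. j \<in> {1..n} \<Longrightarrow> rel_entropy (marginal j \<nu>') (PiM {1..j} \<mu>) < ereal (\<Gamma> j * ln 2)"
    "rel_entropy \<nu>' M = ereal h'" "h' \<le> h"
proof -
  obtain F r where F: "finite F" "0 < r" "F \<subseteq> bounded_measurable M"
    "\<And>\<nu>'. \<nu>' \<in> laws \<Longrightarrow>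
      (\<And>f. f \<in> F \<Longrightarrow> \<bar>(\<integral>x. f x \<partial>\<nu>') - (\<integral>x. f x \<partial>\<nu>)\<bar> < r) \<Longrightarrow> \<nu>' \<in> W"
    using weak_neighbourhood_bounded_measurable[OF W] by metis
  define m0 where "m0 = mean_of M \<nu>"
  define m1 where "m1 = mean_of M M"
  \<comment> \<open>The integrals of \<open>f\<close> against \<open>\<nu>\<close> and the mixture differ by \<open>t * \<bar>m1 f - m0 f\<bar> \<le> t * (1 + s) \<le> r / 2\<close>.\<close>
  define s where "s = (\<Sum>f\<in>F. \<bar>m1 f - m0 f\<bar>)"
  define t where "t = min (1 / 2) (r / (2 * (1 + s)))"
  have s: "0 \<le> s" by (simp add: s_def sum_nonneg)
  have t: "0 < t" "t < 1" using s F(2) by (auto simp: t_def)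
  define m where "m = (\<lambda>f. (1 - t) * m0 f + t * m1 f)"
  have m0: "m0 \<in> means M" unfolding m0_def by (rule mean_of_in_means[OF prob_measuresD[OF \<nu>]])
  have m1: "m1 \<in> means M" unfolding m1_def by (rule mean_of_in_means[OF prob_PiM refl])
  have m_means: "m \<in> means M" unfolding m_def using t by (intro means_convex m0 m1) auto
  have m_le: "m (\<lambda>x. f (restrict x {1..j})) \<le> (1 - t) * (\<Gamma> j * ln 2) + log_mgf (PiM {1..j} \<mu>) f"
    if j: "j \<in> {1..n}" and f: "f \<in> bounded_measurable (PiM {1..j} \<mu>)" for j f
  proof -
    have "m0 (\<lambda>x. f (restrict x {1..j})) \<le> \<Gamma> j * ln 2 + log_mgf (PiM {1..j} \<mu>) f"
      using mean_of_in_region_means_iff[OF \<nu>] reg j f by (simp add: region_means_def m0_def)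
    moreover have "m1 (\<lambda>x. f (restrict x {1..j})) \<le> log_mgf (PiM {1..j} \<mu>) f"
      unfolding m1_def using j by (intro mean_of_M_le f) auto
    ultimately have "m (\<lambda>x. f (restrict x {1..j})) \<le>
        (1 - t) * (\<Gamma> j * ln 2 + log_mgf (PiM {1..j} \<mu>) f) + t * log_mgf (PiM {1..j} \<mu>) f"
      unfolding m_def using t by (intro add_mono mult_left_mono) auto
    then show ?thesis by (simp add: algebra_simps)
  qed
  have "m \<in> region_means"
    unfolding region_means_def
  proof (intro CollectI conjI ballI m_means)
    fix j f assume j: "j \<in> {1..n}" and f: "f \<in> bounded_measurable (PiM {1..j} \<mu>)"
    have "(1 - t) * (\<Gamma> j * ln 2) \<le> 1 * (\<Gamma> j * ln 2)"
      using t \<Gamma>_pos[OF j] by (intro mult_right_mono) auto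
    then show "m (\<lambda>x. f (restrict x {1..j})) \<le> \<Gamma> j * ln 2 + log_mgf (PiM {1..j} \<mu>) f"
      using m_le[OF j f] by linarith
  qed
  note rep = region_means_represented[OF this]
  define \<nu>' where "\<nu>' = measure_of_mean M m"
  have \<nu>': "\<nu>' \<in> laws" and \<nu>'_mean: "mean_of M \<nu>' = m"
    using rep by (auto simp: \<nu>'_def)
  have int: "(\<integral>x. f x \<partial>\<nu>') = m f" if "f \<in> bounded_measurable M" for f
    using fun_cong[OF \<nu>'_mean, of f] that by (simp add: mean_of_def)
  have "\<nu>' \<in> W"
  proof (rule F(4)[OF \<nu>'])
    fix f assume f: "f \<in> F"
    then have fb: "f \<in> bounded_measurable M" using F(3) by blast
    have "(\<integral>x. f x \<partial>\<nu>') - (\<integral>x. f x \<partial>\<nu>) = t * (m1 f - m0 f)"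
      using fb by (simp add: int m_def m0_def mean_of_def algebra_simps)
    then have "\<bar>(\<integral>x. f x \<partial>\<nu>') - (\<integral>x. f x \<partial>\<nu>)\<bar> = t * \<bar>m1 f - m0 f\<bar>"
      using t by (simp add: abs_mult)
    also have "\<dots> \<le> t * (1 + s)"
      using t member_le_sum[of f F "\<lambda>f. \<bar>m1 f - m0 f\<bar>"] f F(1) by (intro mult_left_mono) (auto simp: s_def)
    also have "\<dots> \<le> r / (2 * (1 + s)) * (1 + s)" using s by (intro mult_right_mono) (auto simp: t_def)
    also have "\<dots> = r / 2" using s by (simp add: field_simps)
    also have "\<dots> < r" using F(2) by simp
    finally show "\<bar>(\<integral>x. f x \<partial>\<nu>') - (\<integral>x. f x \<partial>\<nu>)\<bar> < r" .
  qed
  moreover have "rel_entropy (marginal j \<nu>') (PiM {1..j} \<mu>) < ereal (\<Gamma> j * ln 2)" if j: "j \<in> {1..n}" for j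
  proof -
    have jn: "j \<le> n" using j by simp
    have "rel_entropy (marginal j \<nu>') (PiM {1..j} \<mu>) \<le> ereal ((1 - t) * (\<Gamma> j * ln 2))"
      unfolding rel_entropy_marginal_le_iff[OF \<nu>' jn]
    proof
      fix f assume f: "f \<in> bounded_measurable (PiM {1..j} \<mu>)"
      show "(\<integral>x. f (restrict x {1..j}) \<partial>\<nu>') \<le> (1 - t) * (\<Gamma> j * ln 2) + log_mgf (PiM {1..j} \<mu>) f"
        using m_le[OF j f] int[OF restrict_bounded_measurable[OF f jn]] by simp
    qed
    also have "(1 - t) * (\<Gamma> j * ln 2) < 1 * (\<Gamma> j * ln 2)"
      using t \<Gamma>_pos[OF j] by (intro mult_strict_right_mono) auto
    finally show ?thesis by simp
  qed
  moreover have "rel_entropy \<nu>' M \<le> ereal h"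
    unfolding rel_entropy_le_iff[OF \<nu>']
  proof
    fix f assume f: "f \<in> bounded_measurable M"
    have h0: "0 \<le> h" using rel_entropy_nonneg[OF prob_PiM prob_measuresD[OF \<nu>]] h by simp
    have "m0 f \<le> h + log_mgf M f"
      using rel_entropy_le_iff[OF \<nu>, of h] h f by (simp add: m0_def mean_of_def)
    moreover have "m1 f \<le> log_mgf M f"
      using prob_space.integral_le_log_mgf[OF prob_PiM f] f by (simp add: m1_def mean_of_def)
    ultimately have "m f \<le> (1 - t) * (h + log_mgf M f) + t * log_mgf M f"
      unfolding m_def using t by (intro add_mono mult_left_mono) auto
    also have "\<dots> = h + log_mgf M f - t * h" by (simp add: algebra_simps)
    also have "\<dots> \<le> h + log_mgf M f" using t h0 by simp
    finally show "(\<integral>x. f x \<partial>\<nu>') \<le> h + log_mgf M f" by (simp add: int[OF f])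
  qed
  moreover have "0 \<le> rel_entropy \<nu>' M" by (rule rel_entropy_nonneg[OF prob_PiM prob_measuresD[OF \<nu>']])
  ultimately show ?thesis
    using \<nu>' by (cases "rel_entropy \<nu>' M") (auto intro: that)
qed

lemma lower_bound:
  assumes \<Phi>: "continuous_map (weak_topology (power_top n)) euclideanreal \<Phi>"
    and \<nu>: "\<nu> \<in> laws"
    and s: "ereal s < ereal (\<Phi> \<nu>) - rate n \<gamma> \<mu> \<nu>" and \<epsilon>: "0 < \<epsilon>"
  shows "AE \<omega> in P. \<forall>\<^sub>F N in sizes.
    ln 2 + s - 4 * \<epsilon> \<le> ln (partition_sum \<Phi> N \<omega>) / real N"
proof -
  have reg: "\<nu> \<in> (\<Inter>j\<in>{1..n}. entropy_region n \<gamma> \<mu> j)"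
    using s by (auto simp: rate_def split: if_splits)
  then have rate: "rate n \<gamma> \<mu> \<nu> = rel_entropy \<nu> M" by (simp add: rate_def)
  have "0 \<le> rel_entropy \<nu> M" by (rule rel_entropy_nonneg[OF prob_PiM prob_measuresD[OF \<nu>]])
  then obtain h where h: "rel_entropy \<nu> M = ereal h"
    using s rate by (cases "rel_entropy \<nu> M") auto
  have sh: "s < \<Phi> \<nu> - h" using s rate h by simp
  define W where "W = {\<nu>' \<in> laws. \<Phi> \<nu> - \<epsilon> < \<Phi> \<nu>'}"
  have W: "openin (weak_topology (power_top n)) W"
    using openin_continuous_map_preimage[OF \<Phi>, of "{\<Phi> \<nu> - \<epsilon><..}"] by (simp add: W_def)
  have "\<nu> \<in> W" using \<nu> \<epsilon> by (simp add: W_def)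
  then obtain \<nu>' h' where \<nu>': "\<nu>' \<in> laws" "\<nu>' \<in> W"
    "\<And>j. j \<in> {1..n} \<Longrightarrow> rel_entropy (marginal j \<nu>') (PiM {1..j} \<mu>) < ereal (\<Gamma> j * ln 2)"
    "rel_entropy \<nu>' M = ereal h'" "h' \<le> h"
    using approximate_strictly[OF \<nu> reg h W] by metis
  have le: "s - 4 * \<epsilon> \<le> (\<Phi> \<nu>' - h') - 3 * \<epsilon>" using \<nu>'(2,5) sh by (simp add: W_def)
  have "AE \<omega> in P. \<forall>\<^sub>F N in sizes.
      ln 2 + (\<Phi> \<nu>' - h') - 3 * \<epsilon> \<le> ln (partition_sum \<Phi> N \<omega>) / real N"
    by (rule strict_lower_bound[OF \<Phi> \<nu>'(1,3,4) \<epsilon>])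
  then show ?thesis
  proof eventually_elim
    case (elim \<omega>)
    then show ?case by eventually_elim (use le in auto)
  qed
qed

section \<open>The quenched large deviation principle\<close>

text \<open>The supremum is finite: \<open>\<Phi>\<close> is bounded, the rate is nonnegative, and it vanishes at \<open>\<mu>\<close>. Both bounds hold
  almost surely for each fixed \<open>\<epsilon>\<close>; countably many \<open>\<epsilon>\<close> suffice.\<close>

lemma quenched_limit:
  assumes \<Phi>: "continuous_map (weak_topology (power_top n)) euclideanreal \<Phi>"
    and bdd: "bounded (\<Phi> ` laws)"
  shows "AE \<omega> in P. ((\<lambda>N. ereal (ln (partition_sum \<Phi> N \<omega>) / real N))
     \<longlongrightarrow> ereal (ln 2) + (SUP \<nu>\<in>laws. ereal (\<Phi> \<nu>) - rate n \<gamma> \<mu> \<nu>))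
       sizes"
proof -
  let ?S = "SUP \<nu>\<in>laws. ereal (\<Phi> \<nu>) - rate n \<gamma> \<mu> \<nu>"
  obtain b where b: "\<And>\<nu>. \<nu> \<in> laws \<Longrightarrow> \<bar>\<Phi> \<nu>\<bar> \<le> b"
    using bdd by (auto simp: bounded_iff)
  have "?S \<le> ereal b"
  proof (rule SUP_least)
    fix \<nu> :: "(nat \<Rightarrow> 'a) measure" assume \<nu>: "\<nu> \<in> laws"
    have "0 \<le> rate n \<gamma> \<mu> \<nu>"
      using prob_\<mu> sets_\<mu> by (intro rate_nonneg \<nu>) auto
    then show "ereal (\<Phi> \<nu>) - rate n \<gamma> \<mu> \<nu> \<le> ereal b"
      using b[OF \<nu>] by (cases "rate n \<gamma> \<mu> \<nu>") auto
  qed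
  moreover have "ereal (\<Phi> M) \<le> ?S"
  proof (rule SUP_upper2[OF M_in_prob_measures])
    show "ereal (\<Phi> M) \<le> ereal (\<Phi> M) - rate n \<gamma> \<mu> M"
      using rate_M_le by (cases "rate n \<gamma> \<mu> M") auto
  qed
  ultimately obtain s where s: "?S = ereal s" by (cases ?S) auto
  have step: "AE \<omega> in P. \<forall>\<^sub>F N in sizes.
      \<bar>ln (partition_sum \<Phi> N \<omega>) / real N - (ln 2 + s)\<bar> \<le> 5 * \<epsilon>" if \<epsilon>: "0 < \<epsilon>" for \<epsilon>
  proof -
    have "ereal (s - \<epsilon>) < ?S" using \<epsilon> s by simp
    then obtain \<nu> :: "(nat \<Rightarrow> 'a) measure" where \<nu>: "\<nu> \<in> laws"
      "ereal (s - \<epsilon>) < ereal (\<Phi> \<nu>) - rate n \<gamma> \<mu> \<nu>"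
      by (auto simp: less_SUP_iff)
    have up: "ereal (\<Phi> \<nu>) - rate n \<gamma> \<mu> \<nu> \<le> ereal s" if "\<nu> \<in> laws" for \<nu>
      using SUP_upper[OF that, of "\<lambda>\<nu>. ereal (\<Phi> \<nu>) - rate n \<gamma> \<mu> \<nu>"] s by simp
    have "AE \<omega> in P. \<forall>\<^sub>F N in sizes.
        ln (partition_sum \<Phi> N \<omega>) / real N \<le> ln 2 + s + 4 * \<epsilon>"
      by (rule upper_bound[OF \<Phi> up \<epsilon>])
    then show ?thesis
      using lower_bound[OF \<Phi> \<nu> \<epsilon>]
    proof eventually_elim
      case (elim \<omega>)
      show ?case using elim by eventually_elim (use \<epsilon> in \<open>auto simp: abs_le_iff\<close>)
    qed
  qed
  have "AE \<omega> in P. \<forall>k. \<forall>\<^sub>F N in sizes.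
      \<bar>ln (partition_sum \<Phi> N \<omega>) / real N - (ln 2 + s)\<bar> \<le> 5 * inverse (real (Suc k))"
    unfolding AE_all_countable by (intro allI step) simp
  then show ?thesis
  proof eventually_elim
    case (elim \<omega>)
    have "((\<lambda>N. ln (partition_sum \<Phi> N \<omega>) / real N) \<longlongrightarrow> ln 2 + s) sizes"
    proof (rule tendstoI)
      fix e :: real assume "0 < e"
      then obtain k where k: "inverse (real (Suc k)) < e / 5"
        using reals_Archimedean[of "e / 5"] by auto
      show "\<forall>\<^sub>F N in sizes. dist (ln (partition_sum \<Phi> N \<omega>) / real N) (ln 2 + s) < e"
        using elim[rule_format, of k] by eventually_elim (use k in \<open>auto simp: dist_real_def\<close>)
    qed
    then show ?case unfolding s by (simp add: tendsto_ereal)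
  qed
qed

end

theorem theorem2p3:
  fixes n :: nat
    and \<gamma> :: "nat \<Rightarrow> real"
    and \<mu> :: "nat \<Rightarrow> 'a::polish_space measure"
    and P :: "'w measure"
    and X :: "nat \<Rightarrow> nat \<Rightarrow> (nat \<Rightarrow> nat) \<Rightarrow> nat \<Rightarrow> 'w \<Rightarrow> 'a"
  assumes \<mu>: "\<And>k. k \<in> {1..n} \<Longrightarrow> prob_space (\<mu> k) \<and> sets (\<mu> k) = sets borel"
    and \<gamma>_pos: "\<And>k. k \<in> {1..n} \<Longrightarrow> \<gamma> k > 0"
    and \<gamma>_sum: "(\<Sum>k=1..n. \<gamma> k) = 1"
    and admissible_infinite: "infinite (admissible n \<gamma>)"
    and P: "prob_space P"
    and X_indep: "\<And>N. N \<in> admissible n \<gamma> \<Longrightarrow>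
      prob_space.indep_vars P (\<lambda>_. borel) (\<lambda>(j, \<beta>, i). X N j \<beta> i) (rv_indices n \<gamma> N)"
    and X_distr: "\<And>N j \<beta> i. N \<in> admissible n \<gamma> \<Longrightarrow> (j, \<beta>, i) \<in> rv_indices n \<gamma> N \<Longrightarrow>
      distr P borel (X N j \<beta> i) = \<mu> j"
  shows "(\<forall>c::real. compactin (weak_topology (power_top n))
            {\<nu> \<in> prob_measures (power_top n). rate n \<gamma> \<mu> \<nu> \<le> ereal c}) \<and>
    (\<forall>\<Phi>. continuous_map (weak_topology (power_top n)) euclideanreal \<Phi> \<and>
          bounded (\<Phi> ` prob_measures (power_top n)) \<longrightarrow>
       (AE \<omega> in P.
          ((\<lambda>N. ereal (ln (\<Sum>\<alpha>\<in>branches \<gamma> N n. exp (real N * \<Phi> (path_empirical n X N \<alpha> \<omega>))) / real N))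
             \<longlongrightarrow> ereal (ln 2) + (SUP \<nu>\<in>prob_measures (power_top n). ereal (\<Phi> \<nu>) - rate n \<gamma> \<mu> \<nu>))
          (inf sequentially (principal (admissible n \<gamma>)))))"
proof -
  \<comment> \<open>Outside \<open>{1..n}\<close> the given family is arbitrary; any probability measures will do there.\<close>
  define \<mu>' where "\<mu>' = (\<lambda>k. if k \<in> {1..n} then \<mu> k else return borel undefined)"
  interpret hierarchical_model P n \<gamma> \<mu>' X
  proof (intro hierarchical_model.intro hierarchical_model_axioms.intro)
    show "prob_space P" by fact
    show "prob_space (\<mu>' k)" "sets (\<mu>' k) = sets borel" for k
      using \<mu>[of k] by (auto simp: \<mu>'_def intro: prob_space_return)
    show "distr P borel (X N j \<beta> i) = \<mu>' j"
      if "N \<in> admissible n \<gamma>" "(j, \<beta>, i) \<in> rv_indices n \<gamma> N" for N j \<beta> i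
      using X_distr[OF that] that(2) by (simp add: \<mu>'_def rv_indices_def)
  qed (use \<gamma>_pos \<gamma>_sum X_indep in auto)
  have PiM_eq: "PiM {1..j} \<mu>' = PiM {1..j} \<mu>" if "j \<le> n" for j
    using that by (intro PiM_cong) (auto simp: \<mu>'_def)
  have "entropy_region n \<gamma> \<mu>' j = entropy_region n \<gamma> \<mu> j" if "j \<in> {1..n}" for j
    using that by (simp add: entropy_region_def PiM_eq)
  then have rate_eq: "rate n \<gamma> \<mu>' = rate n \<gamma> \<mu>"
    by (simp add: rate_def fun_eq_iff PiM_eq)
  show ?thesis
    using compactin_rate_level_set quenched_limit unfolding rate_eq by blast
qed

end
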